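(* Let $\rho>0$ and let $T=(T_1,\ldots,T_n)\in B(\mathcal H)^n$ be an $n$-tuple of operators. The following statements are equivalent: (i) $T$ is of class $\mathcal C_\rho$; (ii) the von Neumann type inequality $$\|p(T_1,\ldots,T_n)\|\le\|\rho\,p(S_1,\ldots,S_n)+(1-\rho)p(0)\|$$ holds for every noncommutative polynomial with matrix coefficients $p\in\mathbb C[Z_1,\ldots,Z_n]\otimes M_m$, $m\in\mathbb N$; (iii) the map $\Psi_T:\mathcal A_n\to B(\mathcal H)$ defined by $$\Psi_T(q(S_1,\ldots,S_n)):=\frac1\rho\,q(T_1,\ldots,T_n)+\Big(1-\frac1\rho\Big)q(0)I,\qquad q(S_1,\ldots,S_n)\in\mathcal P(S_1,\ldots,S_n),$$ is completely contractive.
   Context: Let $n\ge1$ and let $\mathcal H$ be a complex Hilbert space. $\mathbb F_n^+$ is the unital free semigroup on generators $g_1,\ldots,g_n$ with identity $g_0$. For $T\in B(\mathcal H)^n$, $T_\alpha:=T_{i_1}\cdots T_{i_k}$ if $\alpha=g_{i_1}\cdots g_{i_k}$, and $T_{g_0}:=I$. For $\rho\in(0,\infty)$, $T\in B(\mathcal H)^n$ is of class $\mathcal C_\rho$ if there exist a Hilbert space $\mathcal G\supseteq\mathcal H$ and isometries $V_1,\ldots,V_n\in B(\mathcal G)$ with mutually orthogonal ranges such that $T_\alpha=\rho P_{\mathcal H}V_\alpha|_{\mathcal H}$ for all $\alpha\in\mathbb F_n^+\setminus\{g_0\}$. $F^2(H_n)=\mathbb C1\oplus\bigoplus_{k\ge1}H_n^{\otimes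 k}$ is the full Fock space of an $n$-dimensional Hilbert space $H_n$ with orthonormal basis $e_1,\ldots,e_n$; the left creation operators are $S_i\varphi:=e_i\otimes\varphi$. $\mathbb C[Z_1,\ldots,Z_n]$ is the algebra of polynomials in $n$ noncommuting indeterminates and $\mathcal P(S_1,\ldots,S_n):=\{q(S_1,\ldots,S_n):q\in\mathbb C[Z_1,\ldots,Z_n]\}$; the noncommutative disc algebra $\mathcal A_n$ is its norm closure. The map in (iii) is given on the dense subalgebra $\mathcal P(S_1,\ldots,S_n)$; the condition is that it is completely contractive there (hence extends uniquely to a completely contractive map on $\mathcal A_n$). For $p=\sum_\alpha Z_\alpha\otimes M_\alpha\in\mathbb C[Z_1,\ldots,Z_n]\otimes M_m$ ($M_m$ the $m\times m$ complex matrices), $p(T):=\sum_\alpha T_\alpha\otimes M_\alpha$, and $p(0):=I\otimes M_{g_0}$ is the constant term. *)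

theory Defs
  imports
    "HOL-Analysis.Analysis"
    "HOL-Library.Function_Algebras"
    "Jordan_Normal_Form.Matrix"
begin

section \<open>Complex vector spaces\<close>

class complex_vector = ab_group_add +
  fixes scaleC :: "complex \<Rightarrow> 'a \<Rightarrow> 'a" (infixr \<open>*\<^sub>C\<close> 75)
  assumes scaleC_add_right: "a *\<^sub>C (x + y) = a *\<^sub>C x + a *\<^sub>C y"
    and scaleC_add_left: "(a + b) *\<^sub>C x = a *\<^sub>C x + b *\<^sub>C x"
    and scaleC_scaleC: "a *\<^sub>C b *\<^sub>C x = (a * b) *\<^sub>C x"
    and scaleC_one: "1 *\<^sub>C x = x"

global_interpretation complex_vector:
  vector_space "scaleC :: complex \<Rightarrow> 'a \<Rightarrow> 'a :: complex_vector"
  defines csubspace = "complex_vector.subspace"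
    and cspan = "complex_vector.span"
  by unfold_locales
    (simp_all add: scaleC_add_right scaleC_add_left scaleC_scaleC scaleC_one)

instantiation complex :: complex_vector
begin
definition "a *\<^sub>C (x :: complex) = a * x"
instance
  by standard (simp_all add: scaleC_complex_def algebra_simps)
end

instantiation "fun" :: (type, complex_vector) complex_vector
begin
definition "a *\<^sub>C f = (\<lambda>x. a *\<^sub>C f x)"
instance
  by standard (simp_all add: scaleC_fun_def fun_eq_iff scaleC_add_right scaleC_add_left
    scaleC_scaleC scaleC_one)
end

lemma scaleC_fun_apply [simp]: "(a *\<^sub>C f) x = a *\<^sub>C f x"
  by (simp add: scaleC_fun_def)

lemma sum_fun_apply: "(\<Sum>i\<in>I. f i) x = (\<Sum>i\<in>I. f i x)"
  by (induction I rule: infinite_finite_induct) simp_all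


section \<open>Hilbert spaces\<close>

text \<open>
  A Hilbert space is given by a carrier, which is a linear subspace of some complex vector space
  type, together with an inner product on it (linear in the first argument). Carriers are needed
  because the definition of the class \<open>C\<^sub>\<rho>\<close> quantifies existentially over Hilbert spaces,
  so a Hilbert space must be a term and cannot be a type. Values of inner products and operators
  outside the carriers are irrelevant.
\<close>

record 'a hilb =
  hspace :: "'a set"
  hinner :: "'a \<Rightarrow> 'a \<Rightarrow> complex"

definition hnorm :: "'a hilb \<Rightarrow> 'a \<Rightarrow> real" where
  "hnorm H x = sqrt (Re (hinner H x x))"

definition hcauchy :: "'a::complex_vector hilb \<Rightarrow> (nat \<Rightarrow> 'a) \<Rightarrow> bool" where
  "hcauchy H X \<longleftrightarrow> (\<forall>e>0. \<exists>N. \<forall>m\<ge>N. \<forall>n\<ge>N. hnorm H (X m - X n) < e)"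

definition hlim :: "'a::complex_vector hilb \<Rightarrow> (nat \<Rightarrow> 'a) \<Rightarrow> 'a \<Rightarrow> bool" where
  "hlim H X l \<longleftrightarrow> (\<lambda>n. hnorm H (X n - l)) \<longlonglongrightarrow> 0"

locale hilbert_space =
  fixes H :: "'a::complex_vector hilb"
  assumes subspace: "csubspace (hspace H)"
    and inner_add: "\<lbrakk>x \<in> hspace H; y \<in> hspace H; z \<in> hspace H\<rbrakk>
          \<Longrightarrow> hinner H (x + y) z = hinner H x z + hinner H y z"
    and inner_scale: "\<lbrakk>x \<in> hspace H; y \<in> hspace H\<rbrakk>
          \<Longrightarrow> hinner H (c *\<^sub>C x) y = c * hinner H x y"
    and inner_cnj: "\<lbrakk>x \<in> hspace H; y \<in> hspace H\<rbrakk>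
          \<Longrightarrow> hinner H y x = cnj (hinner H x y)"
    and inner_pos: "\<lbrakk>x \<in> hspace H; x \<noteq> 0\<rbrakk> \<Longrightarrow> 0 < Re (hinner H x x)"
    and complete: "\<lbrakk>\<And>n. X n \<in> hspace H; hcauchy H X\<rbrakk> \<Longrightarrow> \<exists>l\<in>hspace H. hlim H X l"

definition bounded_op ::
  "'a::complex_vector hilb \<Rightarrow> 'b::complex_vector hilb \<Rightarrow> ('a \<Rightarrow> 'b) \<Rightarrow> bool" where
  "bounded_op H K A \<longleftrightarrow>
     (\<forall>x\<in>hspace H. A x \<in> hspace K) \<and>
     (\<forall>x\<in>hspace H. \<forall>y\<in>hspace H. A (x + y) = A x + A y) \<and>
     (\<forall>c. \<forall>x\<in>hspace H. A (c *\<^sub>C x) = c *\<^sub>C A x) \<and>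
     (\<exists>B. \<forall>x\<in>hspace H. hnorm K (A x) \<le> B * hnorm H x)"

definition isometric_op ::
  "'a::complex_vector hilb \<Rightarrow> 'b::complex_vector hilb \<Rightarrow> ('a \<Rightarrow> 'b) \<Rightarrow> bool" where
  "isometric_op H K V \<longleftrightarrow>
     bounded_op H K V \<and> (\<forall>x\<in>hspace H. hnorm K (V x) = hnorm H x)"

definition opnorm :: "'a hilb \<Rightarrow> ('a \<Rightarrow> 'a) \<Rightarrow> real" where
  "opnorm H A = Sup {hnorm H (A x) | x. x \<in> hspace H \<and> hnorm H x \<le> 1}"

definition orth_proj :: "'a::complex_vector hilb \<Rightarrow> 'a set \<Rightarrow> 'a \<Rightarrow> 'a" where
  "orth_proj H M x = (THE y. y \<in> M \<and> (\<forall>z\<in>M. hinner H (x - y) z = 0))"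


subsection \<open>Orthogonal projections exist\<close>

context hilbert_space
begin

lemma zero_mem [simp]: "0 \<in> hspace H"
  and add_mem [simp]: "x \<in> hspace H \<Longrightarrow> y \<in> hspace H \<Longrightarrow> x + y \<in> hspace H"
  and diff_mem [simp]: "x \<in> hspace H \<Longrightarrow> y \<in> hspace H \<Longrightarrow> x - y \<in> hspace H"
  and scale_mem [simp]: "x \<in> hspace H \<Longrightarrow> c *\<^sub>C x \<in> hspace H"
  using subspace complex_vector.subspace_0 complex_vector.subspace_add
    complex_vector.subspace_diff complex_vector.subspace_scale by blast+

lemma inner_add_right: "\<lbrakk>x \<in> hspace H; y \<in> hspace H; z \<in> hspace H\<rbrakk>
    \<Longrightarrow> hinner H z (x + y) = hinner H z x + hinner H z y"
  by (metis add_mem complex_cnj_add inner_add inner_cnj)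

lemma inner_scale_right: "\<lbrakk>x \<in> hspace H; y \<in> hspace H\<rbrakk>
    \<Longrightarrow> hinner H y (c *\<^sub>C x) = cnj c * hinner H y x"
  by (metis scale_mem complex_cnj_mult inner_scale inner_cnj)

lemma inner_diff: "\<lbrakk>x \<in> hspace H; y \<in> hspace H; z \<in> hspace H\<rbrakk>
    \<Longrightarrow> hinner H (x - y) z = hinner H x z - hinner H y z"
  by (metis add_diff_cancel diff_add_cancel diff_mem inner_add)

lemma inner_diff_right: "\<lbrakk>x \<in> hspace H; y \<in> hspace H; z \<in> hspace H\<rbrakk>
    \<Longrightarrow> hinner H z (x - y) = hinner H z x - hinner H z y"
  by (metis add_diff_cancel diff_add_cancel diff_mem inner_add_right)

lemma inner_zero [simp]: "x \<in> hspace H \<Longrightarrow> hinner H 0 x = 0"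
  by (metis diff_self inner_diff)

lemma inner_zero_right [simp]: "x \<in> hspace H \<Longrightarrow> hinner H x 0 = 0"
  by (metis diff_self inner_diff_right)

lemma inner_self_nonneg: "x \<in> hspace H \<Longrightarrow> 0 \<le> Re (hinner H x x)"
  by (cases "x = 0") (auto dest: inner_pos)

lemma inner_self: "x \<in> hspace H \<Longrightarrow> hinner H x x = complex_of_real ((hnorm H x)\<^sup>2)"
  using inner_cnj[of x x] inner_self_nonneg[of x]
  by (auto simp: hnorm_def complex_eq_iff)

lemma hnorm_nonneg: "x \<in> hspace H \<Longrightarrow> 0 \<le> hnorm H x"
  by (simp add: hnorm_def inner_self_nonneg)

lemma hnorm_eq_0: "x \<in> hspace H \<Longrightarrow> hnorm H x = 0 \<longleftrightarrow> x = 0"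
  using inner_pos[of x] by (cases "x = 0") (auto simp: hnorm_def)

lemma hnorm_sq: "x \<in> hspace H \<Longrightarrow> (hnorm H x)\<^sup>2 = Re (hinner H x x)"
  by (simp add: hnorm_def inner_self_nonneg)

lemma hnorm_diff_sq:
  assumes "x \<in> hspace H" "y \<in> hspace H"
  shows "(hnorm H (x - y))\<^sup>2 = (hnorm H x)\<^sup>2 - 2 * Re (hinner H x y) + (hnorm H y)\<^sup>2"
  using assms inner_cnj[of x y] by (simp add: hnorm_sq inner_diff inner_diff_right)

lemma hnorm_add_sq:
  assumes "x \<in> hspace H" "y \<in> hspace H"
  shows "(hnorm H (x + y))\<^sup>2 = (hnorm H x)\<^sup>2 + 2 * Re (hinner H x y) + (hnorm H y)\<^sup>2"
  using assms inner_cnj[of x y] by (simp add: hnorm_sq inner_add inner_add_right)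

lemma hnorm_scale: "x \<in> hspace H \<Longrightarrow> hnorm H (c *\<^sub>C x) = cmod c * hnorm H x"
proof -
  assume x: "x \<in> hspace H"
  have "(hnorm H (c *\<^sub>C x))\<^sup>2 = Re (c * cnj c * hinner H x x)"
    using x by (simp only: hnorm_sq scale_mem inner_scale inner_scale_right ac_simps)
  also have "c * cnj c * hinner H x x = complex_of_real ((cmod c * hnorm H x)\<^sup>2)"
    using x by (simp add: inner_self complex_norm_square[symmetric] power_mult_distrib)
  also have "Re \<dots> = (cmod c * hnorm H x)\<^sup>2" by (rule Re_complex_of_real)
  finally show ?thesis
    using x by (simp add: hnorm_nonneg power2_eq_iff_nonneg)
qed

lemma hnorm_minus_commute:
  assumes "x \<in> hspace H" "y \<in> hspace H"
  shows "hnorm H (x - y) = hnorm H (y - x)"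
proof -
  have "y - x = (-1) *\<^sub>C (x - y)" by simp
  then show ?thesis using assms hnorm_scale[of "x - y" "-1"] by simp
qed

lemma best_coefficient:
  assumes "x \<in> hspace H" "y \<in> hspace H" "y \<noteq> 0"
  shows "(hnorm H (x - (hinner H x y / hinner H y y) *\<^sub>C y))\<^sup>2
       = (hnorm H x)\<^sup>2 - (cmod (hinner H x y))\<^sup>2 / (hnorm H y)\<^sup>2"
proof -
  define a where "a = hinner H x y"
  define r where "r = (hnorm H y)\<^sup>2"
  have r: "r > 0" using assms by (simp add: r_def hnorm_eq_0 hnorm_nonneg)
  define c where "c = a / complex_of_real r"
  have "(hnorm H (x - c *\<^sub>C y))\<^sup>2 = (hnorm H x)\<^sup>2 - 2 * Re (cnj c * a) + (cmod c)\<^sup>2 * r"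
    using assms by (simp add: hnorm_diff_sq inner_scale_right hnorm_scale power_mult_distrib
        a_def r_def)
  also have "cnj c * a = complex_of_real ((cmod a)\<^sup>2 / r)"
    using complex_norm_square[of a] by (simp add: c_def mult.commute)
  also have "(cmod c)\<^sup>2 * r = (cmod a)\<^sup>2 / r"
    using r by (simp add: c_def norm_divide power_divide power2_eq_square)
  finally show ?thesis
    using assms by (simp add: a_def r_def c_def inner_self)
qed

lemma cauchy_schwarz:
  assumes "x \<in> hspace H" "y \<in> hspace H"
  shows "cmod (hinner H x y) \<le> hnorm H x * hnorm H y"
proof (cases "y = 0")
  case True
  then show ?thesis using assms by (simp add: hnorm_def)
next
  case False
  have "0 \<le> (hnorm H x)\<^sup>2 - (cmod (hinner H x y))\<^sup>2 / (hnorm H y)\<^sup>2"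
    using best_coefficient[OF assms False] by (metis zero_le_power2)
  moreover have "hnorm H y > 0"
    using assms False by (simp add: hnorm_eq_0 hnorm_nonneg order_less_le)
  ultimately have "(cmod (hinner H x y))\<^sup>2 \<le> (hnorm H x * hnorm H y)\<^sup>2"
    by (simp add: field_simps power_mult_distrib)
  then show ?thesis
    using assms by (meson hnorm_nonneg mult_nonneg_nonneg power2_le_imp_le)
qed

lemma triangle:
  assumes "x \<in> hspace H" "y \<in> hspace H"
  shows "hnorm H (x + y) \<le> hnorm H x + hnorm H y"
proof -
  have "Re (hinner H x y) \<le> hnorm H x * hnorm H y"
    using cauchy_schwarz[OF assms] complex_Re_le_cmod order_trans by blast
  then have "(hnorm H (x + y))\<^sup>2 \<le> (hnorm H x + hnorm H y)\<^sup>2"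
    using assms by (simp add: hnorm_add_sq power2_sum)
  then show ?thesis
    using assms by (auto intro: power2_le_imp_le add_nonneg_nonneg hnorm_nonneg)
qed

lemma triangle_diff:
  assumes "x \<in> hspace H" "y \<in> hspace H" "z \<in> hspace H"
  shows "hnorm H (x - z) \<le> hnorm H (x - y) + hnorm H (y - z)"
  using triangle[of "x - y" "y - z"] assms by simp

lemma orth_proj_unique:
  assumes "csubspace M" "M \<subseteq> hspace H" "x \<in> hspace H"
    and "y \<in> M" "\<forall>z\<in>M. hinner H (x - y) z = 0"
    and "y' \<in> M" "\<forall>z\<in>M. hinner H (x - y') z = 0"
  shows "y = y'"
proof -
  have m: "y - y' \<in> M" using complex_vector.subspace_diff[OF assms(1,4,6)] .
  have H: "y \<in> hspace H" "y' \<in> hspace H" "y - y' \<in> hspace H" using assms(2,4,6) m by auto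
  have "hinner H ((x - y') - (x - y)) (y - y') = 0"
    using H assms(3,5,7) m by (subst inner_diff) auto
  then have "hinner H (y - y') (y - y') = 0" by simp
  then have "hnorm H (y - y') = 0" by (simp add: hnorm_def)
  then show ?thesis using H(3) hnorm_eq_0[of "y - y'"] by simp
qed

lemma orth_proj_exists:
  assumes M: "csubspace M" "M \<subseteq> hspace H" and x: "x \<in> hspace H"
    and cM: "\<And>X. (\<And>n. X n \<in> M) \<Longrightarrow> hcauchy H X \<Longrightarrow> \<exists>l\<in>M. hlim H X l"
  shows "\<exists>y\<in>M. \<forall>z\<in>M. hinner H (x - y) z = 0"
proof -
  define D where "D = (\<lambda>y. (hnorm H (x - y))\<^sup>2) ` M"
  define d where "d = Inf D"
  have M0: "0 \<in> M" using complex_vector.subspace_0[OF M(1)] .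
  have bdd: "bdd_below D" unfolding D_def by (rule bdd_belowI[of _ 0]) auto
  have low: "d \<le> (hnorm H (x - y))\<^sup>2" if "y \<in> M" for y
    unfolding d_def by (rule cInf_lower[OF _ bdd]) (use that in \<open>auto simp: D_def\<close>)
  have "\<exists>y\<in>M. (hnorm H (x - y))\<^sup>2 < d + 1 / real (Suc n)" for n
  proof -
    have "Inf D < d + 1 / real (Suc n)" by (simp add: d_def)
    moreover have "D \<noteq> {}" using M0 by (auto simp: D_def)
    ultimately obtain t where "t \<in> D" "t < d + 1 / real (Suc n)"
      using cInf_lessD by blast
    then show ?thesis by (auto simp: D_def)
  qed
  then obtain Y where Y: "\<And>n. Y n \<in> M"
    and Yd: "\<And>n. (hnorm H (x - Y n))\<^sup>2 < d + 1 / real (Suc n)" by metis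
  have YH: "Y n \<in> hspace H" for n using Y M by blast
  have par: "(hnorm H (Y n - Y m))\<^sup>2 \<le> 2 / real (Suc n) + 2 / real (Suc m)" for n m
  proof -
    define u where "u = x - Y n"
    define v where "v = x - Y m"
    have uv: "u \<in> hspace H" "v \<in> hspace H" using x YH by (auto simp: u_def v_def)
    have half: "(1/2 :: complex) *\<^sub>C (a + a) = a" for a :: 'a
    proof -
      have "(1/2 :: complex) *\<^sub>C (a + a) = (1/2 + 1/2 :: complex) *\<^sub>C a"
        by (simp only: scaleC_add_right scaleC_add_left)
      then show ?thesis by (simp add: scaleC_one)
    qed
    have mid: "(1/2) *\<^sub>C (Y n + Y m) \<in> M"
      by (intro complex_vector.subspace_scale[OF M(1)] complex_vector.subspace_add[OF M(1)] Y)
    have "x - (1/2) *\<^sub>C (Y n + Y m) = (1/2) *\<^sub>C (u + v)"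
    proof -
      have "(1/2) *\<^sub>C (u + v) = (1/2) *\<^sub>C ((x + x) - (Y n + Y m))"
        by (simp add: u_def v_def algebra_simps)
      also have "\<dots> = x - (1/2) *\<^sub>C (Y n + Y m)"
        by (simp add: half complex_vector.scale_right_diff_distrib)
      finally show ?thesis by simp
    qed
    then have "d \<le> (hnorm H ((1/2) *\<^sub>C (u + v)))\<^sup>2" using low[OF mid] by simp
    also have "\<dots> = (hnorm H (u + v))\<^sup>2 / 4"
      using uv by (simp add: hnorm_scale norm_divide power_divide)
    finally have "4 * d \<le> (hnorm H (u + v))\<^sup>2" by simp
    moreover have "(hnorm H (u + v))\<^sup>2 + (hnorm H (u - v))\<^sup>2
        = 2 * (hnorm H u)\<^sup>2 + 2 * (hnorm H v)\<^sup>2"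
      using uv by (simp add: hnorm_add_sq hnorm_diff_sq)
    moreover have "hnorm H (u - v) = hnorm H (Y n - Y m)"
      using YH by (simp add: u_def v_def hnorm_minus_commute)
    ultimately show ?thesis using Yd[of n] Yd[of m] by (simp add: u_def v_def)
  qed
  have "hcauchy H Y"
    unfolding hcauchy_def
  proof (intro allI impI)
    fix e :: real assume e: "e > 0"
    then obtain N where N: "4 / e\<^sup>2 < real N" using reals_Archimedean2 by blast
    have "hnorm H (Y m - Y n) < e" if "m \<ge> N" "n \<ge> N" for m n
    proof -
      have Np: "0 < real (Suc N)" by simp
      have "2 / real (Suc m) \<le> 2 / real (Suc N)" "2 / real (Suc n) \<le> 2 / real (Suc N)"
        using that by (auto intro!: divide_left_mono)
      then have "(hnorm H (Y m - Y n))\<^sup>2 \<le> 4 / real (Suc N)"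
        using par[of m n] by simp
      also have "\<dots> < e\<^sup>2"
      proof -
        have "4 < real N * e\<^sup>2" using N e by (simp add: field_simps)
        also have "\<dots> \<le> real (Suc N) * e\<^sup>2" by (simp add: mult_right_mono)
        finally show ?thesis by (simp add: field_simps)
      qed
      finally show ?thesis using e by (auto intro: power2_less_imp_less)
    qed
    then show "\<exists>N. \<forall>m\<ge>N. \<forall>n\<ge>N. hnorm H (Y m - Y n) < e" by blast
  qed
  then obtain y where y: "y \<in> M" and lim: "hlim H Y y" using cM Y by blast
  have yH: "y \<in> hspace H" using y M by blast
  have "(\<lambda>n. sqrt (d + 1 / real (Suc n)) + hnorm H (Y n - y)) \<longlonglongrightarrow> sqrt (d + 0) + 0"
    using lim unfolding hlim_def
    by (intro tendsto_intros LIMSEQ_Suc[OF lim_inverse_n'])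
  moreover have "hnorm H (x - y) \<le> sqrt (d + 1 / real (Suc n)) + hnorm H (Y n - y)" for n
  proof -
    have "hnorm H (x - Y n) \<le> sqrt (d + 1 / real (Suc n))"
      using Yd[of n] by (simp add: real_le_rsqrt)
    then show ?thesis using triangle_diff[OF x YH yH, of n] by linarith
  qed
  ultimately have "hnorm H (x - y) \<le> sqrt d"
    by (metis (no_types, lifting) LIMSEQ_le_const add.right_neutral)
  moreover have d0: "0 \<le> d" unfolding d_def
    by (rule cInf_greatest) (use M0 in \<open>auto simp: D_def\<close>)
  ultimately have xy: "(hnorm H (x - y))\<^sup>2 \<le> d"
    using x yH by (metis diff_mem hnorm_nonneg power_mono real_sqrt_pow2)
  have "hinner H (x - y) z = 0" if z: "z \<in> M" for z
  proof (cases "z = 0")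
    case True
    then show ?thesis using x yH by simp
  next
    case False
    have zH: "z \<in> hspace H" using z M by blast
    define c where "c = hinner H (x - y) z / hinner H z z"
    have "y + c *\<^sub>C z \<in> M"
      by (intro complex_vector.subspace_scale[OF M(1)] complex_vector.subspace_add[OF M(1)] y z)
    then have "d \<le> (hnorm H (x - y - c *\<^sub>C z))\<^sup>2" using low by (simp add: diff_diff_eq)
    also have "\<dots> = (hnorm H (x - y))\<^sup>2 - (cmod (hinner H (x - y) z))\<^sup>2 / (hnorm H z)\<^sup>2"
      unfolding c_def using x yH zH False by (intro best_coefficient) auto
    finally have "(cmod (hinner H (x - y) z))\<^sup>2 / (hnorm H z)\<^sup>2 \<le> 0" using xy by simp
    moreover have "hnorm H z > 0"
      using zH False by (simp add: hnorm_eq_0 hnorm_nonneg order_less_le)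
    ultimately show ?thesis by (simp add: divide_le_0_iff)
  qed
  then show ?thesis using y by blast
qed

lemma orth_proj_eqI:
  assumes "csubspace M" "M \<subseteq> hspace H" "x \<in> hspace H"
    and "y \<in> M" "\<forall>z\<in>M. hinner H (x - y) z = 0"
  shows "orth_proj H M x = y"
  unfolding orth_proj_def
proof (rule the_equality)
  show "y \<in> M \<and> (\<forall>z\<in>M. hinner H (x - y) z = 0)" using assms(4,5) by (rule conjI)
next
  fix y' assume "y' \<in> M \<and> (\<forall>z\<in>M. hinner H (x - y') z = 0)"
  then show "y' = y" using orth_proj_unique[OF assms(1-3) _ _ assms(4,5)] by simp
qed

end

section \<open>Operators indexed by words and the class \<open>C\<^sub>\<rho>\<close>\<close>

text \<open>
  The generators are indexed by a finite type \<open>'n\<close>, so \<open>n = CARD('n) \<ge> 1\<close>, and the free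
  monoid on them is \<open>'n list\<close> with identity \<open>[]\<close>.
\<close>

primrec word_op :: "('n \<Rightarrow> 'a \<Rightarrow> 'a) \<Rightarrow> 'n list \<Rightarrow> 'a \<Rightarrow> 'a" where
  "word_op T [] = id"
| "word_op T (i # \<alpha>) = T i \<circ> word_op T \<alpha>"

text \<open>
  The inclusion of \<open>H\<close> into \<open>G\<close> is an isometric embedding \<open>J\<close>; the dilation identity is stated
  in \<open>G\<close>, where \<open>H\<close> is \<open>J ` hspace H\<close>.
\<close>

definition rho_dilation ::
  "real \<Rightarrow> 'h::complex_vector hilb \<Rightarrow> ('n \<Rightarrow> 'h \<Rightarrow> 'h) \<Rightarrow>
   'g::complex_vector hilb \<Rightarrow> ('h \<Rightarrow> 'g) \<Rightarrow> ('n \<Rightarrow> 'g \<Rightarrow> 'g) \<Rightarrow> bool" where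
  "rho_dilation \<rho> H T G J V \<longleftrightarrow>
     hilbert_space G \<and> isometric_op H G J \<and>
     (\<forall>i. isometric_op G G (V i)) \<and>
     (\<forall>i j. i \<noteq> j \<longrightarrow> (\<forall>x\<in>hspace G. \<forall>y\<in>hspace G. hinner G (V i x) (V j y) = 0)) \<and>
     (\<forall>\<alpha>. \<alpha> \<noteq> [] \<longrightarrow> (\<forall>h\<in>hspace H.
        J (word_op T \<alpha> h)
          = complex_of_real \<rho> *\<^sub>C orth_proj G (J ` hspace H) (word_op V \<alpha> (J h))))"

text \<open>
  HOL cannot quantify over the type carrying \<open>G\<close>, so one sufficiently large type is fixed here.
  The lemma \<open>class_C_I\<close> below shows that this is no restriction: a dilation
  carried by any type whatsoever yields membership in the class.
\<close>

definition class_C :: "real \<Rightarrow> 'h::complex_vector hilb \<Rightarrow> ('n \<Rightarrow> 'h \<Rightarrow> 'h) \<Rightarrow> bool" where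
  "class_C \<rho> H T \<longleftrightarrow>
     (\<exists>(G :: ('n list \<times> 'h \<Rightarrow> complex) hilb) J V. rho_dilation \<rho> H T G J V)"

lemma bounded_opD:
  assumes "bounded_op H K A"
  shows "x \<in> hspace H \<Longrightarrow> A x \<in> hspace K"
    and "x \<in> hspace H \<Longrightarrow> y \<in> hspace H \<Longrightarrow> A (x + y) = A x + A y"
    and "x \<in> hspace H \<Longrightarrow> A (c *\<^sub>C x) = c *\<^sub>C A x"
  using assms by (auto simp: bounded_op_def)

lemma isometric_opD:
  assumes "isometric_op H K V"
  shows "bounded_op H K V" and "x \<in> hspace H \<Longrightarrow> hnorm K (V x) = hnorm H x"
  using assms by (auto simp: isometric_op_def)

lemma isometric_opI:
  assumes "\<And>x. x \<in> hspace H \<Longrightarrow> A x \<in> hspace K"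
    and "\<And>x y. x \<in> hspace H \<Longrightarrow> y \<in> hspace H \<Longrightarrow> A (x + y) = A x + A y"
    and "\<And>c x. x \<in> hspace H \<Longrightarrow> A (c *\<^sub>C x) = c *\<^sub>C A x"
    and "\<And>x. x \<in> hspace H \<Longrightarrow> hnorm K (A x) = hnorm H x"
  shows "isometric_op H K A"
  unfolding isometric_op_def bounded_op_def using assms by (auto intro!: exI[of _ 1])

lemma bounded_op_diff:
  assumes "hilbert_space H" "bounded_op H K A" "x \<in> hspace H" "y \<in> hspace H"
  shows "A (x - y) = A x - A y"
proof -
  interpret hilbert_space H by fact
  show ?thesis
    using bounded_opD(2)[OF assms(2), of "x - y" y] assms(3,4) by (simp add: eq_diff_eq)
qed

lemma word_op_mem:
  assumes "\<And>i x. x \<in> A \<Longrightarrow> T i x \<in> A" "x \<in> A"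
  shows "word_op T \<alpha> x \<in> A"
  using assms(2) by (induction \<alpha>) (auto intro: assms(1))

lemma range_isometry:
  assumes H: "hilbert_space H" and G: "hilbert_space G" and J: "isometric_op H G J"
  shows "csubspace (J ` hspace H)"
    and "J ` hspace H \<subseteq> hspace G"
    and "\<And>X. (\<And>n. X n \<in> J ` hspace H) \<Longrightarrow> hcauchy G X \<Longrightarrow> \<exists>l\<in>J ` hspace H. hlim G X l"
proof -
  interpret H: hilbert_space H by fact
  note Jb = bounded_opD[OF isometric_opD(1)[OF J]]
  have Jd: "hnorm G (J x - J y) = hnorm H (x - y)" if "x \<in> hspace H" "y \<in> hspace H" for x y
    using that isometric_opD(2)[OF J, of "x - y"]
    by (simp add: bounded_op_diff[OF H isometric_opD(1)[OF J]])
  show "J ` hspace H \<subseteq> hspace G" using Jb(1) by blast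
  show "csubspace (J ` hspace H)"
  proof (rule complex_vector.subspaceI)
    have "J (0 *\<^sub>C 0) = 0 *\<^sub>C J 0" by (rule Jb(3)) simp
    then show "0 \<in> J ` hspace H" by (metis H.zero_mem complex_vector.scale_zero_left image_eqI)
  next
    fix x y assume "x \<in> J ` hspace H" "y \<in> J ` hspace H"
    then show "x + y \<in> J ` hspace H" by (auto simp: Jb(2)[symmetric])
  next
    fix c x assume "x \<in> J ` hspace H"
    then show "c *\<^sub>C x \<in> J ` hspace H" by (auto simp: Jb(3)[symmetric])
  qed
  fix X :: "nat \<Rightarrow> 'b"
  assume X: "\<And>n. X n \<in> J ` hspace H" and c: "hcauchy G X"
  have "\<forall>n. \<exists>y. y \<in> hspace H \<and> X n = J y" using X by blast
  then obtain Y where Y: "\<And>n. Y n \<in> hspace H" "\<And>n. X n = J (Y n)" by metis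
  have "hcauchy H Y" using c by (simp add: hcauchy_def Y Jd)
  then obtain l where "l \<in> hspace H" "hlim H Y l" using H.complete Y(1) by blast
  then show "\<exists>l\<in>J ` hspace H. hlim G X l"
    by (intro bexI[of _ "J l"]) (auto simp: hlim_def Y Jd)
qed

lemma orth_proj_range_isometry:
  assumes "hilbert_space H" "hilbert_space G" "isometric_op H G J" "x \<in> hspace G"
  shows "orth_proj G (J ` hspace H) x \<in> J ` hspace H"
    and "\<forall>z\<in>J ` hspace H. hinner G (x - orth_proj G (J ` hspace H) x) z = 0"
proof -
  interpret G: hilbert_space G by fact
  note R = range_isometry[OF assms(1-3)]
  obtain y where y: "y \<in> J ` hspace H" "\<forall>z\<in>J ` hspace H. hinner G (x - y) z = 0"
    using G.orth_proj_exists[OF R(1,2) assms(4) R(3)] by blast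
  have "orth_proj G (J ` hspace H) x = y"
    by (rule G.orth_proj_eqI[OF R(1,2) assms(4) y])
  then show "orth_proj G (J ` hspace H) x \<in> J ` hspace H"
    and "\<forall>z\<in>J ` hspace H. hinner G (x - orth_proj G (J ` hspace H) x) z = 0"
    using y by simp_all
qed

lemma hilbert_space_transport:
  fixes G :: "'g::complex_vector hilb" and F :: "'g \<Rightarrow> 'k::complex_vector"
  assumes G: "hilbert_space G" and M: "csubspace M" "M \<subseteq> hspace G"
    and closed: "\<And>X l. (\<And>n. X n \<in> M) \<Longrightarrow> l \<in> hspace G \<Longrightarrow> hlim G X l \<Longrightarrow> l \<in> M"
    and F_add: "\<And>x y. x \<in> M \<Longrightarrow> y \<in> M \<Longrightarrow> F (x + y) = F x + F y"
    and F_scale: "\<And>c x. x \<in> M \<Longrightarrow> F (c *\<^sub>C x) = c *\<^sub>C F x"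
    and inj: "inj_on F M"
  defines "K \<equiv> \<lparr>hspace = F ` M, hinner = (\<lambda>f g. hinner G (inv_into M F f) (inv_into M F g))\<rparr>"
  shows "hilbert_space K"
proof -
  interpret G: hilbert_space G by fact
  have inv: "inv_into M F (F x) = x" if "x \<in> M" for x using inj that by simp
  have sp: "hspace K = F ` M" by (simp add: K_def)
  have ip: "hinner K (F x) (F y) = hinner G x y" if "x \<in> M" "y \<in> M" for x y
    using that by (simp add: K_def inv)
  have add: "x + y \<in> M" if "x \<in> M" "y \<in> M" for x y
    using complex_vector.subspace_add[OF M(1)] that .
  have scale: "c *\<^sub>C x \<in> M" if "x \<in> M" for c x
    using complex_vector.subspace_scale[OF M(1)] that .
  have diff: "x - y \<in> M" if "x \<in> M" "y \<in> M" for x y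
    using complex_vector.subspace_diff[OF M(1)] that .
  have zero: "0 \<in> M" using complex_vector.subspace_0[OF M(1)] .
  have F0: "F 0 = 0" using F_scale[OF zero, of 0] by simp
  have F_diff: "F x - F y = F (x - y)" if "x \<in> M" "y \<in> M" for x y
    using F_add[OF diff[OF that] that(2)] by (simp add: eq_diff_eq)
  have nm: "hnorm K (F x) = hnorm G x" if "x \<in> M" for x
    using that by (simp add: hnorm_def ip)
  have MG: "x \<in> hspace G" if "x \<in> M" for x using M(2) that by blast
  show ?thesis
  proof
    show "csubspace (hspace K)"
      unfolding sp
    proof (rule complex_vector.subspaceI)
      show "0 \<in> F ` M" using zero F0 by (metis image_eqI)
    qed (auto simp: F_add[symmetric] F_scale[symmetric] add scale)
  next
    fix x y z assume "x \<in> hspace K" "y \<in> hspace K" "z \<in> hspace K"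
    then show "hinner K (x + y) z = hinner K x z + hinner K y z"
      by (auto simp: sp ip add MG G.inner_add simp flip: F_add)
  next
    fix x y c assume "x \<in> hspace K" "y \<in> hspace K"
    then show "hinner K (c *\<^sub>C x) y = c * hinner K x y"
      by (auto simp: sp ip scale MG G.inner_scale simp flip: F_scale)
  next
    fix x y assume "x \<in> hspace K" "y \<in> hspace K"
    then show "hinner K y x = cnj (hinner K x y)"
      by (auto simp: sp ip intro!: G.inner_cnj MG)
  next
    fix x assume "x \<in> hspace K" "x \<noteq> 0"
    then obtain y where "y \<in> M" "x = F y" "y \<noteq> 0" using F0 by (auto simp: sp)
    then show "0 < Re (hinner K x x)" using G.inner_pos MG by (simp add: ip)
  next
    fix X :: "nat \<Rightarrow> 'k"
    assume X: "\<And>n. X n \<in> hspace K" and c: "hcauchy K X"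
    have "\<forall>n. \<exists>y. y \<in> M \<and> X n = F y" using X by (auto simp: sp)
    then obtain Y where Y: "\<And>n. Y n \<in> M" "\<And>n. X n = F (Y n)" by metis
    have "hcauchy G Y" using c by (simp add: hcauchy_def Y F_diff nm diff)
    then obtain l where l: "l \<in> hspace G" "hlim G Y l" using G.complete Y(1) MG by blast
    then have lM: "l \<in> M" using closed Y(1) by blast
    then have "hlim K X (F l)" using l by (simp add: hlim_def Y F_diff nm diff)
    then show "\<exists>l\<in>hspace K. hlim K X l" using lM by (auto simp: sp)
  qed
qed

lemma class_C_I:
  fixes G :: "'g::complex_vector hilb" and H :: "'h::complex_vector hilb"
    and T :: "'n \<Rightarrow> 'h \<Rightarrow> 'h"
  assumes H: "hilbert_space H" and dil: "rho_dilation \<rho> H T G J V"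
  shows "class_C \<rho> H T"
proof -
  have G: "hilbert_space G" and J: "isometric_op H G J" and V: "\<And>i. isometric_op G G (V i)"
    and orth: "\<And>i j x y. \<lbrakk>i \<noteq> j; x \<in> hspace G; y \<in> hspace G\<rbrakk> \<Longrightarrow> hinner G (V i x) (V j y) = 0"
    and dilT: "\<And>\<alpha> h. \<lbrakk>\<alpha> \<noteq> []; h \<in> hspace H\<rbrakk> \<Longrightarrow> J (word_op T \<alpha> h)
          = complex_of_real \<rho> *\<^sub>C orth_proj G (J ` hspace H) (word_op V \<alpha> (J h))"
    using dil by (auto simp: rho_dilation_def)
  interpret H: hilbert_space H by fact
  interpret G: hilbert_space G by fact
  note Jb = bounded_opD[OF isometric_opD(1)[OF J]]
  note Vb = bounded_opD[OF isometric_opD(1)[OF V]]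
  define N where "N = {word_op V \<alpha> (J h) | \<alpha> h. h \<in> hspace H}"
  define M where "M = {g \<in> hspace G. \<forall>e>0. \<exists>s\<in>cspan N. hnorm G (g - s) < e}"
  have wG: "word_op V \<alpha> g \<in> hspace G" if "g \<in> hspace G" for \<alpha> g
    using that Vb(1) by (intro word_op_mem) auto
  have NG: "N \<subseteq> hspace G" using wG Jb(1) by (auto simp: N_def)
  have sG: "s \<in> hspace G" if "s \<in> cspan N" for s
    using complex_vector.span_minimal[OF NG G.subspace] that by blast
  have MG: "g \<in> hspace G" if "g \<in> M" for g using that by (simp add: M_def)
  have MD: "\<exists>s\<in>cspan N. hnorm G (g - s) < e" if "g \<in> M" "e > 0" for g e
    using that by (simp add: M_def)
  have MI: "s \<in> M" if "s \<in> cspan N" for s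
    unfolding M_def using sG[OF that] that by (auto intro!: bexI[of _ s] simp: hnorm_def)
  have NM: "word_op V \<alpha> (J h) \<in> M" if "h \<in> hspace H" for \<alpha> h
    using that by (intro MI complex_vector.span_base) (auto simp: N_def)
  have JM: "J h \<in> M" if "h \<in> hspace H" for h using NM[OF that, of "[]"] by simp
  have V_span: "s \<in> cspan N \<and> V i s \<in> cspan N" if "s \<in> cspan N" for i s
    using that
  proof (induction rule: complex_vector.span_induct_alt)
    case base
    have "V i (0 *\<^sub>C 0) = 0 *\<^sub>C V i 0" by (rule Vb(3)) simp
    then show ?case by (simp add: complex_vector.span_zero)
  next
    case (step c x y)
    then obtain \<alpha> h where x: "x = word_op V \<alpha> (J h)" "h \<in> hspace H" by (auto simp: N_def)
    have xG: "x \<in> hspace G" using step NG by blast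
    have "V i x = word_op V (i # \<alpha>) (J h)" by (simp add: x)
    then have "V i x \<in> N" unfolding N_def using x(2) by blast
    moreover have "V i (c *\<^sub>C x + y) = c *\<^sub>C V i x + V i y"
      using xG sG[of y] step(2) by (simp add: Vb)
    ultimately show ?case
      using step by (simp add: complex_vector.span_add complex_vector.span_scale
          complex_vector.span_base)
  qed
  have M_sub: "csubspace M"
  proof (rule complex_vector.subspaceI)
    show "0 \<in> M" by (rule MI) (rule complex_vector.span_zero)
  next
    fix x y assume x: "x \<in> M" and y: "y \<in> M"
    show "x + y \<in> M"
      unfolding M_def
    proof (intro CollectI conjI allI impI)
      fix e :: real assume "e > 0"
      then obtain s t where s: "s \<in> cspan N" "hnorm G (x - s) < e/2"
        and t: "t \<in> cspan N" "hnorm G (y - t) < e/2"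
        using MD[OF x, of "e/2"] MD[OF y, of "e/2"] by auto
      have "hnorm G ((x - s) + (y - t)) \<le> hnorm G (x - s) + hnorm G (y - t)"
        using MG x y sG s(1) t(1) by (intro G.triangle) auto
      then have "hnorm G ((x + y) - (s + t)) < e"
        using s(2) t(2) by (simp add: algebra_simps)
      then show "\<exists>s\<in>cspan N. hnorm G (x + y - s) < e"
        using complex_vector.span_add[OF s(1) t(1)] by blast
    qed (use MG x y in auto)
  next
    fix c x assume x: "x \<in> M"
    show "c *\<^sub>C x \<in> M"
      unfolding M_def
    proof (intro CollectI conjI allI impI)
      fix e :: real assume e: "e > 0"
      have pos: "0 < cmod c + 1" by (simp add: add_nonneg_pos)
      obtain s where s: "s \<in> cspan N" "hnorm G (x - s) < e / (cmod c + 1)"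
        using MD[OF x divide_pos_pos[OF e pos]] by auto
      have "hnorm G (c *\<^sub>C x - c *\<^sub>C s) = cmod c * hnorm G (x - s)"
        using MG[OF x] sG[OF s(1)] G.hnorm_scale[of "x - s" c]
        by (simp add: complex_vector.scale_right_diff_distrib)
      also have "\<dots> \<le> (cmod c + 1) * hnorm G (x - s)"
        using MG[OF x] sG[OF s(1)] by (intro mult_right_mono G.hnorm_nonneg) auto
      also have "\<dots> < e" using s(2) pos by (simp add: field_simps)
      finally show "\<exists>s\<in>cspan N. hnorm G (c *\<^sub>C x - s) < e"
        using complex_vector.span_scale[OF s(1)] by blast
    qed (use MG x in auto)
  qed
  have M_closed: "l \<in> M" if X: "\<And>n. X n \<in> M" and l: "l \<in> hspace G" and lim: "hlim G X l" for X l
    unfolding M_def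
  proof (intro CollectI conjI allI impI)
    fix e :: real assume e: "e > 0"
    have "\<forall>\<^sub>F n in sequentially. hnorm G (X n - l) < e/2"
      using lim e unfolding hlim_def by (auto dest!: order_tendstoD(2)[of _ _ _ "e/2"])
    then obtain n where n: "hnorm G (X n - l) < e/2" by (auto simp: eventually_sequentially)
    obtain s where s: "s \<in> cspan N" "hnorm G (X n - s) < e/2"
      using MD[OF X, of "e/2" n] e by auto
    have "hnorm G (l - s) \<le> hnorm G (l - X n) + hnorm G (X n - s)"
      using l MG[OF X] sG[OF s(1)] by (intro G.triangle_diff)
    also have "hnorm G (l - X n) = hnorm G (X n - l)"
      using l MG[OF X] by (intro G.hnorm_minus_commute)
    finally have "hnorm G (l - s) < e" using n s(2) by linarith
    then show "\<exists>s\<in>cspan N. hnorm G (l - s) < e" using s(1) by blast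
  qed (rule l)
  have VM: "V i x \<in> M" if x: "x \<in> M" for i x
    unfolding M_def
  proof (intro CollectI conjI allI impI)
    fix e :: real assume "e > 0"
    then obtain s where s: "s \<in> cspan N" "hnorm G (x - s) < e" using x by (auto simp: M_def)
    have "hnorm G (V i x - V i s) = hnorm G (x - s)"
      using MG[OF x] sG[OF s(1)] isometric_opD(2)[OF V, of "x - s" i]
      by (simp add: bounded_op_diff[OF G isometric_opD(1)[OF V]])
    then show "\<exists>s\<in>cspan N. hnorm G (V i x - s) < e" using s V_span by metis
  qed (use MG[OF x] Vb(1) in auto)
  define F :: "'g \<Rightarrow> 'n list \<times> 'h \<Rightarrow> complex" where
    "F g = (\<lambda>(\<alpha>, h). if h \<in> hspace H then hinner G g (word_op V \<alpha> (J h)) else 0)" for g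
  have F_add: "F (x + y) = F x + F y" if "x \<in> M" "y \<in> M" for x y
    using that MG wG Jb(1) by (auto simp: F_def fun_eq_iff G.inner_add)
  have F_scale: "F (c *\<^sub>C x) = c *\<^sub>C F x" if "x \<in> M" for c x
    using that MG wG Jb(1)
    by (auto simp: F_def fun_eq_iff G.inner_scale scaleC_complex_def)
  have F_zero: "x = 0" if x: "x \<in> M" and "F x = 0" for x
  proof -
    have ortN: "hinner G x s = 0" if sN: "s \<in> N" for s
    proof -
      obtain \<alpha> h where s: "s = word_op V \<alpha> (J h)" "h \<in> hspace H"
        using sN by (auto simp: N_def)
      have "F x (\<alpha>, h) = 0" using \<open>F x = 0\<close> by simp
      then show ?thesis using s by (simp add: F_def)
    qed
    have ort: "s \<in> hspace G \<and> hinner G x s = 0" if "s \<in> cspan N" for s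
      using that
    proof (induction rule: complex_vector.span_induct_alt)
      case base
      then show ?case using MG[OF x] by simp
    next
      case (step c u v)
      have "u \<in> hspace G" using step(1) NG by auto
      then show ?case
        using MG[OF x] ortN[OF step(1)] step(2) by (simp add: G.inner_add_right G.inner_scale_right)
    qed
    have "hnorm G x \<le> e" if e: "e > 0" for e
    proof -
      obtain s where s: "s \<in> cspan N" "hnorm G (x - s) < e" using x e by (auto simp: M_def)
      have "(hnorm G (x - s))\<^sup>2 = (hnorm G x)\<^sup>2 + (hnorm G s)\<^sup>2"
        using MG[OF x] sG[OF s(1)] ort[OF s(1)] by (simp add: G.hnorm_diff_sq)
      then have "(hnorm G x)\<^sup>2 \<le> (hnorm G (x - s))\<^sup>2" by simp
      then have "hnorm G x \<le> hnorm G (x - s)"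
        by (rule power2_le_imp_le[OF _ G.hnorm_nonneg]) (use MG[OF x] sG[OF s(1)] in auto)
      then show ?thesis using s by simp
    qed
    then have "hnorm G x \<le> 0" using field_le_epsilon[of "hnorm G x" 0] by simp
    then have "hnorm G x = 0" using G.hnorm_nonneg[OF MG[OF x]] by simp
    then show ?thesis using G.hnorm_eq_0 MG[OF x] by simp
  qed
  have M_diff: "x - y \<in> M" if "x \<in> M" "y \<in> M" for x y
    using complex_vector.subspace_diff[OF M_sub] that .
  have F_diff: "F (x - y) = F x - F y" if "x \<in> M" "y \<in> M" for x y
    using F_add[OF M_diff[OF that] that(2)] by (simp add: eq_diff_eq)
  have inj: "inj_on F M"
  proof (rule inj_onI)
    fix x y assume xy: "x \<in> M" "y \<in> M" "F x = F y"
    then have "x - y = 0" by (intro F_zero M_diff) (simp_all add: F_diff)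
    then show "x = y" by simp
  qed
  define K where
    "K = \<lparr>hspace = F ` M, hinner = (\<lambda>f g. hinner G (inv_into M F f) (inv_into M F g))\<rparr>"
  have inv: "inv_into M F (F x) = x" if "x \<in> M" for x using inj that by simp
  have sp: "hspace K = F ` M" by (simp add: K_def)
  have ip: "hinner K (F x) (F y) = hinner G x y" if "x \<in> M" "y \<in> M" for x y
    using that by (simp add: K_def inv)
  have nm: "hnorm K (F x) = hnorm G x" if "x \<in> M" for x
    using that by (simp add: hnorm_def ip)
  have K: "hilbert_space K"
    unfolding K_def
    by (rule hilbert_space_transport[OF G M_sub _ M_closed F_add F_scale inj]) (use MG in auto)
  interpret K: hilbert_space K by fact
  define J' where "J' = F \<circ> J"
  define V' where "V' i = F \<circ> V i \<circ> inv_into M F" for i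
  have V'F: "V' i (F x) = F (V i x)" if "x \<in> M" for i x using that by (simp add: V'_def inv)
  have M_add: "x + y \<in> M" if "x \<in> M" "y \<in> M" for x y
    using complex_vector.subspace_add[OF M_sub] that .
  have M_scale: "c *\<^sub>C x \<in> M" if "x \<in> M" for c x
    using complex_vector.subspace_scale[OF M_sub] that .
  have J': "isometric_op H K J'"
    by (rule isometric_opI)
      (simp_all add: J'_def sp JM Jb F_add F_scale nm isometric_opD(2)[OF J])
  have V': "isometric_op K K (V' i)" for i
  proof (rule isometric_opI)
    fix x assume "x \<in> hspace K"
    then show "V' i x \<in> hspace K" "hnorm K (V' i x) = hnorm K x"
      using MG by (auto simp: sp V'F VM nm isometric_opD(2)[OF V])
  next
    fix x y assume "x \<in> hspace K" "y \<in> hspace K"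
    then show "V' i (x + y) = V' i x + V' i y"
      using MG by (auto simp: sp V'F VM Vb F_add M_add simp flip: F_add)
  next
    fix c x assume "x \<in> hspace K"
    then show "V' i (c *\<^sub>C x) = c *\<^sub>C V' i x"
      using MG by (auto simp: sp V'F VM Vb F_scale M_scale simp flip: F_scale)
  qed
  have V'w: "word_op V' \<alpha> (F x) = F (word_op V \<alpha> x)" if "x \<in> M" for \<alpha> x
  proof (induction \<alpha>)
    case (Cons i \<alpha>)
    have "word_op V \<alpha> x \<in> M" using that VM by (intro word_op_mem)
    then show ?case using Cons by (simp add: V'F)
  qed simp
  have JTa: "J' (word_op T \<alpha> h)
      = complex_of_real \<rho> *\<^sub>C orth_proj K (J' ` hspace H) (word_op V' \<alpha> (J' h))"
    if a: "\<alpha> \<noteq> []" and h: "h \<in> hspace H" for \<alpha> h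
  proof -
    define x where "x = word_op V \<alpha> (J h)"
    define y where "y = orth_proj G (J ` hspace H) x"
    have xM: "x \<in> M" unfolding x_def by (rule NM[OF h])
    have y: "y \<in> J ` hspace H" "\<forall>z\<in>J ` hspace H. hinner G (x - y) z = 0"
      unfolding y_def using orth_proj_range_isometry[OF H G J MG[OF xM]] by auto
    then have yM: "y \<in> M" using JM by blast
    have "orth_proj K (J' ` hspace H) (F x) = F y"
    proof (rule K.orth_proj_eqI)
      show "csubspace (J' ` hspace H)" "J' ` hspace H \<subseteq> hspace K"
        using range_isometry[OF H K J'] by auto
      show "F x \<in> hspace K" using xM by (simp add: sp)
      show "F y \<in> J' ` hspace H" using y(1) by (auto simp: J'_def)
      show "\<forall>z\<in>J' ` hspace H. hinner K (F x - F y) z = 0"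
        using y(2) JM xM yM by (auto simp: J'_def ip M_diff simp flip: F_diff)
    qed
    moreover have "word_op V' \<alpha> (J' h) = F x" using V'w JM[OF h] by (simp add: J'_def x_def)
    moreover have "J' (word_op T \<alpha> h) = F (complex_of_real \<rho> *\<^sub>C y)"
      using dilT[OF a h] by (simp add: J'_def y_def x_def)
    ultimately show ?thesis using F_scale[OF yM] by simp
  qed
  have "hinner K (V' i x) (V' j y) = 0" if "i \<noteq> j" "x \<in> hspace K" "y \<in> hspace K" for i j x y
    using that MG orth by (auto simp: sp V'F ip VM)
  then have "rho_dilation \<rho> H T K J' V'"
    unfolding rho_dilation_def using K J' V' JTa by blast
  then show ?thesis unfolding class_C_def by blast
qed


section \<open>The full Fock space and the left creation operators\<close>

text \<open>
  The tensors \<open>e\<^sub>\<alpha> = e\<^sub>i \<otimes> e\<^sub>j \<otimes> \<dots>\<close> for words \<open>\<alpha> = [i, j, \<dots>]\<close> of length \<open>k\<close> are an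
  orthonormal basis of the \<open>k\<close>-th tensor power of \<open>H\<^sub>n\<close>, and \<open>e\<close> of the empty word is the
  vacuum \<open>1\<close>. A vector of the full Fock space is represented by its family of
  coefficients in this basis, which is an arbitrary square-summable family.
\<close>

definition fock :: "('n list \<Rightarrow> complex) hilb" where
  "fock = \<lparr>hspace = {f. (\<lambda>\<alpha>. (cmod (f \<alpha>))\<^sup>2) summable_on UNIV},
           hinner = (\<lambda>f g. \<Sum>\<^sub>\<infinity>\<alpha>. f \<alpha> * cnj (g \<alpha>))\<rparr>"

definition fock_basis :: "'n list \<Rightarrow> 'n list \<Rightarrow> complex" where
  "fock_basis \<alpha> = (\<lambda>\<beta>. if \<beta> = \<alpha> then 1 else 0)"

text \<open>Coefficients of the tensor product, determined by \<open>e\<^sub>\<alpha> \<otimes> e\<^sub>\<beta> = e\<^sub>\<alpha>\<^sub>\<beta>\<close>.\<close>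

definition fock_tensor ::
  "('n list \<Rightarrow> complex) \<Rightarrow> ('n list \<Rightarrow> complex) \<Rightarrow> 'n list \<Rightarrow> complex" where
  "fock_tensor f g = (\<lambda>\<alpha>. \<Sum>k\<le>length \<alpha>. f (take k \<alpha>) * g (drop k \<alpha>))"

definition creation :: "'n \<Rightarrow> ('n list \<Rightarrow> complex) \<Rightarrow> 'n list \<Rightarrow> complex" where
  "creation i \<phi> = fock_tensor (fock_basis [i]) \<phi>"

lemma fock_tensor_basis: "fock_tensor (fock_basis \<alpha>) (fock_basis \<beta>) = fock_basis (\<alpha> @ \<beta>)"
proof
  fix \<gamma> :: "'a list"
  have split: "take k \<gamma> = \<alpha> \<and> drop k \<gamma> = \<beta> \<longleftrightarrow> k = length \<alpha> \<and> \<gamma> = \<alpha> @ \<beta>"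
    if "k \<le> length \<gamma>" for k
    using that by (auto simp: append_eq_conv_conj)
  have "fock_tensor (fock_basis \<alpha>) (fock_basis \<beta>) \<gamma>
      = (\<Sum>k\<le>length \<gamma>. if take k \<gamma> = \<alpha> \<and> drop k \<gamma> = \<beta> then 1 else 0)"
    unfolding fock_tensor_def fock_basis_def by (intro sum.cong refl) simp
  also have "\<dots> = (\<Sum>k\<le>length \<gamma>. if k = length \<alpha> then of_bool (\<gamma> = \<alpha> @ \<beta>) else 0)"
    by (rule sum.cong) (use split in simp_all)
  finally have "fock_tensor (fock_basis \<alpha>) (fock_basis \<beta>) \<gamma>
      = (\<Sum>k\<le>length \<gamma>. if k = length \<alpha> then of_bool (\<gamma> = \<alpha> @ \<beta>) else 0)" .
  then show "fock_tensor (fock_basis \<alpha>) (fock_basis \<beta>) \<gamma> = fock_basis (\<alpha> @ \<beta>) \<gamma>"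
    by (auto simp: fock_basis_def)
qed

lemma creation_Nil [simp]: "creation i \<phi> [] = 0"
  by (simp add: creation_def fock_tensor_def fock_basis_def)

lemma creation_Cons [simp]: "creation i \<phi> (j # \<alpha>) = (if j = i then \<phi> \<alpha> else 0)"
proof -
  have "creation i \<phi> (j # \<alpha>)
      = (\<Sum>k\<le>length (j # \<alpha>). if k = 1 then (if j = i then \<phi> \<alpha> else 0) else 0)"
    unfolding creation_def fock_tensor_def
  proof (rule sum.cong)
    fix k assume "k \<in> {..length (j # \<alpha>)}"
    then show "fock_basis [i] (take k (j # \<alpha>)) * \<phi> (drop k (j # \<alpha>))
        = (if k = 1 then (if j = i then \<phi> \<alpha> else 0) else 0)"
      by (cases k) (auto simp: fock_basis_def)
  qed simp
  also have "\<dots> = (if j = i then \<phi> \<alpha> else 0)"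
    by (subst sum.delta) simp_all
  finally show ?thesis .
qed


section \<open>Noncommutative polynomials\<close>

text \<open>
  A polynomial in the noncommuting indeterminates is its finitely supported family of
  coefficients indexed by words, with values in \<open>complex\<close> or in the \<open>m \<times> m\<close> matrices.
\<close>

definition nc_polys :: "('n list \<Rightarrow> complex) set" where
  "nc_polys = {q. finite {\<alpha>. q \<alpha> \<noteq> 0}}"

definition nc_eval ::
  "('n \<Rightarrow> 'a \<Rightarrow> 'a) \<Rightarrow> ('n list \<Rightarrow> complex) \<Rightarrow> 'a \<Rightarrow> 'a::complex_vector" where
  "nc_eval T q = (\<Sum>\<alpha> | q \<alpha> \<noteq> 0. q \<alpha> *\<^sub>C word_op T \<alpha>)"

definition nc_mpolys :: "nat \<Rightarrow> ('n list \<Rightarrow> complex mat) set" where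
  "nc_mpolys m = {p. (\<forall>\<alpha>. p \<alpha> \<in> carrier_mat m m) \<and> finite {\<alpha>. p \<alpha> \<noteq> 0\<^sub>m m m}}"

text \<open>The Hilbert space \<open>H \<otimes> \<complex>\<^sup>m\<close>, as the direct sum of \<open>m\<close> copies of \<open>H\<close>.\<close>

definition ampliation :: "nat \<Rightarrow> 'a::complex_vector hilb \<Rightarrow> (nat \<Rightarrow> 'a) hilb" where
  "ampliation m H =
     \<lparr>hspace = {x. (\<forall>i<m. x i \<in> hspace H) \<and> (\<forall>i\<ge>m. x i = 0)},
      hinner = (\<lambda>x y. \<Sum>i<m. hinner H (x i) (y i))\<rparr>"

text \<open>The operator on the ampliation given by a matrix of operators.\<close>

definition mat_op :: "('a \<Rightarrow> 'a) mat \<Rightarrow> (nat \<Rightarrow> 'a) \<Rightarrow> nat \<Rightarrow> 'a::complex_vector" where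
  "mat_op A x = (\<lambda>i. if i < dim_row A then \<Sum>j<dim_col A. (A $$ (i, j)) (x j) else 0)"

definition op_tensor ::
  "('a \<Rightarrow> 'a) \<Rightarrow> complex mat \<Rightarrow> (nat \<Rightarrow> 'a) \<Rightarrow> nat \<Rightarrow> 'a::complex_vector" where
  "op_tensor A M = mat_op (map_mat (\<lambda>c. c *\<^sub>C A) M)"

definition nc_meval ::
  "nat \<Rightarrow> ('n \<Rightarrow> 'a \<Rightarrow> 'a) \<Rightarrow> ('n list \<Rightarrow> complex mat) \<Rightarrow> (nat \<Rightarrow> 'a) \<Rightarrow> nat \<Rightarrow> 'a::complex_vector"
  where
  "nc_meval m T p = (\<Sum>\<alpha> | p \<alpha> \<noteq> 0\<^sub>m m m. op_tensor (word_op T \<alpha>) (p \<alpha>))"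

definition nc_mconst ::
  "('n list \<Rightarrow> complex mat) \<Rightarrow> (nat \<Rightarrow> 'a) \<Rightarrow> nat \<Rightarrow> 'a::complex_vector" where
  "nc_mconst p = op_tensor id (p [])"


section \<open>The map \<open>\<Psi>\<^sub>T\<close> and complete contractivity\<close>

definition completely_contractive ::
  "'a::complex_vector hilb \<Rightarrow> 'b::complex_vector hilb \<Rightarrow>
   ('a \<Rightarrow> 'a) set \<Rightarrow> (('a \<Rightarrow> 'a) \<Rightarrow> 'b \<Rightarrow> 'b) \<Rightarrow> bool" where
  "completely_contractive H K X F \<longleftrightarrow>
     (\<forall>m\<ge>1. \<forall>A\<in>carrier_mat m m. (\<forall>i<m. \<forall>j<m. A $$ (i, j) \<in> X) \<longrightarrow>
        opnorm (ampliation m K) (mat_op (map_mat F A)) \<le> opnorm (ampliation m H) (mat_op A))"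

text \<open>The algebra of polynomials in the left creation operators, dense in the disc algebra.\<close>

definition creation_polys :: "(('n list \<Rightarrow> complex) \<Rightarrow> 'n list \<Rightarrow> complex) set" where
  "creation_polys = nc_eval creation ` nc_polys"

definition Psi ::
  "real \<Rightarrow> ('n \<Rightarrow> 'h \<Rightarrow> 'h) \<Rightarrow> (('n list \<Rightarrow> complex) \<Rightarrow> 'n list \<Rightarrow> complex) \<Rightarrow>
   'h \<Rightarrow> 'h::complex_vector" where
  "Psi \<rho> T A = (THE B. \<exists>q\<in>nc_polys. A = nc_eval creation q \<and>
     B = complex_of_real (1 / \<rho>) *\<^sub>C nc_eval T q
         + (complex_of_real (1 - 1 / \<rho>) * q []) *\<^sub>C id)"

lemma word_op_creation_vacuum: "word_op creation \<alpha> (fock_basis []) = fock_basis \<alpha>"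
  by (induction \<alpha>) (simp_all add: creation_def fock_tensor_basis)

lemma nc_eval_creation_vacuum:
  assumes "q \<in> nc_polys"
  shows "nc_eval creation q (fock_basis []) = q"
proof
  fix \<beta>
  have fin: "finite {\<alpha>. q \<alpha> \<noteq> 0}" using assms by (simp add: nc_polys_def)
  have "nc_eval creation q (fock_basis []) \<beta>
      = (\<Sum>\<alpha> | q \<alpha> \<noteq> 0. if \<beta> = \<alpha> then q \<beta> else 0)"
    unfolding nc_eval_def sum_fun_apply
    by (rule sum.cong)
      (simp_all add: word_op_creation_vacuum scaleC_complex_def fock_basis_def[THEN fun_cong])
  then show "nc_eval creation q (fock_basis []) \<beta> = q \<beta>" using fin by simp
qed

lemma Psi_nc_eval:
  assumes "q \<in> nc_polys"
  shows "Psi \<rho> T (nc_eval creation q)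
       = complex_of_real (1 / \<rho>) *\<^sub>C nc_eval T q + (complex_of_real (1 - 1 / \<rho>) * q []) *\<^sub>C id"
  unfolding Psi_def
proof (rule the_equality)
  fix B assume "\<exists>r\<in>nc_polys. nc_eval creation q = nc_eval creation r \<and>
      B = complex_of_real (1 / \<rho>) *\<^sub>C nc_eval T r + (complex_of_real (1 - 1 / \<rho>) * r []) *\<^sub>C id"
  then obtain r where r: "r \<in> nc_polys" "nc_eval creation q = nc_eval creation r"
    and B: "B = complex_of_real (1 / \<rho>) *\<^sub>C nc_eval T r
              + (complex_of_real (1 - 1 / \<rho>) * r []) *\<^sub>C id"
    by blast
  have "q = r" using nc_eval_creation_vacuum assms r by metis
  then show "B = complex_of_real (1 / \<rho>) *\<^sub>C nc_eval T q
              + (complex_of_real (1 - 1 / \<rho>) * q []) *\<^sub>C id"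
    using B by simp
qed (use assms in blast)

end

theory Submission
  imports Defs "HOL-Library.Sublist"
begin

text \<open>
  All three conditions are compared with the positivity of the multi-Toeplitz kernel that has
  \<open>1\<close> on the diagonal and \<open>T\<^sub>\<gamma> / \<rho>\<close> in the places \<open>S\<^sub>\<alpha>\<^sup>* S\<^sub>\<alpha>\<^sub>\<gamma>\<close>. Conditions (ii) and (iii) are the
  same inequality, since \<open>q \<mapsto> q / \<rho> + (1 - 1 / \<rho>) q(0)\<close> is a bijection of the polynomials.

  If \<open>\<Psi>\<close> is completely contractive, then it maps a matrix of polynomials with nonnegative real
  part to one with nonnegative real part; applied to the upper half of \<open>(S\<^sub>\<alpha>\<^sup>* S\<^sub>\<beta>)\<close>, this makes the
  kernel positive, and the Hilbert space completion of the finitely supported families of vectors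
  carries the dilation, with the shifts of the families as isometries.

  Conversely, a dilation writes \<open>\<Psi>(q(S))\<close> as the compression of \<open>q(V)\<close>, so it remains to see
  \<open>\<parallel>q(V)\<parallel> \<le> \<parallel>q(S)\<parallel>\<close> for isometries with orthogonal ranges. The Poisson kernel
  \<open>x \<mapsto> \<Sum>\<^sub>\<alpha> e\<^sub>\<alpha> \<otimes> r\<^sup>|\<^sup>\<alpha>\<^sup>| \<Delta>\<^sub>r V\<^sub>\<alpha>\<^sup>* x\<close> with \<open>\<Delta>\<^sub>r\<^sup>2 = 1 - r\<^sup>2 \<Sum>\<^sub>i V\<^sub>i V\<^sub>i\<^sup>*\<close> compresses \<open>S\<^sub>\<beta>\<close> to
  \<open>r\<^sup>|\<^sup>\<beta>\<^sup>| V\<^sub>\<beta>\<close>; it is truncated to words of length \<open>< N\<close>, and \<open>N \<rightarrow> \<infinity>\<close>, \<open>r \<rightarrow> 1\<close>.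
\<close>

text \<open>The Fock space with coefficients in the dilation space is never formed. A truncated
  Poisson transform has finitely many nonzero coefficients, and the Gram matrix of finitely many
  vectors is a finite sum of scalar products, so a bound for \<open>q(S)\<close> on scalar families
  passes to families of vectors. To survive this summation the bound is carried in the additive form
  Re <q(S) a, b> \<le> c/2 (|a|^2 + |b|^2); scaling b recovers the norm bound at the end.

  The radius r < 1 is essential. The remainder of the Poisson sum is r^(2N) times the sum of
  |V_\<alpha>^* x|^2 over the words of length N. If the ranges of the V_i fill the space, that sum
  is |x|^2 for every N, while the defect operator at r = 1 is zero.

  In the other direction, the map on polynomials fixes constant terms, hence is unital, so the norms
  of 1 - t A and of its image can be compared to first order in t. The matrix of S_\<alpha>^*
  S_\<beta> is positive as a Gram matrix, but only its upper half consists of polynomials in S; it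
  is recovered as the sum of that half and its adjoint, each taking one half of the
  diagonal.\<close>

context hilbert_space
begin

lemma sum_mem: "(\<And>i. i \<in> I \<Longrightarrow> f i \<in> hspace H) \<Longrightarrow> sum f I \<in> hspace H"
  by (induction I rule: infinite_finite_induct) auto

lemma inner_sum:
  assumes "\<And>i. i \<in> I \<Longrightarrow> f i \<in> hspace H" "x \<in> hspace H"
  shows "hinner H (sum f I) x = (\<Sum>i\<in>I. hinner H (f i) x)"
  using assms by (induction I rule: infinite_finite_induct) (simp_all add: inner_add sum_mem)

lemma inner_sum_right:
  assumes "\<And>i. i \<in> I \<Longrightarrow> f i \<in> hspace H" "x \<in> hspace H"
  shows "hinner H x (sum f I) = (\<Sum>i\<in>I. hinner H x (f i))"
  using assms
  by (induction I rule: infinite_finite_induct) (simp_all add: inner_add_right sum_mem)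

end

subsection \<open>Ampliations\<close>

lemma hspace_ampliation:
  "x \<in> hspace (ampliation m H) \<longleftrightarrow> (\<forall>i<m. x i \<in> hspace H) \<and> (\<forall>i\<ge>m. x i = 0)"
  by (simp add: ampliation_def)

lemma hinner_ampliation: "hinner (ampliation m H) x y = (\<Sum>i<m. hinner H (x i) (y i))"
  by (simp add: ampliation_def)

lemma (in hilbert_space) hnorm_ampliation:
  assumes "x \<in> hspace (ampliation m H)"
  shows "hnorm (ampliation m H) x = sqrt (\<Sum>i<m. (hnorm H (x i))\<^sup>2)"
  using assms by (simp add: hnorm_def[of "ampliation m H"] hinner_ampliation hspace_ampliation
      hnorm_sq)

lemma hilbert_space_ampliation:
  assumes "hilbert_space H"
  shows "hilbert_space (ampliation m H)"
proof -
  interpret hilbert_space H by fact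
  have mem_diff: "x - y \<in> hspace (ampliation m H)"
    if "x \<in> hspace (ampliation m H)" "y \<in> hspace (ampliation m H)" for x y
    using that by (simp add: hspace_ampliation)
  show ?thesis
  proof
    show "csubspace (hspace (ampliation m H))"
      by (rule complex_vector.subspaceI) (simp_all add: hspace_ampliation)
  next
    fix x y z
    assume "x \<in> hspace (ampliation m H)" "y \<in> hspace (ampliation m H)"
      "z \<in> hspace (ampliation m H)"
    then show "hinner (ampliation m H) (x + y) z
        = hinner (ampliation m H) x z + hinner (ampliation m H) y z"
      by (simp add: hspace_ampliation hinner_ampliation inner_add sum.distrib)
  next
    fix x y c
    assume "x \<in> hspace (ampliation m H)" "y \<in> hspace (ampliation m H)"
    then show "hinner (ampliation m H) (c *\<^sub>C x) y = c * hinner (ampliation m H) x y"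
      and "hinner (ampliation m H) y x = cnj (hinner (ampliation m H) x y)"
      by (simp_all add: hspace_ampliation hinner_ampliation inner_scale sum_distrib_left
          inner_cnj[of _ "y _"] inner_cnj[of "x _" "y _"])
  next
    fix x assume x: "x \<in> hspace (ampliation m H)" "x \<noteq> 0"
    then obtain i where i: "i < m" "x i \<noteq> 0"
      by (metis hspace_ampliation zero_fun_def ext not_le)
    then have "0 < Re (hinner H (x i) (x i))" using x by (simp add: hspace_ampliation inner_pos)
    then show "0 < Re (hinner (ampliation m H) x x)"
      using x i unfolding hinner_ampliation Re_sum
      by (intro sum_pos2[of _ i]) (auto simp: hspace_ampliation inner_self_nonneg)
  next
    fix X :: "nat \<Rightarrow> nat \<Rightarrow> 'a"
    assume X: "\<And>n. X n \<in> hspace (ampliation m H)" and c: "hcauchy (ampliation m H) X"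
    have "\<exists>l\<in>hspace H. hlim H (\<lambda>n. X n i) l" if i: "i < m" for i
    proof (rule complete)
      show "X n i \<in> hspace H" for n using X i by (simp add: hspace_ampliation)
      have "hnorm H (X k i - X n i) \<le> hnorm (ampliation m H) (X k - X n)" for k n
        using i X[of k] X[of n] unfolding hnorm_ampliation[OF mem_diff[OF X X]]
        by (intro real_le_rsqrt) (auto intro!: member_le_sum[of i _ "\<lambda>i. (hnorm H (X k i - X n i))\<^sup>2"])
      then show "hcauchy H (\<lambda>n. X n i)"
        using c unfolding hcauchy_def by (meson le_less_trans)
    qed
    then obtain l where l: "\<And>i. i < m \<Longrightarrow> l i \<in> hspace H"
      and lim: "\<And>i. i < m \<Longrightarrow> hlim H (\<lambda>n. X n i) (l i)" by metis
    \<comment> \<open>The carrier requires the coordinates from \<open>m\<close> on to vanish, and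
      \<open>l\<close> is arbitrary there.\<close>
    define l' where "l' = (\<lambda>i. if i < m then l i else 0)"
    have l': "l' \<in> hspace (ampliation m H)" using l by (simp add: l'_def hspace_ampliation)
    have "(\<lambda>n. sqrt (\<Sum>i<m. (hnorm H (X n i - l i))\<^sup>2)) \<longlonglongrightarrow> sqrt (\<Sum>i<m. 0\<^sup>2)"
      using lim by (intro tendsto_intros) (auto simp: hlim_def)
    then have "hlim (ampliation m H) X l'"
      by (simp add: hlim_def hnorm_ampliation[OF mem_diff[OF X l']]) (simp add: l'_def)
    then show "\<exists>l\<in>hspace (ampliation m H). hlim (ampliation m H) X l" using l' by blast
  qed
qed

subsection \<open>The full Fock space\<close>

lemma hspace_fock: "f \<in> hspace fock \<longleftrightarrow> (\<lambda>\<alpha>. (cmod (f \<alpha>))\<^sup>2) summable_on UNIV"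
  by (simp add: fock_def)

lemma hinner_fock: "hinner fock f g = (\<Sum>\<^sub>\<infinity>\<alpha>. f \<alpha> * cnj (g \<alpha>))"
  by (simp add: fock_def)

lemma fock_summable_mult:
  assumes "f \<in> hspace fock" "g \<in> hspace fock"
  shows "(\<lambda>\<alpha>. f \<alpha> * cnj (g \<alpha>)) summable_on UNIV"
proof (rule abs_summable_summable)
  have "(\<lambda>\<alpha>. (cmod (f \<alpha>))\<^sup>2 + (cmod (g \<alpha>))\<^sup>2) summable_on UNIV"
    using assms by (intro summable_on_add) (simp_all add: hspace_fock)
  then show "(\<lambda>\<alpha>. norm (f \<alpha> * cnj (g \<alpha>))) summable_on UNIV"
  proof (rule summable_on_comparison_test)
    fix \<alpha>
    have "0 \<le> (cmod (f \<alpha>) - cmod (g \<alpha>))\<^sup>2" by simp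
    also have "\<dots> = (cmod (f \<alpha>))\<^sup>2 + (cmod (g \<alpha>))\<^sup>2 - 2 * (cmod (f \<alpha>) * cmod (g \<alpha>))"
      by (simp add: power2_diff)
    finally have "2 * (cmod (f \<alpha>) * cmod (g \<alpha>)) \<le> (cmod (f \<alpha>))\<^sup>2 + (cmod (g \<alpha>))\<^sup>2" by simp
    moreover have "0 \<le> cmod (f \<alpha>) * cmod (g \<alpha>)" by simp
    ultimately show "norm (f \<alpha> * cnj (g \<alpha>)) \<le> (cmod (f \<alpha>))\<^sup>2 + (cmod (g \<alpha>))\<^sup>2"
      unfolding norm_mult complex_mod_cnj by linarith
  qed simp
qed

lemma fock_add_mem:
  assumes "f \<in> hspace fock" "g \<in> hspace fock"
  shows "f + g \<in> hspace fock"
proof -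
  have "(\<lambda>\<alpha>. 2 * (cmod (f \<alpha>))\<^sup>2 + 2 * (cmod (g \<alpha>))\<^sup>2) summable_on UNIV"
    using assms by (intro summable_on_add summable_on_cmult_right) (simp_all add: hspace_fock)
  then have "(\<lambda>\<alpha>. (cmod ((f + g) \<alpha>))\<^sup>2) summable_on UNIV"
  proof (rule summable_on_comparison_test)
    fix \<alpha>
    have "(cmod ((f + g) \<alpha>))\<^sup>2 \<le> (cmod (f \<alpha>) + cmod (g \<alpha>))\<^sup>2"
      by (simp add: norm_triangle_ineq power_mono)
    also have "\<dots> \<le> 2 * (cmod (f \<alpha>))\<^sup>2 + 2 * (cmod (g \<alpha>))\<^sup>2"
      using zero_le_power2[of "cmod (f \<alpha>) - cmod (g \<alpha>)"] by (simp add: power2_sum power2_diff)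
    finally show "(cmod ((f + g) \<alpha>))\<^sup>2 \<le> 2 * (cmod (f \<alpha>))\<^sup>2 + 2 * (cmod (g \<alpha>))\<^sup>2" .
  qed simp
  then show ?thesis by (simp add: hspace_fock)
qed

lemma fock_scale_mem: "f \<in> hspace fock \<Longrightarrow> c *\<^sub>C f \<in> hspace fock"
  by (auto simp: hspace_fock scaleC_complex_def norm_mult power_mult_distrib
      intro: summable_on_cmult_right)

text \<open>Holds for every family: the complex and the real series are summable together, and both
  sums default to 0 otherwise.\<close>

lemma hinner_fock_self: "hinner fock f f = complex_of_real (\<Sum>\<^sub>\<infinity>\<alpha>. (cmod (f \<alpha>))\<^sup>2)"
proof -
  have "(\<Sum>\<^sub>\<infinity>\<alpha>. complex_of_real ((cmod (f \<alpha>))\<^sup>2))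
      = complex_of_real (\<Sum>\<^sub>\<infinity>\<alpha>. (cmod (f \<alpha>))\<^sup>2)"
    by (rule infsum_bounded_linear_strong[OF _ bounded_linear_of_real])
      (rule iffI, drule summable_on_bounded_linear[OF bounded_linear_Re],
        simp only: Re_complex_of_real, erule summable_on_of_real)
  then show ?thesis by (simp add: hinner_fock flip: complex_norm_square)
qed

lemma hnorm_fock: "hnorm fock f = sqrt (\<Sum>\<^sub>\<infinity>\<alpha>. (cmod (f \<alpha>))\<^sup>2)"
  by (simp add: hnorm_def hinner_fock_self)

lemma fock_finite_sum_le:
  assumes "f \<in> hspace fock" "finite A"
  shows "(\<Sum>\<alpha>\<in>A. (cmod (f \<alpha>))\<^sup>2) \<le> (hnorm fock f)\<^sup>2"
proof -
  have "(\<Sum>\<alpha>\<in>A. (cmod (f \<alpha>))\<^sup>2) \<le> (\<Sum>\<^sub>\<infinity>\<alpha>. (cmod (f \<alpha>))\<^sup>2)"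
    using assms by (intro finite_sum_le_infsum) (auto simp: hspace_fock)
  then show ?thesis by (simp add: hnorm_fock infsum_nonneg)
qed

lemma fock_memI:
  assumes "\<And>A. finite A \<Longrightarrow> (\<Sum>\<alpha>\<in>A. (cmod (f \<alpha>))\<^sup>2) \<le> e\<^sup>2" "0 \<le> e"
  shows "f \<in> hspace fock" "hnorm fock f \<le> e"
proof -
  have s: "(\<lambda>\<alpha>. (cmod (f \<alpha>))\<^sup>2) summable_on UNIV"
    using assms(1) by (intro nonneg_bdd_above_summable_on) (auto intro!: bdd_aboveI)
  then show "f \<in> hspace fock" by (simp add: hspace_fock)
  have "(\<Sum>\<^sub>\<infinity>\<alpha>. (cmod (f \<alpha>))\<^sup>2) \<le> e\<^sup>2"
    using s assms(1) by (intro infsum_le_finite_sums) auto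
  then show "hnorm fock f \<le> e" using assms(2) by (simp add: hnorm_fock real_le_lsqrt infsum_nonneg)
qed

text \<open>A Cauchy sequence converges coefficientwise. The Cauchy estimate passes to the limit on
  each finite set of words, and the bounds on finite sets add up to a bound on the norm, so the
  coefficientwise limit is the norm limit.\<close>

lemma fock_complete:
  assumes X: "\<And>n. X n \<in> hspace (fock :: ('n list \<Rightarrow> complex) hilb)" and c: "hcauchy fock X"
  shows "\<exists>l\<in>hspace fock. hlim fock X l"
proof -
  have diff: "X k - X n \<in> hspace fock" for k n
    using fock_add_mem[OF X[of k] fock_scale_mem[OF X[of n], of "-1"]] by simp
  have pt: "cmod (X k \<alpha> - X n \<alpha>) \<le> hnorm fock (X k - X n)" for k n \<alpha>
    using fock_finite_sum_le[OF diff, of "{\<alpha>}" k n]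
    by (simp add: hnorm_fock infsum_nonneg real_le_rsqrt)
  have "convergent (\<lambda>n. X n \<alpha>)" for \<alpha>
  proof -
    have "Cauchy (\<lambda>n. X n \<alpha>)"
      using c unfolding Cauchy_def hcauchy_def dist_norm by (meson pt le_less_trans)
    then show ?thesis by (rule Cauchy_convergent)
  qed
  then obtain f where f: "\<And>\<alpha>. (\<lambda>n. X n \<alpha>) \<longlonglongrightarrow> f \<alpha>" unfolding convergent_def by metis
  have bound: "X n - f \<in> hspace fock \<and> hnorm fock (X n - f) \<le> e"
    if e: "e > 0" and N: "\<And>m. m \<ge> N \<Longrightarrow> hnorm fock (X n - X m) < e" for n N e
  proof -
    have "(\<Sum>\<alpha>\<in>A. (cmod ((X n - f) \<alpha>))\<^sup>2) \<le> e\<^sup>2" if A: "finite A" for A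
    proof (rule LIMSEQ_le_const2)
      show "(\<lambda>m. \<Sum>\<alpha>\<in>A. (cmod (X n \<alpha> - X m \<alpha>))\<^sup>2) \<longlonglongrightarrow> (\<Sum>\<alpha>\<in>A. (cmod ((X n - f) \<alpha>))\<^sup>2)"
        unfolding fun_diff_def by (intro tendsto_intros f)
      have "(\<Sum>\<alpha>\<in>A. (cmod (X n \<alpha> - X m \<alpha>))\<^sup>2) \<le> e\<^sup>2" if "m \<ge> N" for m
        using fock_finite_sum_le[OF diff A, of n m] N[OF that] e
        by (smt (verit) fun_diff_def power_mono hnorm_fock infsum_nonneg real_sqrt_ge_zero
            zero_le_power2 sum.cong)
      then show "\<exists>N. \<forall>m\<ge>N. (\<Sum>\<alpha>\<in>A. (cmod (X n \<alpha> - X m \<alpha>))\<^sup>2) \<le> e\<^sup>2" by blast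
    qed
    then show ?thesis using fock_memI[of "X n - f" e] e by auto
  qed
  obtain N where "\<forall>m\<ge>N. \<forall>n\<ge>N. hnorm fock (X m - X n) < 1"
    using c[unfolded hcauchy_def, rule_format, of 1] by auto
  then have "X N - f \<in> hspace fock" using bound[of 1 N N] by simp
  then have fm: "f \<in> hspace fock"
    using fock_add_mem[OF X[of N] fock_scale_mem[of "X N - f" "-1"]] by simp
  have "hlim fock X f"
    unfolding hlim_def
  proof (rule LIMSEQ_I)
    fix r :: real assume r: "0 < r"
    then obtain N where N: "\<forall>m\<ge>N. \<forall>n\<ge>N. hnorm fock (X m - X n) < r/2"
      using c unfolding hcauchy_def by (metis half_gt_zero)
    have "norm (hnorm fock (X n - f) - 0) < r" if "n \<ge> N" for n
      using bound[of "r/2" N n] N that r by (auto simp: hnorm_fock infsum_nonneg)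
    then show "\<exists>no. \<forall>n\<ge>no. norm (hnorm fock (X n - f) - 0) < r" by blast
  qed
  then show ?thesis using fm by blast
qed

lemma hilbert_space_fock: "hilbert_space (fock :: ('n list \<Rightarrow> complex) hilb)"
proof
  show "csubspace (hspace (fock :: ('n list \<Rightarrow> complex) hilb))"
    by (rule complex_vector.subspaceI) (auto simp: fock_add_mem fock_scale_mem, simp add: hspace_fock)
next
  fix f g h :: "'n list \<Rightarrow> complex"
  assume "f \<in> hspace fock" "g \<in> hspace fock" "h \<in> hspace fock"
  then show "hinner fock (f + g) h = hinner fock f h + hinner fock g h"
    by (simp add: hinner_fock distrib_right infsum_add fock_summable_mult)
next
  fix f g :: "'n list \<Rightarrow> complex" and c
  assume "f \<in> hspace fock" "g \<in> hspace fock"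
  then show "hinner fock (c *\<^sub>C f) g = c * hinner fock f g"
    by (simp add: hinner_fock scaleC_complex_def mult.assoc infsum_cmult_right fock_summable_mult)
  show "hinner fock g f = cnj (hinner fock f g)"
    by (simp add: hinner_fock mult.commute flip: infsum_cnj)
next
  fix f :: "'n list \<Rightarrow> complex"
  assume f: "f \<in> hspace fock" "f \<noteq> 0"
  then obtain \<alpha> where "f \<alpha> \<noteq> 0" by (metis ext zero_fun_def)
  then have "0 < (\<Sum>\<alpha>\<in>{\<alpha>}. (cmod (f \<alpha>))\<^sup>2)" by simp
  also have "\<dots> \<le> (hnorm fock f)\<^sup>2" by (rule fock_finite_sum_le[OF f(1)]) simp
  finally show "0 < Re (hinner fock f f)" by (simp add: hnorm_fock hinner_fock_self infsum_nonneg)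
qed (rule fock_complete)

text \<open>Shows \<open>creation i\<close> as transport along the injection \<open>(#) i\<close>,
  the form in which infinite sums can be reindexed.\<close>

lemma creation_decomp: "creation i f \<alpha> = (if \<alpha> \<in> range ((#) i) then f (tl \<alpha>) else 0)"
  by (cases \<alpha>) auto

lemma hinner_creation_same: "hinner fock (creation i f) (creation i g) = hinner fock f g"
proof -
  have "hinner fock (creation i f) (creation i g)
      = (\<Sum>\<^sub>\<infinity>\<alpha>\<in>range ((#) i). f (tl \<alpha>) * cnj (g (tl \<alpha>)))"
    unfolding hinner_fock by (rule infsum_cong_neutral) (auto simp: creation_decomp)
  also have "\<dots> = hinner fock f g"
    by (subst infsum_reindex) (auto simp: hinner_fock o_def)
  finally show ?thesis .
qed

lemma hinner_creation_distinct:
  "i \<noteq> j \<Longrightarrow> hinner fock (creation i f) (creation j g) = 0"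
  unfolding hinner_fock by (rule infsum_0) (auto simp: creation_decomp)

lemma creation_mem:
  assumes "f \<in> hspace fock"
  shows "creation i f \<in> hspace fock"
proof -
  have "(\<lambda>\<alpha>. (cmod (f (tl \<alpha>)))\<^sup>2) summable_on range ((#) i)"
    using assms by (subst summable_on_reindex) (auto simp: hspace_fock o_def)
  also have "?this \<longleftrightarrow> (\<lambda>\<alpha>. (cmod (creation i f \<alpha>))\<^sup>2) summable_on UNIV"
    by (rule summable_on_cong_neutral) (auto simp: creation_decomp)
  finally show ?thesis by (simp add: hspace_fock)
qed

lemma creation_isometric: "isometric_op fock fock (creation i)"
  by (rule isometric_opI)
    (auto simp: creation_mem creation_decomp hnorm_def hinner_creation_same scaleC_complex_def
      intro!: ext)

section \<open>Gram matrices of finitely many vectors\<close>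

context hilbert_space
begin

text \<open>One Gram-Schmidt step per vector: splitting off the direction of \<open>g a\<close> adds
  one row of coefficients and reduces \<open>g a\<close> to zero. The result replaces vectors of an
  arbitrary Hilbert space by \<open>r\<close> scalar coordinates.\<close>

lemma gram_factorization:
  assumes "finite K" "\<And>k. k \<in> K \<Longrightarrow> g k \<in> hspace H"
  shows "\<exists>r (z :: nat \<Rightarrow> 'k \<Rightarrow> complex). \<forall>k\<in>K. \<forall>l\<in>K.
           hinner H (g k) (g l) = (\<Sum>s<r. z s k * cnj (z s l))"
  using assms
proof (induction K arbitrary: g rule: finite_induct)
  case (insert a K)
  \<comment> \<open>If \<open>g a = 0\<close> then \<open>e = 0\<close>, nothing is split off, and
    the new row is zero.\<close>
  define e where "e = complex_of_real (1 / hnorm H (g a)) *\<^sub>C g a"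
  define g' where "g' k = g k - hinner H (g k) e *\<^sub>C e" for k
  have gm: "g k \<in> hspace H" if "k \<in> insert a K" for k using insert.prems that .
  have em: "e \<in> hspace H" using gm by (simp add: e_def)
  have g'm: "g' k \<in> hspace H" if "k \<in> insert a K" for k using gm[OF that] em by (simp add: g'_def)
  have ee: "e = 0 \<or> hinner H e e = 1"
  proof (cases "g a = 0")
    case False
    then have "hnorm H (g a) \<noteq> 0" using hnorm_eq_0 gm by simp
    then have "hnorm H e = 1"
      using gm hnorm_nonneg[of "g a"] by (simp add: e_def hnorm_scale norm_divide)
    then show ?thesis using em by (simp add: inner_self)
  qed (simp add: e_def)
  have split: "hinner H (g k) (g l) = hinner H (g' k) (g' l) + hinner H (g k) e * cnj (hinner H (g l) e)"
    if "k \<in> insert a K" "l \<in> insert a K" for k l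
    using ee gm[OF that(1)] gm[OF that(2)] em inner_cnj[OF gm[OF that(2)] em]
    by (auto simp: g'_def inner_diff inner_diff_right inner_scale inner_scale_right)
  have "g' a = 0"
  proof (cases "g a = 0")
    case False
    then have "hnorm H (g a) \<noteq> 0" using hnorm_eq_0 gm by simp
    then show ?thesis
      using gm by (simp add: g'_def e_def inner_scale_right inner_self power2_eq_square scaleC_one)
  qed (simp add: g'_def em)
  obtain r and z :: "nat \<Rightarrow> 'k \<Rightarrow> complex" where
    z: "\<And>k l. k \<in> K \<Longrightarrow> l \<in> K \<Longrightarrow> hinner H (g' k) (g' l) = (\<Sum>s<r. z s k * cnj (z s l))"
    using insert.IH[of g'] g'm by blast
  \<comment> \<open>The old rows get the entry 0 at \<open>a\<close>, in accordance with
    \<open>g' a = 0\<close>, since the induction hypothesis says nothing about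
    \<open>z s a\<close>.\<close>
  define z' where "z' s k = (if s < r then if k = a then 0 else z s k else hinner H (g k) e)" for s k
  have "hinner H (g k) (g l) = (\<Sum>s<Suc r. z' s k * cnj (z' s l))"
    if kl: "k \<in> insert a K" "l \<in> insert a K" for k l
  proof -
    have "hinner H (g' k) (g' l) = (\<Sum>s<r. z' s k * cnj (z' s l))"
    proof (cases "k = a \<or> l = a")
      case True
      then show ?thesis using \<open>g' a = 0\<close> g'm kl by (auto simp: z'_def)
    next
      case False
      then show ?thesis using z[of k l] kl by (simp add: z'_def)
    qed
    then show ?thesis using split[OF kl] by (simp add: z'_def)
  qed
  then show ?case by blast
qed simp

end

subsection \<open>Isometries with orthogonal ranges\<close>

text \<open>The norm of \<open>x + y\<close> determines the real part; replacing \<open>y\<close> by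
  \<open>\<i> *\<^sub>C y\<close> turns the imaginary part into a real part.\<close>

lemma isometric_hinner:
  assumes H: "hilbert_space H" and K: "hilbert_space K" and A: "isometric_op H K A"
    and x: "x \<in> hspace H" and y: "y \<in> hspace H"
  shows "hinner K (A x) (A y) = hinner H x y"
proof -
  interpret H: hilbert_space H by fact
  interpret K: hilbert_space K by fact
  note Ab = bounded_opD[OF isometric_opD(1)[OF A]]
  have Re: "Re (hinner K (A x) (A y)) = Re (hinner H x y)" if "y \<in> hspace H" for y
    using K.hnorm_add_sq[OF Ab(1)[OF x] Ab(1)[OF that]] H.hnorm_add_sq[OF x that]
      isometric_opD(2)[OF A, of "x + y"] isometric_opD(2)[OF A x] isometric_opD(2)[OF A that]
      Ab(2)[OF x that] x that by simp
  have "Im (hinner K (A x) (A y)) = Im (hinner H x y)"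
    using Re[of "\<i> *\<^sub>C y"] x y by (simp add: Ab H.inner_scale_right K.inner_scale_right)
  then show ?thesis using Re[OF y] by (simp add: complex_eq_iff)
qed

lemma word_op_append: "word_op T (\<alpha> @ \<beta>) x = word_op T \<alpha> (word_op T \<beta> x)"
  by (induction \<alpha>) simp_all

lemma nc_eval_eq_sum:
  assumes "finite B" "{\<alpha>. q \<alpha> \<noteq> 0} \<subseteq> B"
  shows "nc_eval T q x = (\<Sum>\<alpha>\<in>B. q \<alpha> *\<^sub>C word_op T \<alpha> x)"
  unfolding nc_eval_def sum_fun_apply scaleC_fun_apply
  using assms by (intro sum.mono_neutral_left) auto

locale row_isometry = hilbert_space G
  for G :: "'g::complex_vector hilb" +
  fixes V :: "'n \<Rightarrow> 'g \<Rightarrow> 'g"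
  assumes isometry: "\<And>i. isometric_op G G (V i)"
    and orthogonal_ranges:
      "\<And>i j x y. \<lbrakk>i \<noteq> j; x \<in> hspace G; y \<in> hspace G\<rbrakk> \<Longrightarrow> hinner G (V i x) (V j y) = 0"
begin

lemmas V_mem = bounded_opD(1)[OF isometric_opD(1)[OF isometry]]

lemma word_mem: "x \<in> hspace G \<Longrightarrow> word_op V \<alpha> x \<in> hspace G"
  by (rule word_op_mem) (auto simp: V_mem)

lemma hinner_V: "\<lbrakk>x \<in> hspace G; y \<in> hspace G\<rbrakk> \<Longrightarrow> hinner G (V i x) (V i y) = hinner G x y"
  by (rule isometric_hinner[OF _ _ isometry]) (auto intro: hilbert_space_axioms)

text \<open>The Hilbert space adjoint of \<open>V i\<close>. As the range of an isometry is closed,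
  projecting onto it and inverting gives the adjoint without a representation theorem for
  functionals.\<close>

definition adj :: "'n \<Rightarrow> 'g \<Rightarrow> 'g" where
  "adj i x = inv_into (hspace G) (V i) (orth_proj G (V i ` hspace G) x)"

lemma adj:
  assumes x: "x \<in> hspace G"
  shows "adj i x \<in> hspace G" and "y \<in> hspace G \<Longrightarrow> hinner G (adj i x) y = hinner G x (V i y)"
proof -
  note P = orth_proj_range_isometry[OF hilbert_space_axioms hilbert_space_axioms isometry x]
  show a: "adj i x \<in> hspace G" unfolding adj_def by (rule inv_into_into) (rule P)
  have V_adj: "V i (adj i x) = orth_proj G (V i ` hspace G) x"
    unfolding adj_def by (rule f_inv_into_f) (rule P)
  assume y: "y \<in> hspace G"
  have "hinner G (x - V i (adj i x)) (V i y) = 0" using P(2) y by (simp add: V_adj)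
  then show "hinner G (adj i x) y = hinner G x (V i y)"
    using x y a by (simp add: inner_diff V_mem hinner_V)
qed

lemma adj_right:
  assumes "x \<in> hspace G" "y \<in> hspace G"
  shows "hinner G y (adj i x) = hinner G (V i y) x"
  using adj[OF assms(1)] assms by (metis V_mem inner_cnj)

text \<open>This is \<open>V_\<alpha>^*\<close>; the adjoint of a product reverses the
  factors.\<close>

definition adj_word :: "'n list \<Rightarrow> 'g \<Rightarrow> 'g" where
  "adj_word \<alpha> = word_op adj (rev \<alpha>)"

lemma adj_word_simps [simp]:
  "adj_word [] x = x"
  "adj_word (i # \<alpha>) x = adj_word \<alpha> (adj i x)"
  "adj_word (\<alpha> @ \<beta>) x = adj_word \<beta> (adj_word \<alpha> x)"
  by (simp_all add: adj_word_def word_op_append)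

lemma adj_word_mem: "x \<in> hspace G \<Longrightarrow> adj_word \<alpha> x \<in> hspace G"
  unfolding adj_word_def by (rule word_op_mem) (auto simp: adj)

lemma adj_word_right:
  "\<lbrakk>x \<in> hspace G; y \<in> hspace G\<rbrakk> \<Longrightarrow> hinner G y (adj_word \<alpha> x) = hinner G (word_op V \<alpha> y) x"
  by (induction \<alpha> arbitrary: x) (simp_all add: adj adj_right word_mem)

end

subsection \<open>The Poisson kernel\<close>

locale finite_row_isometry = row_isometry G V
  for G :: "'g::complex_vector hilb" and V :: "'n::finite \<Rightarrow> 'g \<Rightarrow> 'g"
begin

definition range_proj :: "'g \<Rightarrow> 'g" where
  "range_proj x = (\<Sum>i\<in>UNIV. V i (adj i x))"

lemma range_proj_mem: "x \<in> hspace G \<Longrightarrow> range_proj x \<in> hspace G"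
  unfolding range_proj_def by (intro sum_mem V_mem adj)

text \<open>\<open>range_proj\<close> is a self-adjoint idempotent: the orthogonality of the ranges
  kills the terms with two distinct letters. The agreement of the three forms is what makes the
  square root in \<open>defect\<close> explicit.\<close>

lemma hinner_range_proj:
  assumes "x \<in> hspace G" "y \<in> hspace G"
  shows "hinner G (range_proj x) y = (\<Sum>i\<in>UNIV. hinner G (adj i x) (adj i y))"
    and "hinner G x (range_proj y) = (\<Sum>i\<in>UNIV. hinner G (adj i x) (adj i y))"
    and "hinner G (range_proj x) (range_proj y) = (\<Sum>i\<in>UNIV. hinner G (adj i x) (adj i y))"
proof -
  show "hinner G (range_proj x) y = (\<Sum>i\<in>UNIV. hinner G (adj i x) (adj i y))"
    using assms by (simp add: range_proj_def inner_sum adj V_mem adj_right)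
  show "hinner G x (range_proj y) = (\<Sum>i\<in>UNIV. hinner G (adj i x) (adj i y))"
    using assms by (simp add: range_proj_def inner_sum_right adj V_mem)
  have "hinner G (V i (adj i x)) (range_proj y) = hinner G (adj i x) (adj i y)" for i
  proof -
    have "hinner G (V i (adj i x)) (V j (adj j y))
        = (if j = i then hinner G (adj i x) (adj i y) else 0)" for j
      using assms orthogonal_ranges[of i j "adj i x" "adj j y"] hinner_V[of "adj i x" "adj i y" i]
      by (auto simp: adj(1))
    moreover have "hinner G (V i (adj i x)) (range_proj y)
        = (\<Sum>j\<in>UNIV. hinner G (V i (adj i x)) (V j (adj j y)))"
      unfolding range_proj_def using assms by (intro inner_sum_right V_mem adj(1))
    ultimately have "hinner G (V i (adj i x)) (range_proj y)
        = (\<Sum>j\<in>UNIV. if j = i then hinner G (adj i x) (adj i y) else 0)" by simp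
    then show ?thesis by simp
  qed
  then show "hinner G (range_proj x) (range_proj y) = (\<Sum>i\<in>UNIV. hinner G (adj i x) (adj i y))"
    using assms by (subst range_proj_def, subst inner_sum) (simp_all add: range_proj_mem V_mem adj)
qed

text \<open>The square root of \<open>1 - r\<^sup>2 \<Sum>\<^sub>i V\<^sub>i V\<^sub>i\<^sup>*\<close>, explicit because \<open>\<Sum>\<^sub>i V\<^sub>i V\<^sub>i\<^sup>*\<close> is a projection.\<close>

definition defect :: "real \<Rightarrow> 'g \<Rightarrow> 'g" where
  "defect r x = x - complex_of_real (1 - sqrt (1 - r\<^sup>2)) *\<^sub>C range_proj x"

lemma defect_mem: "x \<in> hspace G \<Longrightarrow> defect r x \<in> hspace G"
  by (simp add: defect_def range_proj_mem)

lemma hinner_defect: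
  assumes "x \<in> hspace G" "y \<in> hspace G" and r: "0 \<le> r" "r \<le> 1"
  shows "hinner G (defect r x) (defect r y)
       = hinner G x y - complex_of_real (r\<^sup>2) * (\<Sum>i\<in>UNIV. hinner G (adj i x) (adj i y))"
proof -
  \<comment> \<open>For a projection P, the square of \<open>1 - k P\<close> is
    \<open>1 - (2 k - k\<^sup>2) P\<close>. This \<open>k\<close> is the root of
    \<open>2 k - k\<^sup>2 = r\<^sup>2\<close> in [0, 1].\<close>
  define k where "k = 1 - sqrt (1 - r\<^sup>2)"
  define S where "S = (\<Sum>i\<in>UNIV. hinner G (adj i x) (adj i y))"
  have "r\<^sup>2 \<le> 1" using r by (simp add: power_le_one)
  then have k: "2 * k - k\<^sup>2 = r\<^sup>2" by (simp add: k_def power2_diff)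
  have "hinner G (defect r x) (defect r y)
      = hinner G x y - complex_of_real k * S
        - complex_of_real k * (S - complex_of_real k * S)"
    using assms(1,2) unfolding defect_def k_def[symmetric] S_def
    by (simp only: inner_diff inner_diff_right inner_scale inner_scale_right
        range_proj_mem hinner_range_proj[OF assms(1,2)] diff_mem scale_mem
        complex_cnj_complex_of_real)
  also have "\<dots> = hinner G x y - (2 * complex_of_real k - (complex_of_real k)\<^sup>2) * S"
    by (simp add: power2_eq_square algebra_simps)
  also have "2 * complex_of_real k - (complex_of_real k)\<^sup>2 = complex_of_real (r\<^sup>2)"
    by (simp flip: k)
  finally show ?thesis by (simp add: S_def)
qed

lemma finite_words_length: "finite {\<alpha> :: 'n list. length \<alpha> = N}"
  and finite_words_below: "finite {\<alpha> :: 'n list. length \<alpha> < N}"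
  using finite_lists_length_eq[of "UNIV :: 'n set" N] finite_lists_length_le[of "UNIV :: 'n set" N]
  by (auto elim: finite_subset[rotated])

text \<open>The new letter goes to the right end because \<open>adj_word (\<alpha> @ [i])\<close>
  applies \<open>adj i\<close> last, which is the term produced by
  \<open>hinner_defect\<close>.\<close>

lemma sum_words_Suc:
  "(\<Sum>\<alpha> | length \<alpha> = Suc N. f (\<alpha> :: 'n list))
    = (\<Sum>\<alpha> | length \<alpha> = N. \<Sum>i\<in>UNIV. f (\<alpha> @ [i]) :: 'c::comm_monoid_add)"
proof -
  have "bij_betw (\<lambda>(\<alpha>, i). \<alpha> @ [i]) ({\<alpha> :: 'n list. length \<alpha> = N} \<times> UNIV) {\<alpha>. length \<alpha> = Suc N}"
    by (rule bij_betw_byWitness[where f' = "\<lambda>\<alpha>. (butlast \<alpha>, last \<alpha>)"])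
      (auto, metis append_butlast_last_id length_0_conv nat.simps(3))
  then show ?thesis
    by (simp add: sum.cartesian_product sum.reindex_bij_betw[symmetric] case_prod_unfold)
qed

text \<open>Let A_N be the sum of the
  \<open>hinner G (adj_word \<alpha> x) (adj_word \<alpha> y)\<close> over the words of length N. By
  \<open>hinner_defect\<close> level N contributes r^(2N) A_N - r^(2N+2) A_(N+1).\<close>

lemma poisson_telescope:
  assumes x: "x \<in> hspace G" and y: "y \<in> hspace G" and r: "0 \<le> r" "r \<le> 1"
  shows "(\<Sum>\<alpha> | length \<alpha> < N. complex_of_real (r ^ (2 * length \<alpha>))
            * hinner G (defect r (adj_word \<alpha> x)) (defect r (adj_word \<alpha> y)))
       = hinner G x y - complex_of_real (r ^ (2 * N))
            * (\<Sum>\<alpha> | length \<alpha> = N. hinner G (adj_word \<alpha> x) (adj_word \<alpha> y))"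
proof (induction N)
  case 0
  then show ?case by simp
next
  case (Suc N)
  have "{\<alpha> :: 'n list. length \<alpha> < Suc N} = {\<alpha>. length \<alpha> < N} \<union> {\<alpha>. length \<alpha> = N}" by auto
  then have "(\<Sum>\<alpha> | length \<alpha> < Suc N. complex_of_real (r ^ (2 * length \<alpha>))
            * hinner G (defect r (adj_word \<alpha> x)) (defect r (adj_word \<alpha> y)))
      = hinner G x y - complex_of_real (r ^ (2 * N))
            * (\<Sum>\<alpha> | length \<alpha> = N. hinner G (adj_word \<alpha> x) (adj_word \<alpha> y))
        + (\<Sum>\<alpha> | length \<alpha> = N. complex_of_real (r ^ (2 * N))
            * hinner G (defect r (adj_word \<alpha> x)) (defect r (adj_word \<alpha> y)))"
    by (simp add: sum.union_disjoint finite_words_length finite_words_below disjoint_iff Suc.IH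
        del: of_real_power)
  also have "(\<Sum>\<alpha> | length \<alpha> = N. complex_of_real (r ^ (2 * N))
            * hinner G (defect r (adj_word \<alpha> x)) (defect r (adj_word \<alpha> y)))
      = complex_of_real (r ^ (2 * N))
          * (\<Sum>\<alpha> | length \<alpha> = N. hinner G (adj_word \<alpha> x) (adj_word \<alpha> y))
        - complex_of_real (r ^ (2 * Suc N))
          * (\<Sum>\<alpha> | length \<alpha> = Suc N. hinner G (adj_word \<alpha> x) (adj_word \<alpha> y))"
    by (simp add: hinner_defect[OF adj_word_mem[OF x] adj_word_mem[OF y] r] sum_words_Suc
        sum_subtractf sum_distrib_left algebra_simps power2_eq_square)
  finally show ?case by simp
qed

lemma poisson_bound:
  assumes x: "x \<in> hspace G" and r: "0 \<le> r" "r \<le> 1"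
  shows "(\<Sum>\<alpha> | length \<alpha> < N. r ^ (2 * length \<alpha>) * (hnorm G (defect r (adj_word \<alpha> x)))\<^sup>2)
      + r ^ (2 * N) * (\<Sum>\<alpha> | length \<alpha> = N. (hnorm G (adj_word \<alpha> x))\<^sup>2) = (hnorm G x)\<^sup>2"
proof -
  have "complex_of_real ((\<Sum>\<alpha> | length \<alpha> < N. r ^ (2 * length \<alpha>) * (hnorm G (defect r (adj_word \<alpha> x)))\<^sup>2)
      + r ^ (2 * N) * (\<Sum>\<alpha> | length \<alpha> = N. (hnorm G (adj_word \<alpha> x))\<^sup>2))
      = complex_of_real ((hnorm G x)\<^sup>2)"
    using poisson_telescope[OF x x r, of N] x
    by (simp add: inner_self adj_word_mem defect_mem)
  then show ?thesis by (simp only: of_real_eq_iff)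
qed

text \<open>The case \<open>r = 1\<close> of \<open>poisson_bound\<close>, where the remainder has
  weight 1 and the other terms are nonnegative. It controls the remainder for all smaller
  radii.\<close>

lemma adj_words_bound:
  assumes "x \<in> hspace G"
  shows "(\<Sum>\<alpha> | length \<alpha> = N. (hnorm G (adj_word \<alpha> x))\<^sup>2) \<le> (hnorm G x)\<^sup>2"
  using poisson_bound[OF assms, of 1 N]
    sum_nonneg[of "{\<alpha>::'n list. length \<alpha> < N}" "\<lambda>\<alpha>. (hnorm G (defect 1 (adj_word \<alpha> x)))\<^sup>2"]
  by simp

text \<open>Only independence of \<open>N\<close> matters here, so the crude estimate a b \<le> a^2
  + b^2 suffices.\<close>

lemma adj_words_hinner_bound:
  assumes "x \<in> hspace G" "y \<in> hspace G"
  shows "cmod (\<Sum>\<alpha> | length \<alpha> = N. hinner G (adj_word \<alpha> x) (adj_word \<alpha> y))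
      \<le> (hnorm G x)\<^sup>2 + (hnorm G y)\<^sup>2"
proof -
  have "cmod (\<Sum>\<alpha> | length \<alpha> = N. hinner G (adj_word \<alpha> x) (adj_word \<alpha> y))
      \<le> (\<Sum>\<alpha> | length \<alpha> = N. (hnorm G (adj_word \<alpha> x))\<^sup>2 + (hnorm G (adj_word \<alpha> y))\<^sup>2)"
  proof (rule sum_norm_le)
    fix \<alpha>
    have n: "0 \<le> hnorm G (adj_word \<alpha> x)" "0 \<le> hnorm G (adj_word \<alpha> y)"
      using assms by (simp_all add: hnorm_nonneg adj_word_mem)
    have "cmod (hinner G (adj_word \<alpha> x) (adj_word \<alpha> y))
        \<le> hnorm G (adj_word \<alpha> x) * hnorm G (adj_word \<alpha> y)"
      using assms by (intro cauchy_schwarz adj_word_mem)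
    also have "\<dots> \<le> (hnorm G (adj_word \<alpha> x))\<^sup>2 + (hnorm G (adj_word \<alpha> y))\<^sup>2"
      using zero_le_power2[of "hnorm G (adj_word \<alpha> x) - hnorm G (adj_word \<alpha> y)"]
        mult_nonneg_nonneg[OF n] unfolding power2_diff by linarith
    finally show "cmod (hinner G (adj_word \<alpha> x) (adj_word \<alpha> y))
        \<le> (hnorm G (adj_word \<alpha> x))\<^sup>2 + (hnorm G (adj_word \<alpha> y))\<^sup>2" .
  qed
  also have "\<dots> \<le> (hnorm G x)\<^sup>2 + (hnorm G y)\<^sup>2"
    unfolding sum.distrib using assms by (intro add_mono adj_words_bound)
  finally show ?thesis .
qed

definition poisson :: "real \<Rightarrow> nat \<Rightarrow> 'g \<Rightarrow> 'n list \<Rightarrow> 'g" where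
  "poisson r N x \<alpha> = (if length \<alpha> < N
     then complex_of_real (r ^ length \<alpha>) *\<^sub>C defect r (adj_word \<alpha> x) else 0)"

lemma poisson_mem: "x \<in> hspace G \<Longrightarrow> poisson r N x \<alpha> \<in> hspace G"
  by (simp add: poisson_def defect_mem adj_word_mem)

lemma poisson_norm:
  assumes x: "x \<in> hspace G" and r: "0 \<le> r" "r \<le> 1"
  shows "(\<Sum>\<alpha> | length \<alpha> < N. (hnorm G (poisson r N x \<alpha>))\<^sup>2) \<le> (hnorm G x)\<^sup>2"
proof -
  have "(\<Sum>\<alpha> | length \<alpha> < N. (hnorm G (poisson r N x \<alpha>))\<^sup>2)
      = (\<Sum>\<alpha> | length \<alpha> < N. r ^ (2 * length \<alpha>) * (hnorm G (defect r (adj_word \<alpha> x)))\<^sup>2)"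
    using x r by (intro sum.cong refl)
      (simp add: poisson_def hnorm_scale defect_mem adj_word_mem power_mult_distrib norm_power
        power_mult[symmetric] mult.commute)
  also have "\<dots> \<le> (hnorm G x)\<^sup>2"
  proof -
    have "0 \<le> r ^ (2 * N) * (\<Sum>\<alpha> | length \<alpha> = N. (hnorm G (adj_word \<alpha> x))\<^sup>2)"
      using r by (simp add: sum_nonneg)
    then show ?thesis using poisson_bound[OF x r, of N] by linarith
  qed
  finally show ?thesis .
qed

text \<open>The sum pairs the image of the transform of \<open>x\<close> under
  \<open>S_\<beta>\<close> (tensored with the identity) with the transform of \<open>y\<close>.
  Since \<open>V_{\<beta>\<alpha>}^* = V_\<alpha>^* V_\<beta>^*\<close>, it is
  \<open>r ^ length \<beta>\<close> times the telescoping sum for \<open>x\<close> and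
  \<open>V_\<beta>^* y\<close>, whose remainder decays geometrically.\<close>

lemma poisson_pairing:
  assumes x: "x \<in> hspace G" and y: "y \<in> hspace G" and r: "0 \<le> r" "r < 1"
  shows "(\<lambda>N. \<Sum>\<alpha> | length \<alpha> < N. hinner G (poisson r N x \<alpha>) (poisson r N y (\<beta> @ \<alpha>)))
           \<longlonglongrightarrow> complex_of_real (r ^ length \<beta>) * hinner G (word_op V \<beta> x) y"
proof -
  define z where "z = adj_word \<beta> y"
  have z: "z \<in> hspace G" unfolding z_def by (rule adj_word_mem[OF y])
  define R where "R N = (\<Sum>\<alpha> | length \<alpha> = N. hinner G (adj_word \<alpha> x) (adj_word \<alpha> z))" for N
  \<comment> \<open>With the cutoff \<open>N + length \<beta>\<close> exactly the words with
    \<open>length \<alpha> < N\<close> survive, because \<open>\<beta> @ \<alpha>\<close> must also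
    stay below it. \<open>LIMSEQ_offset\<close> removes the shift.\<close>
  have eq: "(\<Sum>\<alpha> | length \<alpha> < N + length \<beta>.
        hinner G (poisson r (N + length \<beta>) x \<alpha>) (poisson r (N + length \<beta>) y (\<beta> @ \<alpha>)))
      = complex_of_real (r ^ length \<beta>) * (hinner G (word_op V \<beta> x) y - complex_of_real (r ^ (2 * N)) * R N)"
    for N
  proof -
    have "(\<Sum>\<alpha> | length \<alpha> < N + length \<beta>.
        hinner G (poisson r (N + length \<beta>) x \<alpha>) (poisson r (N + length \<beta>) y (\<beta> @ \<alpha>)))
      = (\<Sum>\<alpha> | length \<alpha> < N. complex_of_real (r ^ length \<beta>) * (complex_of_real (r ^ (2 * length \<alpha>))
            * hinner G (defect r (adj_word \<alpha> x)) (defect r (adj_word \<alpha> z))))"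
    proof (intro sum.mono_neutral_cong_right finite_words_below ballI)
      fix \<alpha> :: "'n list" assume "\<alpha> \<in> {\<alpha>. length \<alpha> < N + length \<beta>} - {\<alpha>. length \<alpha> < N}"
      then show "hinner G (poisson r (N + length \<beta>) x \<alpha>) (poisson r (N + length \<beta>) y (\<beta> @ \<alpha>)) = 0"
        using poisson_mem[OF x] by (simp add: poisson_def[of _ _ y])
    next
      fix \<alpha> :: "'n list" assume "\<alpha> \<in> {\<alpha>. length \<alpha> < N}"
      then show "hinner G (poisson r (N + length \<beta>) x \<alpha>) (poisson r (N + length \<beta>) y (\<beta> @ \<alpha>))
          = complex_of_real (r ^ length \<beta>) * (complex_of_real (r ^ (2 * length \<alpha>))
            * hinner G (defect r (adj_word \<alpha> x)) (defect r (adj_word \<alpha> z)))"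
        using x z by (simp add: poisson_def defect_mem adj_word_mem inner_scale inner_scale_right
            power_add mult_2 flip: z_def)
    qed auto
    also have "\<dots> = complex_of_real (r ^ length \<beta>) * (hinner G x z - complex_of_real (r ^ (2 * N)) * R N)"
      using poisson_telescope[OF x z, of r N] r by (simp add: R_def flip: sum_distrib_left)
    finally show ?thesis using adj_word_right[OF y x, of \<beta>] by (simp only: z_def)
  qed
  have "(\<lambda>N. complex_of_real (r ^ (2 * N)) * R N) \<longlonglongrightarrow> 0"
  proof (rule Lim_null_comparison)
    have "norm (complex_of_real (r ^ (2 * N)) * R N)
        \<le> (r\<^sup>2) ^ N * ((hnorm G x)\<^sup>2 + (hnorm G z)\<^sup>2)" for N
    proof -
      have "norm (complex_of_real (r ^ (2 * N)) * R N) = (r\<^sup>2) ^ N * cmod (R N)"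
        using r by (simp add: norm_mult norm_power power_mult)
      also have "\<dots> \<le> (r\<^sup>2) ^ N * ((hnorm G x)\<^sup>2 + (hnorm G z)\<^sup>2)"
        unfolding R_def by (intro mult_left_mono adj_words_hinner_bound x z) simp
      finally show ?thesis .
    qed
    then show "\<forall>\<^sub>F N in sequentially. norm (complex_of_real (r ^ (2 * N)) * R N)
        \<le> (r\<^sup>2) ^ N * ((hnorm G x)\<^sup>2 + (hnorm G z)\<^sup>2)"
      by simp
    show "(\<lambda>N. (r\<^sup>2) ^ N * ((hnorm G x)\<^sup>2 + (hnorm G z)\<^sup>2)) \<longlonglongrightarrow> 0"
    proof (intro tendsto_mult_left_zero LIMSEQ_power_zero)
      show "norm (r\<^sup>2) < 1" using r by (simp add: power2_less_1_iff)
    qed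
  qed
  then have "(\<lambda>N. complex_of_real (r ^ length \<beta>) * (hinner G (word_op V \<beta> x) y - complex_of_real (r ^ (2 * N)) * R N))
      \<longlonglongrightarrow> complex_of_real (r ^ length \<beta>) * (hinner G (word_op V \<beta> x) y - 0)"
    by (intro tendsto_intros)
  then show ?thesis unfolding eq[symmetric] diff_zero by (rule LIMSEQ_offset[where k = "length \<beta>"])
qed

end

subsection \<open>The von Neumann inequality for isometries with orthogonal ranges\<close>

text \<open>The shape shared by \<open>mat_op\<close> and \<open>nc_meval\<close>: a matrix of
  scalar polynomials, of which only the entries below \<open>m\<close> are read. The value 0 from
  \<open>m\<close> on keeps the result in the ampliation.\<close>

definition mat_eval ::
  "nat \<Rightarrow> ('n \<Rightarrow> 'a \<Rightarrow> 'a) \<Rightarrow> (nat \<Rightarrow> nat \<Rightarrow> 'n list \<Rightarrow> complex) \<Rightarrow> (nat \<Rightarrow> 'a) \<Rightarrow>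
   nat \<Rightarrow> 'a::complex_vector" where
  "mat_eval m T q x = (\<lambda>i. if i < m then \<Sum>j<m. nc_eval T (q i j) (x j) else 0)"

lemma (in hilbert_space) nc_eval_mem:
  assumes "\<And>i x. x \<in> hspace H \<Longrightarrow> T i x \<in> hspace H" "x \<in> hspace H"
  shows "nc_eval T q x \<in> hspace H"
  unfolding nc_eval_def sum_fun_apply scaleC_fun_apply
  by (intro sum_mem scale_mem word_op_mem assms)

lemma (in hilbert_space) mat_eval_mem:
  assumes "\<And>i x. x \<in> hspace H \<Longrightarrow> T i x \<in> hspace H" "x \<in> hspace (ampliation m H)"
  shows "mat_eval m T q x \<in> hspace (ampliation m H)"
  using assms by (auto simp: hspace_ampliation mat_eval_def intro!: sum_mem nc_eval_mem)

lemma row_isometry_creation: "row_isometry fock creation"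
  by (intro row_isometry.intro hilbert_space_fock row_isometry_axioms.intro creation_isometric
      hinner_creation_distinct)

lemma fock_finite_support:
  assumes "finite W" "\<And>\<alpha>. \<alpha> \<notin> W \<Longrightarrow> f \<alpha> = 0"
  shows "f \<in> hspace fock" and "(hnorm fock f)\<^sup>2 = (\<Sum>\<alpha>\<in>W. (cmod (f \<alpha>))\<^sup>2)"
proof -
  have "(\<lambda>\<alpha>. (cmod (f \<alpha>))\<^sup>2) summable_on W" using assms(1) by simp
  also have "?this \<longleftrightarrow> (\<lambda>\<alpha>. (cmod (f \<alpha>))\<^sup>2) summable_on UNIV"
    using assms(2) by (intro summable_on_cong_neutral) auto
  finally show "f \<in> hspace fock" by (simp add: hspace_fock)
  have "(\<Sum>\<^sub>\<infinity>\<alpha>. (cmod (f \<alpha>))\<^sup>2) = (\<Sum>\<^sub>\<infinity>\<alpha>\<in>W. (cmod (f \<alpha>))\<^sup>2)"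
    using assms(2) by (intro infsum_cong_neutral) auto
  then show "(hnorm fock f)\<^sup>2 = (\<Sum>\<alpha>\<in>W. (cmod (f \<alpha>))\<^sup>2)"
    using assms(1) by (simp add: hnorm_fock sum_nonneg)
qed

lemma word_op_creation:
  "word_op creation \<beta> f \<gamma> = (if \<gamma> \<in> range ((@) \<beta>) then f (drop (length \<beta>) \<gamma>) else 0)"
proof (induction \<beta> arbitrary: \<gamma>)
  case (Cons i \<beta>)
  show ?case by (cases \<gamma>) (auto simp: Cons.IH)
qed auto

lemma hinner_fock_word_op:
  assumes "finite W" "\<And>\<alpha>. \<alpha> \<notin> W \<Longrightarrow> f \<alpha> = 0"
  shows "hinner fock (word_op creation \<beta> f) g = (\<Sum>\<alpha>\<in>W. f \<alpha> * cnj (g (\<beta> @ \<alpha>)))"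
proof -
  have "hinner fock (word_op creation \<beta> f) g
      = (\<Sum>\<^sub>\<infinity>\<gamma>\<in>range ((@) \<beta>). f (drop (length \<beta>) \<gamma>) * cnj (g \<gamma>))"
    unfolding hinner_fock by (rule infsum_cong_neutral) (auto simp: word_op_creation)
  also have "\<dots> = (\<Sum>\<^sub>\<infinity>\<alpha>. f \<alpha> * cnj (g (\<beta> @ \<alpha>)))"
    by (subst infsum_reindex) (auto simp: o_def inj_on_def)
  also have "\<dots> = (\<Sum>\<^sub>\<infinity>\<alpha>\<in>W. f \<alpha> * cnj (g (\<beta> @ \<alpha>)))"
    using assms(2) by (intro infsum_cong_neutral) auto
  finally show ?thesis using assms(1) by simp
qed

text \<open>\<open>c\<close> will be the operator norm of \<open>q(S)\<close>. Reducing it to one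
  inequality keeps suprema out of the estimates.\<close>

locale fock_bounded_polynomial =
  fixes m :: nat and q :: "nat \<Rightarrow> nat \<Rightarrow> 'n list \<Rightarrow> complex" and c :: real
  assumes polys: "\<And>i j. \<lbrakk>i < m; j < m\<rbrakk> \<Longrightarrow> q i j \<in> nc_polys"
    and c_nonneg: "0 \<le> c"
    and bound: "\<And>x. x \<in> hspace (ampliation m fock) \<Longrightarrow>
      hnorm (ampliation m fock) (mat_eval m creation q x) \<le> c * hnorm (ampliation m fock) x"
begin

definition support :: "'n list set" where
  "support = (\<Union>i<m. \<Union>j<m. {\<alpha>. q i j \<alpha> \<noteq> 0})"

lemma finite_support: "finite support"
  using polys unfolding support_def nc_polys_def by auto

lemma nc_eval_support:
  assumes "i < m" "j < m"
  shows "nc_eval T (q i j) x = (\<Sum>\<beta>\<in>support. q i j \<beta> *\<^sub>C word_op T \<beta> x)"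
  using assms by (intro nc_eval_eq_sum finite_support) (auto simp: support_def)

text \<open>Cauchy-Schwarz bounds the form by \<open>c\<close> times a product of norms. The product
  is weakened to half the sum of squares because the latter is additive and can be summed over the
  coordinates of a Gram factorization.\<close>

lemma scalar_form_bound:
  assumes W: "finite W"
    and a0: "\<And>j \<alpha>. \<alpha> \<notin> W \<Longrightarrow> a j \<alpha> = 0" and b0: "\<And>j \<alpha>. \<alpha> \<notin> W \<Longrightarrow> b j \<alpha> = 0"
  shows "Re (\<Sum>i<m. \<Sum>j<m. \<Sum>\<beta>\<in>support. q i j \<beta> * (\<Sum>\<alpha>\<in>W. a j \<alpha> * cnj (b i (\<beta> @ \<alpha>))))
      \<le> c / 2 * ((\<Sum>j<m. \<Sum>\<alpha>\<in>W. (cmod (a j \<alpha>))\<^sup>2) + (\<Sum>i<m. \<Sum>\<alpha>\<in>W. (cmod (b i \<alpha>))\<^sup>2))"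
proof -
  interpret F: row_isometry fock "creation :: 'n \<Rightarrow> _" by (rule row_isometry_creation)
  interpret A: hilbert_space "ampliation m (fock :: ('n list \<Rightarrow> complex) hilb)"
    by (rule hilbert_space_ampliation) (rule hilbert_space_fock)
  define x where "x = (\<lambda>j. if j < m then a j else 0)"
  define y where "y = (\<lambda>j. if j < m then b j else 0)"
  note af = fock_finite_support[of W "a _", OF W a0] and bf = fock_finite_support[of W "b _", OF W b0]
  have x: "x \<in> hspace (ampliation m fock)" using af by (simp add: x_def hspace_ampliation)
  have y: "y \<in> hspace (ampliation m fock)" using bf by (simp add: y_def hspace_ampliation)
  have xn: "(hnorm (ampliation m fock) x)\<^sup>2 = (\<Sum>j<m. \<Sum>\<alpha>\<in>W. (cmod (a j \<alpha>))\<^sup>2)"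
    unfolding F.hnorm_ampliation[OF x] by (simp add: sum_nonneg x_def af)
  have yn: "(hnorm (ampliation m fock) y)\<^sup>2 = (\<Sum>j<m. \<Sum>\<alpha>\<in>W. (cmod (b j \<alpha>))\<^sup>2)"
    unfolding F.hnorm_ampliation[OF y] by (simp add: sum_nonneg y_def bf)
  have "hinner fock (nc_eval creation (q i j) (a j)) (b i)
      = (\<Sum>\<beta>\<in>support. q i j \<beta> * (\<Sum>\<alpha>\<in>W. a j \<alpha> * cnj (b i (\<beta> @ \<alpha>))))" if "i < m" "j < m" for i j
    using that af bf
    by (simp add: nc_eval_support F.inner_sum F.inner_scale F.word_mem hinner_fock_word_op[OF W a0])
  then have "(\<Sum>i<m. \<Sum>j<m. \<Sum>\<beta>\<in>support. q i j \<beta> * (\<Sum>\<alpha>\<in>W. a j \<alpha> * cnj (b i (\<beta> @ \<alpha>))))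
      = (\<Sum>i<m. \<Sum>j<m. hinner fock (nc_eval creation (q i j) (a j)) (b i))" by simp
  also have "\<dots> = hinner (ampliation m fock) (mat_eval m creation q x) y"
    using af bf by (simp add: hinner_ampliation mat_eval_def x_def y_def F.inner_sum F.nc_eval_mem F.V_mem)
  finally have eq: "(\<Sum>i<m. \<Sum>j<m. \<Sum>\<beta>\<in>support. q i j \<beta> * (\<Sum>\<alpha>\<in>W. a j \<alpha> * cnj (b i (\<beta> @ \<alpha>))))
      = hinner (ampliation m fock) (mat_eval m creation q x) y" .
  have "Re (hinner (ampliation m fock) (mat_eval m creation q x) y)
      \<le> hnorm (ampliation m fock) (mat_eval m creation q x) * hnorm (ampliation m fock) y"
    using F.mat_eval_mem[OF F.V_mem x] y
    by (intro order_trans[OF complex_Re_le_cmod] A.cauchy_schwarz)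
  also have "\<dots> \<le> c * hnorm (ampliation m fock) x * hnorm (ampliation m fock) y"
    using bound[OF x] A.hnorm_nonneg[OF y] by (intro mult_right_mono)
  also have "\<dots> = c / 2 * (2 * hnorm (ampliation m fock) x * hnorm (ampliation m fock) y)" by simp
  also have "\<dots> \<le> c / 2 * ((hnorm (ampliation m fock) x)\<^sup>2 + (hnorm (ampliation m fock) y)\<^sup>2)"
    using c_nonneg by (intro mult_left_mono sum_squares_bound) auto
  finally show ?thesis unfolding eq xn yn .
qed

text \<open>In terms of operators: tensoring \<open>q(S)\<close> with the identity of
  \<open>H\<close> does not increase its norm. In Gram coordinates both sides are sums over
  \<open>s < r\<close>, and each summand is an instance of \<open>scalar_form_bound\<close>.\<close>

lemma vector_form_bound:
  assumes H: "hilbert_space H" and W: "finite W"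
    and f: "\<And>j \<alpha>. j < m \<Longrightarrow> f j \<alpha> \<in> hspace H" and g: "\<And>j \<alpha>. j < m \<Longrightarrow> g j \<alpha> \<in> hspace H"
    and g0: "\<And>j \<alpha>. \<alpha> \<notin> W \<Longrightarrow> g j \<alpha> = 0"
  shows "Re (\<Sum>i<m. \<Sum>j<m. \<Sum>\<beta>\<in>support. q i j \<beta> * (\<Sum>\<alpha>\<in>W. hinner H (f j \<alpha>) (g i (\<beta> @ \<alpha>))))
      \<le> c / 2 * ((\<Sum>j<m. \<Sum>\<alpha>\<in>W. (hnorm H (f j \<alpha>))\<^sup>2) + (\<Sum>i<m. \<Sum>\<alpha>\<in>W. (hnorm H (g i \<alpha>))\<^sup>2))"
proof -
  interpret hilbert_space H by fact
  \<comment> \<open>The boolean tags the two families (\<open>True\<close> for \<open>f\<close>,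
    \<open>False\<close> for \<open>g\<close>). They must be factored together, as the form consists
    of inner products between them.\<close>
  define K where "K = {..<m} \<times> W \<times> (UNIV :: bool set)"
  define h where "h = (\<lambda>(j, \<alpha>, t). if t then f j \<alpha> else g j \<alpha>)"
  have "finite K" using W by (simp add: K_def)
  moreover have "h k \<in> hspace H" if "k \<in> K" for k using that f g by (auto simp: K_def h_def)
  ultimately obtain r and z :: "nat \<Rightarrow> nat \<times> 'n list \<times> bool \<Rightarrow> complex" where
    z: "\<And>k l. \<lbrakk>k \<in> K; l \<in> K\<rbrakk> \<Longrightarrow> hinner H (h k) (h l) = (\<Sum>s<r. z s k * cnj (z s l))"
    using gram_factorization[of K h] by blast
  \<comment> \<open>Cutting off at \<open>W\<close> supplies the support condition of the scalar
    bound. It loses nothing: \<open>f\<close> is read only on \<open>W\<close>, and \<open>g\<close>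
    vanishes outside it, where \<open>\<beta> @ \<alpha>\<close> may well lie.\<close>
  define a where "a s j \<alpha> = (if \<alpha> \<in> W then z s (j, \<alpha>, True) else 0)" for s j \<alpha>
  define b where "b s j \<alpha> = (if \<alpha> \<in> W then z s (j, \<alpha>, False) else 0)" for s j \<alpha>
  have fg: "hinner H (f j \<alpha>) (g i \<gamma>) = (\<Sum>s<r. a s j \<alpha> * cnj (b s i \<gamma>))"
    if "i < m" "j < m" "\<alpha> \<in> W" for i j \<alpha> \<gamma>
  proof (cases "\<gamma> \<in> W")
    case True
    then show ?thesis using that z[of "(j, \<alpha>, True)" "(i, \<gamma>, False)"]
      by (simp add: K_def h_def a_def b_def)
  next
    case False
    then show ?thesis using f[OF that(2)] by (simp add: g0 b_def)
  qed
  have ff: "(hnorm H (f j \<alpha>))\<^sup>2 = (\<Sum>s<r. (cmod (a s j \<alpha>))\<^sup>2)" if "j < m" "\<alpha> \<in> W" for j \<alpha>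
    using that f z[of "(j, \<alpha>, True)" "(j, \<alpha>, True)"]
    by (simp add: K_def h_def a_def hnorm_sq complex_mult_cnj cmod_power2)
  have gg: "(hnorm H (g j \<alpha>))\<^sup>2 = (\<Sum>s<r. (cmod (b s j \<alpha>))\<^sup>2)" if "j < m" "\<alpha> \<in> W" for j \<alpha>
    using that g z[of "(j, \<alpha>, False)" "(j, \<alpha>, False)"]
    by (simp add: K_def h_def b_def hnorm_sq complex_mult_cnj cmod_power2)
  have "Re (\<Sum>i<m. \<Sum>j<m. \<Sum>\<beta>\<in>support. q i j \<beta> * (\<Sum>\<alpha>\<in>W. hinner H (f j \<alpha>) (g i (\<beta> @ \<alpha>))))
      = Re (\<Sum>i<m. \<Sum>j<m. \<Sum>\<beta>\<in>support. q i j \<beta> * (\<Sum>\<alpha>\<in>W. \<Sum>s<r. a s j \<alpha> * cnj (b s i (\<beta> @ \<alpha>))))"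
    by (intro arg_cong[where f = Re] sum.cong refl arg_cong2[where f = times]) (simp add: fg)
  also have "(\<Sum>i<m. \<Sum>j<m. \<Sum>\<beta>\<in>support. q i j \<beta> * (\<Sum>\<alpha>\<in>W. \<Sum>s<r. a s j \<alpha> * cnj (b s i (\<beta> @ \<alpha>))))
      = (\<Sum>s<r. \<Sum>i<m. \<Sum>j<m. \<Sum>\<beta>\<in>support. q i j \<beta> * (\<Sum>\<alpha>\<in>W. a s j \<alpha> * cnj (b s i (\<beta> @ \<alpha>))))"
    by (simp only: sum.swap[where B = "{..<r}" and A = W] sum_distrib_left[where A = "{..<r}"]
        sum.swap[where B = "{..<r}" and A = support] sum.swap[where B = "{..<r}" and A = "{..<m}"])
  also have "Re \<dots> \<le> (\<Sum>s<r. c / 2 * ((\<Sum>j<m. \<Sum>\<alpha>\<in>W. (cmod (a s j \<alpha>))\<^sup>2) + (\<Sum>i<m. \<Sum>\<alpha>\<in>W. (cmod (b s i \<alpha>))\<^sup>2)))"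
    unfolding Re_sum[of _ "{..<r}"]
    by (intro sum_mono scalar_form_bound W) (simp_all add: a_def b_def)
  also have "\<dots> = c / 2 * ((\<Sum>s<r. \<Sum>j<m. \<Sum>\<alpha>\<in>W. (cmod (a s j \<alpha>))\<^sup>2) + (\<Sum>s<r. \<Sum>i<m. \<Sum>\<alpha>\<in>W. (cmod (b s i \<alpha>))\<^sup>2))"
    by (simp only: sum_distrib_left[symmetric] sum.distrib)
  also have "(\<Sum>s<r. \<Sum>j<m. \<Sum>\<alpha>\<in>W. (cmod (a s j \<alpha>))\<^sup>2) = (\<Sum>j<m. \<Sum>\<alpha>\<in>W. (hnorm H (f j \<alpha>))\<^sup>2)"
    by (simp add: ff sum.swap[where B = "{..<r}" and A = W] sum.swap[where B = "{..<r}" and A = "{..<m}"])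
  also have "(\<Sum>s<r. \<Sum>i<m. \<Sum>\<alpha>\<in>W. (cmod (b s i \<alpha>))\<^sup>2) = (\<Sum>i<m. \<Sum>\<alpha>\<in>W. (hnorm H (g i \<alpha>))\<^sup>2)"
    by (simp add: gg sum.swap[where B = "{..<r}" and A = W] sum.swap[where B = "{..<r}" and A = "{..<m}"])
  finally show ?thesis .
qed

end

text \<open>Poisson transforms do not increase norms, so \<open>vector_form_bound\<close> applied to
  them keeps the constant, while by \<open>poisson_pairing\<close> the form tends to that of
  \<open>q(r V)\<close>.\<close>

lemma (in finite_row_isometry) von_neumann_form_bound:
  assumes F: "fock_bounded_polynomial m q c"
    and u: "\<And>i. i < m \<Longrightarrow> u i \<in> hspace G" and v: "\<And>i. i < m \<Longrightarrow> v i \<in> hspace G"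
  shows "Re (\<Sum>i<m. \<Sum>j<m. hinner G (nc_eval V (q i j) (u j)) (v i))
      \<le> c / 2 * ((\<Sum>i<m. (hnorm G (u i))\<^sup>2) + (\<Sum>i<m. (hnorm G (v i))\<^sup>2))"
proof -
  interpret fock_bounded_polynomial m q c by fact
  define C where "C = c / 2 * ((\<Sum>i<m. (hnorm G (u i))\<^sup>2) + (\<Sum>i<m. (hnorm G (v i))\<^sup>2))"
  define P where "P r = (\<Sum>i<m. \<Sum>j<m. \<Sum>\<beta>\<in>support.
      q i j \<beta> * (complex_of_real (r ^ length \<beta>) * hinner G (word_op V \<beta> (u j)) (v i)))" for r
  have P_le: "Re (P r) \<le> C" if r: "0 \<le> r" "r < 1" for r
  proof (rule LIMSEQ_le_const2)
    let ?S = "\<lambda>N. \<Sum>i<m. \<Sum>j<m. \<Sum>\<beta>\<in>support. q i j \<beta> *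
      (\<Sum>\<alpha> | length \<alpha> < N. hinner G (poisson r N (u j) \<alpha>) (poisson r N (v i) (\<beta> @ \<alpha>)))"
    show "(\<lambda>N. Re (?S N)) \<longlonglongrightarrow> Re (P r)"
      unfolding P_def using u v r by (intro tendsto_intros poisson_pairing) auto
    have "Re (?S N) \<le> C" for N
    proof -
      have "Re (?S N) \<le> c / 2 *
          ((\<Sum>j<m. \<Sum>\<alpha> | length \<alpha> < N. (hnorm G (poisson r N (u j) \<alpha>))\<^sup>2)
          + (\<Sum>i<m. \<Sum>\<alpha> | length \<alpha> < N. (hnorm G (poisson r N (v i) \<alpha>))\<^sup>2))"
        using u v by (intro vector_form_bound hilbert_space_axioms finite_words_below poisson_mem)
          (auto simp: poisson_def)
      also have "\<dots> \<le> C"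
        unfolding C_def using u v r c_nonneg
        by (intro mult_left_mono add_mono sum_mono poisson_norm) auto
      finally show ?thesis .
    qed
    then show "\<exists>N. \<forall>n\<ge>N. Re (?S n) \<le> C" by blast
  qed
  \<comment> \<open>\<open>P\<close> is a polynomial in \<open>r\<close>, so the bound reaches
    \<open>r = 1\<close> by continuity although \<open>poisson_pairing\<close> stops short of
    it.\<close>
  have "Re (P 1) \<le> C"
  proof (rule tendsto_upperbound)
    show "((\<lambda>r. Re (P r)) \<longlongrightarrow> Re (P 1)) (at_left 1)"
      unfolding P_def by (intro tendsto_intros)
    have "\<forall>\<^sub>F r in at_left (1::real). 0 < r \<and> r < 1"
      by (rule eventually_at_leftI[of 0]) auto
    then show "\<forall>\<^sub>F r in at_left 1. Re (P r) \<le> C" by eventually_elim (simp add: P_le)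
  qed simp
  also have "P 1 = (\<Sum>i<m. \<Sum>j<m. hinner G (nc_eval V (q i j) (u j)) (v i))"
    unfolding P_def using u v by (intro sum.cong refl)
      (simp add: nc_eval_support inner_sum inner_scale word_mem)
  finally show ?thesis by (simp add: C_def)
qed

subsection \<open>Semi-inner products\<close>

text \<open>Instantiated twice, with the finitely supported families and with the Cauchy sequences
  in them. Both forms may have null vectors, which are divided out only after the
  completion.\<close>

locale semi_inner_space =
  fixes E :: "'e::complex_vector set" and B :: "'e \<Rightarrow> 'e \<Rightarrow> complex"
  assumes subspace: "csubspace E"
    and add: "\<lbrakk>x \<in> E; y \<in> E; z \<in> E\<rbrakk> \<Longrightarrow> B (x + y) z = B x z + B y z"
    and scale: "\<lbrakk>x \<in> E; y \<in> E\<rbrakk> \<Longrightarrow> B (c *\<^sub>C x) y = c * B x y"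
    and cnj: "\<lbrakk>x \<in> E; y \<in> E\<rbrakk> \<Longrightarrow> B y x = cnj (B x y)"
    and nonneg: "x \<in> E \<Longrightarrow> 0 \<le> Re (B x x)"
begin

lemma zero_mem [simp]: "0 \<in> E"
  and add_mem [simp]: "x \<in> E \<Longrightarrow> y \<in> E \<Longrightarrow> x + y \<in> E"
  and diff_mem [simp]: "x \<in> E \<Longrightarrow> y \<in> E \<Longrightarrow> x - y \<in> E"
  and scale_mem [simp]: "x \<in> E \<Longrightarrow> c *\<^sub>C x \<in> E"
  using subspace complex_vector.subspace_0 complex_vector.subspace_add
    complex_vector.subspace_diff complex_vector.subspace_scale by blast+

lemma add_right: "\<lbrakk>x \<in> E; y \<in> E; z \<in> E\<rbrakk> \<Longrightarrow> B z (x + y) = B z x + B z y"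
  by (metis add add_mem cnj complex_cnj_add)

lemma scale_right: "\<lbrakk>x \<in> E; y \<in> E\<rbrakk> \<Longrightarrow> B y (c *\<^sub>C x) = Complex.cnj c * B y x"
  by (metis scale scale_mem cnj complex_cnj_mult)

lemma diff: "\<lbrakk>x \<in> E; y \<in> E; z \<in> E\<rbrakk> \<Longrightarrow> B (x - y) z = B x z - B y z"
  by (metis add_diff_cancel diff_add_cancel diff_mem add)

lemma diff_right: "\<lbrakk>x \<in> E; y \<in> E; z \<in> E\<rbrakk> \<Longrightarrow> B z (x - y) = B z x - B z y"
  by (metis add_diff_cancel diff_add_cancel diff_mem add_right)

definition seminorm :: "'e \<Rightarrow> real" where
  "seminorm x = sqrt (Re (B x x))"

lemma seminorm_nonneg: "x \<in> E \<Longrightarrow> 0 \<le> seminorm x"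
  by (simp add: seminorm_def nonneg)

lemma seminorm_sq: "x \<in> E \<Longrightarrow> (seminorm x)\<^sup>2 = Re (B x x)"
  by (simp add: seminorm_def nonneg)

lemma seminorm_add_sq:
  "\<lbrakk>x \<in> E; y \<in> E\<rbrakk> \<Longrightarrow> (seminorm (x + y))\<^sup>2 = (seminorm x)\<^sup>2 + 2 * Re (B x y) + (seminorm y)\<^sup>2"
  using cnj[of x y] by (simp add: seminorm_sq add add_right)

lemma seminorm_minus: "\<lbrakk>x \<in> E; y \<in> E\<rbrakk> \<Longrightarrow> seminorm (x - y) = seminorm (y - x)"
  by (simp add: seminorm_def diff diff_right)

lemma seminorm_scale: "x \<in> E \<Longrightarrow> seminorm (c *\<^sub>C x) = cmod c * seminorm x"
proof -
  assume x: "x \<in> E"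
  have "B (c *\<^sub>C x) (c *\<^sub>C x) = complex_of_real ((cmod c)\<^sup>2) * B x x"
    using x by (simp add: scale scale_right complex_norm_square del: of_real_power)
  then show ?thesis by (simp add: seminorm_def real_sqrt_mult del: of_real_power)
qed

lemma seminorm_zero: "seminorm 0 = 0"
  using seminorm_scale[OF zero_mem, of 0] by simp

lemma cauchy_schwarz:
  assumes x: "x \<in> E" and y: "y \<in> E"
  shows "cmod (B x y) \<le> seminorm x * seminorm y"
proof -
  define p where "p = (cmod (B x y))\<^sup>2"
  define a where "a = Re (B x x)"
  define b where "b = Re (B y y)"
  \<comment> \<open>Nonnegativity at \<open>x - c *\<^sub>C y\<close> with
    \<open>c = t * B x y\<close>. The usual best coefficient would divide by \<open>B y y\<close>,
    which may vanish for a nonzero \<open>y\<close>.\<close>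
  have key: "0 \<le> a - 2 * t * p + t\<^sup>2 * p * b" for t
  proof -
    define c where "c = complex_of_real t * B x y"
    have Byx: "B y x = Complex.cnj (B x y)" by (rule cnj[OF x y])
    have "B (x - c *\<^sub>C y) (x - c *\<^sub>C y)
        = B x x - complex_of_real (2 * t) * (B x y * Complex.cnj (B x y))
          + complex_of_real (t\<^sup>2) * (B x y * Complex.cnj (B x y)) * B y y"
      using x y by (simp add: diff diff_right scale scale_right Byx c_def algebra_simps power2_eq_square)
    also have "B x y * Complex.cnj (B x y) = complex_of_real p"
      by (simp add: p_def complex_norm_square del: of_real_power)
    finally have "Re (B (x - c *\<^sub>C y) (x - c *\<^sub>C y)) = a - 2 * t * p + t\<^sup>2 * p * b"
      by (simp add: a_def b_def del: of_real_power of_real_mult flip: of_real_mult)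
    moreover have "0 \<le> Re (B (x - c *\<^sub>C y) (x - c *\<^sub>C y))" using x y by (intro nonneg) simp
    ultimately show ?thesis by simp
  qed
  have ab: "0 \<le> a" "0 \<le> b" using nonneg x y by (simp_all add: a_def b_def)
  have "p \<le> a * b"
  proof (cases "b = 0")
    case True
    have "p = 0"
    proof (rule ccontr)
      assume "p \<noteq> 0"
      \<comment> \<open>For \<open>b = 0\<close> the expression is linear in \<open>t\<close>, and
        this \<open>t\<close> gives it the value -1.\<close>
      then show False using key[of "(a + 1) / (2 * p)"] True ab by simp
    qed
    then show ?thesis using True by simp
  next
    case False
    then show ?thesis using key[of "1 / b"] ab by (simp add: field_simps power2_eq_square)
  qed
  then have "(cmod (B x y))\<^sup>2 \<le> (seminorm x * seminorm y)\<^sup>2"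
    using x y by (simp add: p_def a_def b_def power_mult_distrib seminorm_sq)
  then show ?thesis using x y by (meson seminorm_nonneg mult_nonneg_nonneg power2_le_imp_le)
qed

lemma triangle: "\<lbrakk>x \<in> E; y \<in> E\<rbrakk> \<Longrightarrow> seminorm (x + y) \<le> seminorm x + seminorm y"
proof -
  assume xy: "x \<in> E" "y \<in> E"
  have "Re (B x y) \<le> seminorm x * seminorm y"
    using cauchy_schwarz[OF xy] complex_Re_le_cmod order_trans by blast
  then have "(seminorm (x + y))\<^sup>2 \<le> (seminorm x + seminorm y)\<^sup>2"
    using xy by (simp add: seminorm_add_sq power2_sum)
  then show ?thesis using xy by (auto intro: power2_le_imp_le add_nonneg_nonneg seminorm_nonneg)
qed

lemma triangle_diff:
  "\<lbrakk>x \<in> E; y \<in> E; z \<in> E\<rbrakk> \<Longrightarrow> seminorm (x - z) \<le> seminorm (x - y) + seminorm (y - z)"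
  using triangle[of "x - y" "y - z"] by simp

lemma seminorm_reverse_triangle:
  assumes "x \<in> E" "y \<in> E"
  shows "\<bar>seminorm x - seminorm y\<bar> \<le> seminorm (x - y)"
  using triangle[of "x - y" y] triangle[of "y - x" x] seminorm_minus[of x y] assms by simp

text \<open>Expresses the form through seminorms alone, which reduces its convergence along Cauchy
  sequences to that of seminorms.\<close>

lemma polarization:
  assumes x: "x \<in> E" and y: "y \<in> E"
  shows "B x y = Complex
    (((seminorm (x + y))\<^sup>2 - (seminorm x)\<^sup>2 - (seminorm y)\<^sup>2) / 2)
    (((seminorm (x + \<i> *\<^sub>C y))\<^sup>2 - (seminorm x)\<^sup>2 - (seminorm y)\<^sup>2) / 2)"
  using seminorm_add_sq[of x y] seminorm_add_sq[of x "\<i> *\<^sub>C y"] x y seminorm_scale[of y \<i>]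
  by (simp add: complex_eq_iff scale_right)

subsection \<open>The Hilbert space of a complete semi-inner product\<close>

text \<open>Vectors are realised as the functionals they induce, which factors out the null vectors.\<close>

definition functional :: "'e \<Rightarrow> 'e \<Rightarrow> complex" where
  "functional x = (\<lambda>w. if w \<in> E then B x w else 0)"

definition quotient_hilb :: "('e \<Rightarrow> complex) hilb" where
  "quotient_hilb = \<lparr>hspace = functional ` E,
     hinner = (\<lambda>f g. B (inv_into E functional f) (inv_into E functional g))\<rparr>"

lemma hspace_quotient: "hspace quotient_hilb = functional ` E"
  by (simp add: quotient_hilb_def)

lemma functional_mem: "x \<in> E \<Longrightarrow> functional x \<in> hspace quotient_hilb"
  by (simp add: hspace_quotient)

lemma functional_add: "\<lbrakk>x \<in> E; y \<in> E\<rbrakk> \<Longrightarrow> functional x + functional y = functional (x + y)"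
  by (auto simp: functional_def add)

lemma functional_scale: "x \<in> E \<Longrightarrow> c *\<^sub>C functional x = functional (c *\<^sub>C x)"
  by (auto simp: functional_def scale scaleC_complex_def)

lemma functional_diff: "\<lbrakk>x \<in> E; y \<in> E\<rbrakk> \<Longrightarrow> functional x - functional y = functional (x - y)"
  by (auto simp: functional_def diff)

text \<open>By Cauchy-Schwarz the null vectors are precisely those that pair to zero with
  everything.\<close>

lemma functional_eq_iff:
  assumes "x \<in> E" "y \<in> E"
  shows "functional x = functional y \<longleftrightarrow> seminorm (x - y) = 0"
proof
  assume eq: "functional x = functional y"
  have "B x w = B y w" if "w \<in> E" for w using fun_cong[OF eq, of w] that by (simp add: functional_def)
  then have "B (x - y) (x - y) = 0" using assms by (simp add: diff)
  then show "seminorm (x - y) = 0" by (simp add: seminorm_def)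
next
  assume "seminorm (x - y) = 0"
  then have "B (x - y) w = 0" if "w \<in> E" for w
    using cauchy_schwarz[of "x - y" w] assms that by simp
  then show "functional x = functional y" using assms by (auto simp: functional_def diff)
qed

lemma inv_functional:
  assumes "x \<in> E"
  shows "inv_into E functional (functional x) \<in> E"
    and "functional (inv_into E functional (functional x)) = functional x"
  using assms by (auto intro: inv_into_into f_inv_into_f)

lemma hinner_functional:
  assumes x: "x \<in> E" and y: "y \<in> E"
  shows "hinner quotient_hilb (functional x) (functional y) = B x y"
proof -
  define x' where "x' = inv_into E functional (functional x)"
  define y' where "y' = inv_into E functional (functional y)"
  have x': "x' \<in> E" "functional x' = functional x" and y': "y' \<in> E" "functional y' = functional y"
    using inv_functional[OF x] inv_functional[OF y] by (simp_all add: x'_def y'_def)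
  \<comment> \<open>Independence of the representatives, one argument at a time: equal functionals
    agree in the first argument, and conjugation moves the second one there.\<close>
  have "B x' y' = B x y'" using fun_cong[OF x'(2), of y'] y'(1) by (simp add: functional_def)
  also have "\<dots> = Complex.cnj (B y' x)" using cnj x y'(1) by blast
  also have "B y' x = B y x" using fun_cong[OF y'(2), of x] x by (simp add: functional_def)
  also have "Complex.cnj (B y x) = B x y" using cnj[OF y x] by simp
  finally show ?thesis by (simp add: quotient_hilb_def x'_def y'_def)
qed

lemma hnorm_functional: "x \<in> E \<Longrightarrow> hnorm quotient_hilb (functional x) = seminorm x"
  by (simp add: hnorm_def seminorm_def hinner_functional)

lemma hilbert_space_quotient:
  assumes complete: "\<And>X. \<lbrakk>\<And>n. X n \<in> E; \<forall>e>0. \<exists>N. \<forall>m\<ge>N. \<forall>n\<ge>N. seminorm (X m - X n) < e\<rbrakk>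
      \<Longrightarrow> \<exists>l\<in>E. (\<lambda>n. seminorm (X n - l)) \<longlonglongrightarrow> 0"
  shows "hilbert_space quotient_hilb"
proof
  show "csubspace (hspace quotient_hilb)"
  proof (rule complex_vector.subspaceI)
    have "functional 0 = 0" using scale[of 0 _ 0] by (auto simp: functional_def)
    then show "0 \<in> hspace quotient_hilb" using functional_mem[OF zero_mem] by simp
  qed (auto simp: hspace_quotient functional_add functional_scale)
next
  fix f assume f: "f \<in> hspace quotient_hilb" "f \<noteq> 0"
  then obtain x where x: "x \<in> E" "f = functional x" by (auto simp: hspace_quotient)
  have "seminorm x \<noteq> 0"
  proof
    assume "seminorm x = 0"
    then have "f = functional 0" using x functional_eq_iff[of x 0] by simp
    also have "\<dots> = 0" using scale[of 0 _ 0] by (auto simp: functional_def)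
    finally show False using f(2) by simp
  qed
  then have "Re (B x x) \<noteq> 0" by (simp add: seminorm_def)
  then show "0 < Re (hinner quotient_hilb f f)" using nonneg[OF x(1)] x by (simp add: hinner_functional)
next
  fix X :: "nat \<Rightarrow> 'e \<Rightarrow> complex"
  assume X: "\<And>n. X n \<in> hspace quotient_hilb" and c: "hcauchy quotient_hilb X"
  have "\<forall>n. \<exists>x. x \<in> E \<and> X n = functional x" using X by (auto simp: hspace_quotient)
  then obtain Y where Y: "\<And>n. Y n \<in> E" "\<And>n. X n = functional (Y n)" by metis
  have "\<forall>e>0. \<exists>N. \<forall>m\<ge>N. \<forall>n\<ge>N. seminorm (Y m - Y n) < e"
    using c by (simp add: hcauchy_def Y functional_diff hnorm_functional)
  then obtain l where l: "l \<in> E" "(\<lambda>n. seminorm (Y n - l)) \<longlonglongrightarrow> 0" using complete Y(1) by blast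
  then have "hlim quotient_hilb X (functional l)"
    by (simp add: hlim_def Y functional_diff hnorm_functional)
  then show "\<exists>l\<in>hspace quotient_hilb. hlim quotient_hilb X l" using functional_mem[OF l(1)] by blast
qed (auto simp: hspace_quotient functional_add functional_scale hinner_functional add scale
    intro: cnj)

section \<open>Isometries induced on the quotient\<close>

definition quotient_map :: "('e \<Rightarrow> 'e) \<Rightarrow> ('e \<Rightarrow> complex) \<Rightarrow> 'e \<Rightarrow> complex" where
  "quotient_map A f = functional (A (inv_into E functional f))"

context
  fixes A :: "'e \<Rightarrow> 'e"
  assumes A_mem: "\<And>x. x \<in> E \<Longrightarrow> A x \<in> E"
    and A_add: "\<And>x y. \<lbrakk>x \<in> E; y \<in> E\<rbrakk> \<Longrightarrow> A (x + y) = A x + A y"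
    and A_scale: "\<And>c x. x \<in> E \<Longrightarrow> A (c *\<^sub>C x) = c *\<^sub>C A x"
    and A_B: "\<And>x y. \<lbrakk>x \<in> E; y \<in> E\<rbrakk> \<Longrightarrow> B (A x) (A y) = B x y"
begin

text \<open>\<open>A\<close> preserves seminorms, hence sends vectors at distance zero to such
  vectors, so the chosen representative does not affect the value.\<close>

lemma quotient_map_functional:
  assumes "x \<in> E"
  shows "quotient_map A (functional x) = functional (A x)"
proof -
  define y where "y = inv_into E functional (functional x)"
  have y: "y \<in> E" "functional y = functional x"
    using inv_functional[OF assms] by (simp_all add: y_def)
  have "A (y - x) = A y - A x"
    using A_add[of "y - x" x] y assms by (simp add: eq_diff_eq)
  then have "seminorm (A y - A x) = seminorm (y - x)"
    using A_B[of "y - x" "y - x"] y assms by (simp add: seminorm_def)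
  then show ?thesis
    using functional_eq_iff[of "A y" "A x"] functional_eq_iff[of y x] y assms A_mem
    by (simp add: quotient_map_def flip: y_def)
qed

lemma quotient_map_isometric: "isometric_op quotient_hilb quotient_hilb (quotient_map A)"
  by (rule isometric_opI)
    (auto simp: hspace_quotient quotient_map_functional functional_add functional_scale A_mem A_add
      A_scale hnorm_functional, simp add: seminorm_def A_B)

end

subsection \<open>Completion by Cauchy sequences\<close>

definition cauchy_seqs :: "(nat \<Rightarrow> 'e) set" where
  "cauchy_seqs = {u. (\<forall>n. u n \<in> E) \<and> (\<forall>e>0. \<exists>N. \<forall>m\<ge>N. \<forall>n\<ge>N. seminorm (u m - u n) < e)}"

definition lim_form :: "(nat \<Rightarrow> 'e) \<Rightarrow> (nat \<Rightarrow> 'e) \<Rightarrow> complex" where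
  "lim_form u v = lim (\<lambda>n. B (u n) (v n))"

lemma cauchy_seqs_mem: "u \<in> cauchy_seqs \<Longrightarrow> u n \<in> E"
  by (simp add: cauchy_seqs_def)

lemma cauchy_seqsD:
  assumes "u \<in> cauchy_seqs" "e > 0"
  obtains N where "\<And>m n. \<lbrakk>m \<ge> N; n \<ge> N\<rbrakk> \<Longrightarrow> seminorm (u m - u n) < e"
  using assms unfolding cauchy_seqs_def by blast

lemma const_cauchy: "x \<in> E \<Longrightarrow> (\<lambda>n. x) \<in> cauchy_seqs"
  by (auto simp: cauchy_seqs_def seminorm_zero)

lemma cauchy_seqs_lipschitz:
  assumes u: "u \<in> cauchy_seqs" and v: "\<And>n. v n \<in> E"
    and le: "\<And>m n. seminorm (v m - v n) \<le> C * seminorm (u m - u n)"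
  shows "v \<in> cauchy_seqs"
  unfolding cauchy_seqs_def
proof (intro CollectI conjI allI impI v)
  fix e :: real assume e: "e > 0"
  \<comment> \<open>A positive divisor is required also for \<open>C = 0\<close>, as in scaling by
    zero.\<close>
  have p: "0 < \<bar>C\<bar> + 1" by simp
  obtain N where N: "\<And>m n. \<lbrakk>m \<ge> N; n \<ge> N\<rbrakk> \<Longrightarrow> seminorm (u m - u n) < e / (\<bar>C\<bar> + 1)"
    using cauchy_seqsD[OF u divide_pos_pos[OF e p]] by blast
  have "seminorm (v m - v n) < e" if "m \<ge> N" "n \<ge> N" for m n
  proof -
    have "seminorm (v m - v n) \<le> C * seminorm (u m - u n)" by (rule le)
    also have "\<dots> \<le> (\<bar>C\<bar> + 1) * seminorm (u m - u n)"
      using u by (intro mult_right_mono seminorm_nonneg) (auto simp: cauchy_seqs_mem)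
    also have "\<dots> < e" using N[OF that] p by (simp add: field_simps)
    finally show ?thesis .
  qed
  then show "\<exists>N. \<forall>m\<ge>N. \<forall>n\<ge>N. seminorm (v m - v n) < e" by blast
qed

lemma subspace_cauchy: "csubspace cauchy_seqs"
proof (rule complex_vector.subspaceI)
  show "0 \<in> cauchy_seqs" using const_cauchy[OF zero_mem] by (simp add: zero_fun_def)
next
  fix u v assume u: "u \<in> cauchy_seqs" and v: "v \<in> cauchy_seqs"
  show "u + v \<in> cauchy_seqs"
    unfolding cauchy_seqs_def
  proof (intro CollectI conjI allI impI)
    fix e :: real assume "e > 0"
    then obtain N M where N: "\<And>m n. \<lbrakk>m \<ge> N; n \<ge> N\<rbrakk> \<Longrightarrow> seminorm (u m - u n) < e/2"
      and M: "\<And>m n. \<lbrakk>m \<ge> M; n \<ge> M\<rbrakk> \<Longrightarrow> seminorm (v m - v n) < e/2"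
      using cauchy_seqsD[OF u, of "e/2"] cauchy_seqsD[OF v, of "e/2"] by (metis half_gt_zero)
    have "seminorm ((u + v) m - (u + v) n) < e" if "m \<ge> max N M" "n \<ge> max N M" for m n
    proof -
      have eq: "(u + v) m - (u + v) n = (u m - u n) + (v m - v n)" by simp
      have "seminorm ((u + v) m - (u + v) n) \<le> seminorm (u m - u n) + seminorm (v m - v n)"
        unfolding eq using u v by (intro triangle diff_mem cauchy_seqs_mem)
      then show ?thesis using N[of m n] M[of m n] that by simp
    qed
    then show "\<exists>N. \<forall>m\<ge>N. \<forall>n\<ge>N. seminorm ((u + v) m - (u + v) n) < e" by blast
  qed (use u v in \<open>simp add: cauchy_seqs_mem\<close>)
next
  fix c u assume u: "u \<in> cauchy_seqs"
  show "c *\<^sub>C u \<in> cauchy_seqs"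
  proof (rule cauchy_seqs_lipschitz[OF u, where C = "cmod c"])
    fix m n
    have "(c *\<^sub>C u) m - (c *\<^sub>C u) n = c *\<^sub>C (u m - u n)"
      by (simp add: complex_vector.scale_right_diff_distrib)
    then show "seminorm ((c *\<^sub>C u) m - (c *\<^sub>C u) n) \<le> cmod c * seminorm (u m - u n)"
      using u by (simp only: seminorm_scale cauchy_seqs_mem diff_mem)
  qed (use u in \<open>simp add: cauchy_seqs_mem\<close>)
qed

lemma seminorm_convergent:
  assumes u: "u \<in> cauchy_seqs"
  shows "convergent (\<lambda>n. seminorm (u n))"
proof -
  have "Cauchy (\<lambda>n. seminorm (u n))"
    unfolding Cauchy_def dist_real_def
  proof (intro allI impI)
    fix e :: real assume "e > 0"
    then obtain N where N: "\<And>m n. \<lbrakk>m \<ge> N; n \<ge> N\<rbrakk> \<Longrightarrow> seminorm (u m - u n) < e"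
      using cauchy_seqsD[OF u] by blast
    then have "\<bar>seminorm (u m) - seminorm (u n)\<bar> < e" if "m \<ge> N" "n \<ge> N" for m n
      using seminorm_reverse_triangle[of "u m" "u n"] u that by (force simp: cauchy_seqs_mem)
    then show "\<exists>N. \<forall>m\<ge>N. \<forall>n\<ge>N. \<bar>seminorm (u m) - seminorm (u n)\<bar> < e" by blast
  qed
  then show ?thesis by (rule Cauchy_convergent)
qed

lemma lim_form_limit:
  assumes u: "u \<in> cauchy_seqs" and v: "v \<in> cauchy_seqs"
  shows "(\<lambda>n. B (u n) (v n)) \<longlonglongrightarrow> lim_form u v"
proof -
  have s: "u + v \<in> cauchy_seqs" "u + \<i> *\<^sub>C v \<in> cauchy_seqs"
    using subspace_cauchy u v complex_vector.subspace_add complex_vector.subspace_scale by blast+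
  obtain a b c d where "(\<lambda>n. seminorm (u n)) \<longlonglongrightarrow> a" "(\<lambda>n. seminorm (v n)) \<longlonglongrightarrow> b"
    "(\<lambda>n. seminorm ((u + v) n)) \<longlonglongrightarrow> c" "(\<lambda>n. seminorm ((u + \<i> *\<^sub>C v) n)) \<longlonglongrightarrow> d"
    using seminorm_convergent u v s unfolding convergent_def by metis
  then have "(\<lambda>n. Complex
      (((seminorm ((u + v) n))\<^sup>2 - (seminorm (u n))\<^sup>2 - (seminorm (v n))\<^sup>2) / 2)
      (((seminorm ((u + \<i> *\<^sub>C v) n))\<^sup>2 - (seminorm (u n))\<^sup>2 - (seminorm (v n))\<^sup>2) / 2))
      \<longlonglongrightarrow> Complex ((c\<^sup>2 - a\<^sup>2 - b\<^sup>2) / 2) ((d\<^sup>2 - a\<^sup>2 - b\<^sup>2) / 2)"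
    by (intro tendsto_intros) auto
  then have "convergent (\<lambda>n. B (u n) (v n))"
    unfolding convergent_def
    by (simp add: polarization[OF cauchy_seqs_mem[OF u] cauchy_seqs_mem[OF v]]) blast
  then show ?thesis by (simp add: lim_form_def convergent_LIMSEQ_iff)
qed

lemma lim_form_eqI:
  "(\<lambda>n. B (u n) (v n)) \<longlonglongrightarrow> l \<Longrightarrow> lim_form u v = l"
  by (simp add: lim_form_def limI)

lemma lim_form_const: "lim_form (\<lambda>n. x) (\<lambda>n. y) = B x y"
  by (rule lim_form_eqI) simp

lemma semi_inner_cauchy: "semi_inner_space cauchy_seqs lim_form"
proof
  show "csubspace cauchy_seqs" by (rule subspace_cauchy)
next
  fix u v w assume "u \<in> cauchy_seqs" "v \<in> cauchy_seqs" "w \<in> cauchy_seqs"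
  then show "lim_form (u + v) w = lim_form u w + lim_form v w"
    by (intro lim_form_eqI) (simp add: add cauchy_seqs_mem tendsto_add lim_form_limit)
next
  fix u v c assume "u \<in> cauchy_seqs" "v \<in> cauchy_seqs"
  then show "lim_form (c *\<^sub>C u) v = c * lim_form u v"
    by (intro lim_form_eqI) (simp add: scale cauchy_seqs_mem tendsto_mult lim_form_limit)
next
  fix u v assume uv: "u \<in> cauchy_seqs" "v \<in> cauchy_seqs"
  have "(\<lambda>n. Complex.cnj (B (u n) (v n))) \<longlonglongrightarrow> Complex.cnj (lim_form u v)"
    by (intro tendsto_cnj lim_form_limit uv)
  moreover have "Complex.cnj (B (u n) (v n)) = B (v n) (u n)" for n
    using cnj[of "u n" "v n"] uv by (simp add: cauchy_seqs_mem)
  ultimately show "lim_form v u = Complex.cnj (lim_form u v)"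
    by (intro lim_form_eqI) simp
next
  fix u assume u: "u \<in> cauchy_seqs"
  show "0 \<le> Re (lim_form u u)"
    by (rule LIMSEQ_le_const[OF tendsto_Re[OF lim_form_limit[OF u u]]])
      (use u in \<open>simp add: nonneg cauchy_seqs_mem\<close>)
qed

interpretation cauchy: semi_inner_space cauchy_seqs lim_form
  by (rule semi_inner_cauchy)

lemma cauchy_seminorm_limit:
  "u \<in> cauchy_seqs \<Longrightarrow> (\<lambda>n. seminorm (u n)) \<longlonglongrightarrow> cauchy.seminorm u"
  unfolding seminorm_def cauchy.seminorm_def
  by (intro tendsto_real_sqrt tendsto_Re lim_form_limit)

lemma cauchy_seminorm_const: "cauchy.seminorm (\<lambda>n. x) = seminorm x"
  by (simp add: cauchy.seminorm_def seminorm_def lim_form_const)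

lemma cauchy_seminorm_le:
  assumes "u \<in> cauchy_seqs" "\<And>n. n \<ge> N \<Longrightarrow> seminorm (u n) \<le> e"
  shows "cauchy.seminorm u \<le> e"
  using assms by (intro LIMSEQ_le_const2[OF cauchy_seminorm_limit]) auto

lemma cauchy_approx:
  assumes u: "u \<in> cauchy_seqs" and e: "e > 0"
  shows "\<exists>w\<in>E. cauchy.seminorm (u - (\<lambda>n. w)) \<le> e"
proof -
  obtain N where N: "\<And>m n. \<lbrakk>m \<ge> N; n \<ge> N\<rbrakk> \<Longrightarrow> seminorm (u m - u n) < e"
    using cauchy_seqsD[OF u e] by blast
  have "cauchy.seminorm (u - (\<lambda>n. u N)) \<le> e"
    by (rule cauchy_seminorm_le[of _ N])
      (use u N in \<open>auto simp: cauchy_seqs_mem const_cauchy intro: less_imp_le\<close>)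
  then show ?thesis using cauchy_seqs_mem[OF u] by blast
qed

text \<open>Constant sequences are dense by \<open>cauchy_approx\<close>. Picking a constant
  \<open>w k\<close> within 1/(k+1) of \<open>X k\<close>, the sequence of these constants is itself
  Cauchy and is the limit of \<open>X\<close>.\<close>

lemma cauchy_complete:
  assumes X: "\<And>k. X k \<in> cauchy_seqs"
    and c: "\<forall>e>0. \<exists>N. \<forall>k\<ge>N. \<forall>l\<ge>N. cauchy.seminorm (X k - X l) < e"
  shows "\<exists>w\<in>cauchy_seqs. (\<lambda>k. cauchy.seminorm (X k - w)) \<longlonglongrightarrow> 0"
proof -
  have "\<forall>k. \<exists>w. w \<in> E \<and> cauchy.seminorm (X k - (\<lambda>n. w)) \<le> 1 / real (Suc k)"
  proof
    fix k
    show "\<exists>w. w \<in> E \<and> cauchy.seminorm (X k - (\<lambda>n. w)) \<le> 1 / real (Suc k)"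
      using cauchy_approx[OF X, of "1 / real (Suc k)" k] by (simp add: Bex_def)
  qed
  then obtain w where w: "\<And>k. w k \<in> E"
    and wX: "\<And>k. cauchy.seminorm (X k - (\<lambda>n. w k)) \<le> 1 / real (Suc k)" by metis
  have cw: "(\<lambda>n. w k) \<in> cauchy_seqs" for k by (rule const_cauchy[OF w])
  have dist: "seminorm (w k - w l) \<le> 1 / real (Suc k) + cauchy.seminorm (X k - X l) + 1 / real (Suc l)"
    for k l
  proof -
    have "seminorm (w k - w l) = cauchy.seminorm ((\<lambda>n. w k) - (\<lambda>n. w l))"
      using cauchy_seminorm_const[of "w k - w l"] by (simp add: fun_diff_def)
    also have "\<dots> \<le> cauchy.seminorm ((\<lambda>n. w k) - X k)
        + (cauchy.seminorm (X k - X l) + cauchy.seminorm (X l - (\<lambda>n. w l)))"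
      using cauchy.triangle_diff[of "\<lambda>n. w k" "X k" "\<lambda>n. w l", OF cw X cw]
        cauchy.triangle_diff[of "X k" "X l" "\<lambda>n. w l", OF X X cw]
      by linarith
    also have "cauchy.seminorm ((\<lambda>n. w k) - X k) = cauchy.seminorm (X k - (\<lambda>n. w k))"
      by (rule cauchy.seminorm_minus[OF cw X])
    finally show ?thesis using wX[of k] wX[of l] by linarith
  qed
  have small: "\<exists>N. \<forall>k\<ge>N. 1 / real (Suc k) < e" if e: "e > 0" for e
  proof -
    obtain N where N: "inverse (real (Suc N)) < e" using reals_Archimedean[OF e] by blast
    have "1 / real (Suc k) < e" if "k \<ge> N" for k
    proof -
      have "1 / real (Suc k) \<le> 1 / real (Suc N)" using that by (intro divide_left_mono) auto
      then show ?thesis using N by (simp add: inverse_eq_divide)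
    qed
    then show ?thesis by blast
  qed
  have wC: "w \<in> cauchy_seqs"
    unfolding cauchy_seqs_def
  proof (intro CollectI conjI allI impI w)
    fix e :: real assume e: "e > 0"
    then have e3: "e/3 > 0" by simp
    obtain N where N: "\<forall>k\<ge>N. 1 / real (Suc k) < e/3" using small[OF e3] by blast
    obtain M where M: "\<forall>k\<ge>M. \<forall>l\<ge>M. cauchy.seminorm (X k - X l) < e/3"
      using c e3 by blast
    have "seminorm (w k - w l) < e" if "k \<ge> max N M" "l \<ge> max N M" for k l
    proof -
      have "1 / real (Suc k) < e/3" "1 / real (Suc l) < e/3" "cauchy.seminorm (X k - X l) < e/3"
        using N M that by (simp_all del: of_nat_Suc)
      then show ?thesis using dist[of k l] by linarith
    qed
    then show "\<exists>N. \<forall>m\<ge>N. \<forall>n\<ge>N. seminorm (w m - w n) < e" by blast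
  qed
  have "(\<lambda>k. cauchy.seminorm (X k - w)) \<longlonglongrightarrow> 0"
  proof (rule LIMSEQ_I)
    fix e :: real assume e: "e > 0"
    obtain N where N: "\<And>k l. \<lbrakk>k \<ge> N; l \<ge> N\<rbrakk> \<Longrightarrow> seminorm (w k - w l) < e/3"
      using cauchy_seqsD[OF wC, of "e/3"] e by (metis divide_pos_pos zero_less_numeral)
    have e3: "e/3 > 0" using e by simp
    obtain M where M: "\<forall>k\<ge>M. 1 / real (Suc k) < e/3" using small[OF e3] by blast
    have "norm (cauchy.seminorm (X k - w) - 0) < e" if k: "k \<ge> max N M" for k
    proof -
      have "cauchy.seminorm ((\<lambda>n. w k) - w) \<le> e/3"
      proof (rule cauchy_seminorm_le[of _ N])
        show "(\<lambda>n. w k) - w \<in> cauchy_seqs" using cw wC by (rule cauchy.diff_mem)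
        show "seminorm (((\<lambda>n. w k) - w) n) \<le> e/3" if "n \<ge> N" for n
          using N[of k n] k that by simp
      qed
      moreover have "1 / real (Suc k) < e/3" using M k by (simp del: of_nat_Suc)
      ultimately have "cauchy.seminorm (X k - w) < e"
        using cauchy.triangle_diff[of "X k" "\<lambda>n. w k" w, OF X cw wC] wX[of k] e by linarith
      then show ?thesis using cauchy.seminorm_nonneg[of "X k - w"] X wC by simp
    qed
    then show "\<exists>no. \<forall>k\<ge>no. norm (cauchy.seminorm (X k - w) - 0) < e" by blast
  qed
  then show ?thesis using wC by blast
qed

lemma hilbert_space_completion: "hilbert_space cauchy.quotient_hilb"
  by (rule cauchy.hilbert_space_quotient) (rule cauchy_complete)

section \<open>Isometries extended to the completion\<close>

context
  fixes \<sigma> :: "'e \<Rightarrow> 'e"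
  assumes \<sigma>_mem: "\<And>x. x \<in> E \<Longrightarrow> \<sigma> x \<in> E"
    and \<sigma>_add: "\<And>x y. \<lbrakk>x \<in> E; y \<in> E\<rbrakk> \<Longrightarrow> \<sigma> (x + y) = \<sigma> x + \<sigma> y"
    and \<sigma>_scale: "\<And>c x. x \<in> E \<Longrightarrow> \<sigma> (c *\<^sub>C x) = c *\<^sub>C \<sigma> x"
    and \<sigma>_B: "\<And>x y. \<lbrakk>x \<in> E; y \<in> E\<rbrakk> \<Longrightarrow> B (\<sigma> x) (\<sigma> y) = B x y"
begin

lemma pointwise_cauchy:
  assumes u: "u \<in> cauchy_seqs"
  shows "(\<lambda>n. \<sigma> (u n)) \<in> cauchy_seqs"
proof (rule cauchy_seqs_lipschitz[OF u, where C = 1])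
  show "\<sigma> (u n) \<in> E" for n using \<sigma>_mem u by (simp add: cauchy_seqs_mem)
  fix m n
  have E: "u m \<in> E" "u n \<in> E" using u by (simp_all add: cauchy_seqs_mem)
  then have "\<sigma> (u m - u n) = \<sigma> (u m) - \<sigma> (u n)"
    using \<sigma>_add[of "u m - u n" "u n"] by (simp add: eq_diff_eq)
  then show "seminorm (\<sigma> (u m) - \<sigma> (u n)) \<le> 1 * seminorm (u m - u n)"
    using \<sigma>_B[of "u m - u n" "u m - u n"] E by (simp add: seminorm_def)
qed

lemma pointwise_lim_form:
  "\<lbrakk>u \<in> cauchy_seqs; v \<in> cauchy_seqs\<rbrakk> \<Longrightarrow> lim_form (\<lambda>n. \<sigma> (u n)) (\<lambda>n. \<sigma> (v n)) = lim_form u v"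
  by (simp add: lim_form_def \<sigma>_B cauchy_seqs_mem)

definition completion_map :: "((nat \<Rightarrow> 'e) \<Rightarrow> complex) \<Rightarrow> (nat \<Rightarrow> 'e) \<Rightarrow> complex" where
  "completion_map = cauchy.quotient_map (\<lambda>u n. \<sigma> (u n))"

lemma completion_map_functional:
  "u \<in> cauchy_seqs \<Longrightarrow> completion_map (cauchy.functional u) = cauchy.functional (\<lambda>n. \<sigma> (u n))"
  unfolding completion_map_def
  by (rule cauchy.quotient_map_functional)
    (auto simp: pointwise_cauchy pointwise_lim_form \<sigma>_add \<sigma>_scale cauchy_seqs_mem)

lemma completion_map_isometric:
  "isometric_op cauchy.quotient_hilb cauchy.quotient_hilb completion_map"
  unfolding completion_map_def
  by (rule cauchy.quotient_map_isometric)
    (auto simp: pointwise_cauchy pointwise_lim_form \<sigma>_add \<sigma>_scale cauchy_seqs_mem)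

end

end

subsection \<open>Multi-Toeplitz kernels\<close>

text \<open>The inner product of \<open>V_\<alpha> J h\<close> and \<open>V_\<beta> J k\<close> in
  any dilation: common initial letters cancel because the \<open>V_i\<close> are isometries,
  incomparable words give orthogonal vectors, and the remaining word \<open>\<gamma>\<close>
  compresses to \<open>T_\<gamma> / \<rho>\<close>.\<close>

definition toeplitz_kernel ::
  "real \<Rightarrow> 'h hilb \<Rightarrow> ('n \<Rightarrow> 'h \<Rightarrow> 'h) \<Rightarrow> 'n list \<Rightarrow> 'n list \<Rightarrow> 'h \<Rightarrow> 'h \<Rightarrow> complex" where
  "toeplitz_kernel \<rho> H T \<alpha> \<beta> h k =
     (if \<alpha> = \<beta> then hinner H h k
      else if prefix \<beta> \<alpha> then complex_of_real (1 / \<rho>) * hinner H (word_op T (drop (length \<beta>) \<alpha>) h) k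
      else if prefix \<alpha> \<beta> then complex_of_real (1 / \<rho>) * hinner H h (word_op T (drop (length \<alpha>) \<beta>) k)
      else 0)"

definition toeplitz_form ::
  "real \<Rightarrow> 'h hilb \<Rightarrow> ('n \<Rightarrow> 'h \<Rightarrow> 'h) \<Rightarrow> ('n list \<Rightarrow> 'h::zero) \<Rightarrow> ('n list \<Rightarrow> 'h) \<Rightarrow> complex" where
  "toeplitz_form \<rho> H T f g =
     (\<Sum>\<alpha> | f \<alpha> \<noteq> 0. \<Sum>\<beta> | g \<beta> \<noteq> 0. toeplitz_kernel \<rho> H T \<alpha> \<beta> (f \<alpha>) (g \<beta>))"

definition word_families :: "'h::zero hilb \<Rightarrow> ('n list \<Rightarrow> 'h) set" where
  "word_families H = {f. finite {\<alpha>. f \<alpha> \<noteq> 0} \<and> (\<forall>\<alpha>. f \<alpha> \<in> hspace H)}"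

definition family_shift :: "'n \<Rightarrow> ('n list \<Rightarrow> 'h::zero) \<Rightarrow> 'n list \<Rightarrow> 'h" where
  "family_shift i f \<gamma> = (case \<gamma> of [] \<Rightarrow> 0 | j # \<alpha> \<Rightarrow> if j = i then f \<alpha> else 0)"

definition single_family :: "'n list \<Rightarrow> 'h::zero \<Rightarrow> 'n list \<Rightarrow> 'h" where
  "single_family \<alpha> h = (\<lambda>\<gamma>. if \<gamma> = \<alpha> then h else 0)"

lemma family_shift_single: "family_shift i (single_family \<alpha> h) = single_family (i # \<alpha>) h"
  by (rule ext) (auto simp: family_shift_def single_family_def split: list.splits)

locale bounded_tuple = hilbert_space H
  for H :: "'h::complex_vector hilb" +
  fixes T :: "'n \<Rightarrow> 'h \<Rightarrow> 'h"
  assumes bounded: "\<And>i. bounded_op H H (T i)"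
begin

lemmas T_mem = bounded_opD(1)[OF bounded]

lemma word_mem: "x \<in> hspace H \<Longrightarrow> word_op T \<alpha> x \<in> hspace H"
  by (rule word_op_mem) (auto simp: T_mem)

lemma word_add:
  "\<lbrakk>x \<in> hspace H; y \<in> hspace H\<rbrakk> \<Longrightarrow> word_op T \<alpha> (x + y) = word_op T \<alpha> x + word_op T \<alpha> y"
  by (induction \<alpha>) (simp_all add: bounded_opD(2)[OF bounded] word_mem)

lemma word_scale: "x \<in> hspace H \<Longrightarrow> word_op T \<alpha> (c *\<^sub>C x) = c *\<^sub>C word_op T \<alpha> x"
  by (induction \<alpha>) (simp_all add: bounded_opD(3)[OF bounded] word_mem)

lemma word_zero: "word_op T \<alpha> 0 = 0"
  using word_scale[OF zero_mem, of \<alpha> 0] by simp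

lemma kernel_add:
  "\<lbrakk>x \<in> hspace H; y \<in> hspace H; z \<in> hspace H\<rbrakk> \<Longrightarrow>
    toeplitz_kernel \<rho> H T \<alpha> \<beta> (x + y) z = toeplitz_kernel \<rho> H T \<alpha> \<beta> x z + toeplitz_kernel \<rho> H T \<alpha> \<beta> y z"
  by (simp add: toeplitz_kernel_def inner_add word_add word_mem distrib_left del: of_real_divide)

lemma kernel_scale:
  "\<lbrakk>x \<in> hspace H; z \<in> hspace H\<rbrakk> \<Longrightarrow>
    toeplitz_kernel \<rho> H T \<alpha> \<beta> (c *\<^sub>C x) z = c * toeplitz_kernel \<rho> H T \<alpha> \<beta> x z"
  by (simp add: toeplitz_kernel_def inner_scale word_scale word_mem del: of_real_divide)

lemma kernel_zero: "z \<in> hspace H \<Longrightarrow> toeplitz_kernel \<rho> H T \<alpha> \<beta> 0 z = 0"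
  "z \<in> hspace H \<Longrightarrow> toeplitz_kernel \<rho> H T \<alpha> \<beta> z 0 = 0"
  by (simp_all add: toeplitz_kernel_def word_zero word_mem)

lemma kernel_cnj:
  assumes "x \<in> hspace H" "z \<in> hspace H"
  shows "toeplitz_kernel \<rho> H T \<beta> \<alpha> z x = cnj (toeplitz_kernel \<rho> H T \<alpha> \<beta> x z)"
proof -
  have "\<not> (prefix \<alpha> \<beta> \<and> prefix \<beta> \<alpha>)" if "\<alpha> \<noteq> \<beta>" using that by (auto dest: prefix_order.antisym)
  then show ?thesis
    using assms inner_cnj[of x z]
      inner_cnj[of x "word_op T (drop (length \<alpha>) \<beta>) z"] inner_cnj[of "word_op T (drop (length \<beta>) \<alpha>) x" z]
    by (auto simp: toeplitz_kernel_def word_mem)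
qed

lemma form_eq:
  assumes f: "f \<in> word_families H" and g: "g \<in> word_families H"
    and W: "finite W" "{\<alpha>. f \<alpha> \<noteq> 0} \<subseteq> W" and W': "finite W'" "{\<alpha>. g \<alpha> \<noteq> 0} \<subseteq> W'"
  shows "toeplitz_form \<rho> H T f g = (\<Sum>\<alpha>\<in>W. \<Sum>\<beta>\<in>W'. toeplitz_kernel \<rho> H T \<alpha> \<beta> (f \<alpha>) (g \<beta>))"
proof -
  have m: "f \<alpha> \<in> hspace H" "g \<alpha> \<in> hspace H" for \<alpha> using f g by (auto simp: word_families_def)
  have "toeplitz_form \<rho> H T f g
      = (\<Sum>\<alpha>\<in>W. \<Sum>\<beta> | g \<beta> \<noteq> 0. toeplitz_kernel \<rho> H T \<alpha> \<beta> (f \<alpha>) (g \<beta>))"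
    unfolding toeplitz_form_def using W m by (intro sum.mono_neutral_left) (auto simp: kernel_zero)
  also have "\<dots> = (\<Sum>\<alpha>\<in>W. \<Sum>\<beta>\<in>W'. toeplitz_kernel \<rho> H T \<alpha> \<beta> (f \<alpha>) (g \<beta>))"
    using W' m by (intro sum.cong sum.mono_neutral_left) (auto simp: kernel_zero)
  finally show ?thesis .
qed

lemma subspace_word_families: "csubspace (word_families H :: ('n list \<Rightarrow> 'h) set)"
proof (rule complex_vector.subspaceI)
  fix f g :: "'n list \<Rightarrow> 'h" assume fg: "f \<in> word_families H" "g \<in> word_families H"
  have "{\<alpha>. (f + g) \<alpha> \<noteq> 0} \<subseteq> {\<alpha>. f \<alpha> \<noteq> 0} \<union> {\<alpha>. g \<alpha> \<noteq> 0}" by auto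
  moreover have "finite ({\<alpha>. f \<alpha> \<noteq> 0} \<union> {\<alpha>. g \<alpha> \<noteq> 0})" using fg by (simp add: word_families_def)
  ultimately have "finite {\<alpha>. (f + g) \<alpha> \<noteq> 0}" by (rule finite_subset)
  then show "f + g \<in> word_families H" using fg by (simp add: word_families_def)
next
  fix c and f :: "'n list \<Rightarrow> 'h" assume f: "f \<in> word_families H"
  have "{\<alpha>. (c *\<^sub>C f) \<alpha> \<noteq> 0} \<subseteq> {\<alpha>. f \<alpha> \<noteq> 0}" by auto
  moreover have "finite {\<alpha>. f \<alpha> \<noteq> 0}" using f by (simp add: word_families_def)
  ultimately have "finite {\<alpha>. (c *\<^sub>C f) \<alpha> \<noteq> 0}" by (rule finite_subset)
  then show "c *\<^sub>C f \<in> word_families H" using f by (simp add: word_families_def)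
qed (simp add: word_families_def)

lemma semi_inner_toeplitz:
  assumes pos: "\<And>f. f \<in> word_families H \<Longrightarrow> 0 \<le> Re (toeplitz_form \<rho> H T f f)"
  shows "semi_inner_space (word_families H) (toeplitz_form \<rho> H T)"
proof
  show "csubspace (word_families H :: ('n list \<Rightarrow> 'h) set)" by (rule subspace_word_families)
next
  fix f g h :: "'n list \<Rightarrow> 'h"
  assume fgh: "f \<in> word_families H" "g \<in> word_families H" "h \<in> word_families H"
  then have fg: "f + g \<in> word_families H" using subspace_word_families complex_vector.subspace_add by blast
  define W where "W = {\<alpha>. f \<alpha> \<noteq> 0} \<union> {\<alpha>. g \<alpha> \<noteq> 0} \<union> {\<alpha>. h \<alpha> \<noteq> 0}"
  have W: "finite W" "{\<alpha>. f \<alpha> \<noteq> 0} \<subseteq> W" "{\<alpha>. g \<alpha> \<noteq> 0} \<subseteq> W" "{\<alpha>. h \<alpha> \<noteq> 0} \<subseteq> W"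
    "{\<alpha>. (f + g) \<alpha> \<noteq> 0} \<subseteq> W"
    using fgh by (auto simp: W_def word_families_def)
  have m: "f \<alpha> \<in> hspace H" "g \<alpha> \<in> hspace H" "h \<alpha> \<in> hspace H" for \<alpha>
    using fgh by (auto simp: word_families_def)
  show "toeplitz_form \<rho> H T (f + g) h = toeplitz_form \<rho> H T f h + toeplitz_form \<rho> H T g h"
    unfolding form_eq[OF fg fgh(3) W(1,5) W(1,4)] form_eq[OF fgh(1,3) W(1,2) W(1,4)]
      form_eq[OF fgh(2,3) W(1,3) W(1,4)] sum.distrib[symmetric]
    by (intro sum.cong refl) (simp add: kernel_add m)
next
  fix f g :: "'n list \<Rightarrow> 'h" and c
  assume fg: "f \<in> word_families H" "g \<in> word_families H"
  then have cf: "c *\<^sub>C f \<in> word_families H"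
    using subspace_word_families complex_vector.subspace_scale by blast
  define W where "W = {\<alpha>. f \<alpha> \<noteq> 0} \<union> {\<alpha>. g \<alpha> \<noteq> 0}"
  have W: "finite W" "{\<alpha>. f \<alpha> \<noteq> 0} \<subseteq> W" "{\<alpha>. g \<alpha> \<noteq> 0} \<subseteq> W" "{\<alpha>. (c *\<^sub>C f) \<alpha> \<noteq> 0} \<subseteq> W"
    using fg by (auto simp: W_def word_families_def)
  have m: "f \<alpha> \<in> hspace H" "g \<alpha> \<in> hspace H" for \<alpha>
    using fg by (auto simp: word_families_def)
  show "toeplitz_form \<rho> H T (c *\<^sub>C f) g = c * toeplitz_form \<rho> H T f g"
    unfolding form_eq[OF cf fg(2) W(1,4) W(1,3)] form_eq[OF fg W(1,2) W(1,3)] sum_distrib_left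
    by (intro sum.cong refl) (simp add: kernel_scale m)
  have "toeplitz_form \<rho> H T g f
      = (\<Sum>\<alpha>\<in>W. \<Sum>\<beta>\<in>W. toeplitz_kernel \<rho> H T \<beta> \<alpha> (g \<beta>) (f \<alpha>))"
    unfolding form_eq[OF fg(2,1) W(1,3) W(1,2)] by (rule sum.swap)
  also have "\<dots> = cnj (\<Sum>\<alpha>\<in>W. \<Sum>\<beta>\<in>W. toeplitz_kernel \<rho> H T \<alpha> \<beta> (f \<alpha>) (g \<beta>))"
    unfolding cnj_sum by (intro sum.cong refl kernel_cnj m)
  finally show "toeplitz_form \<rho> H T g f = cnj (toeplitz_form \<rho> H T f g)"
    unfolding form_eq[OF fg W(1,2) W(1,3)] .
qed (rule pos)

lemma shift_support: "{\<alpha>. family_shift i f \<alpha> \<noteq> 0} = (#) i ` {\<alpha>. f \<alpha> \<noteq> 0}"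
proof (rule Set.set_eqI)
  fix \<gamma>
  show "\<gamma> \<in> {\<alpha>. family_shift i f \<alpha> \<noteq> 0} \<longleftrightarrow> \<gamma> \<in> (#) i ` {\<alpha>. f \<alpha> \<noteq> 0}"
    by (cases \<gamma>) (auto simp: family_shift_def)
qed

lemma shift_mem: "f \<in> word_families H \<Longrightarrow> family_shift i f \<in> word_families H"
  by (auto simp: word_families_def shift_support) (simp add: family_shift_def split: list.splits)

text \<open>The multi-Toeplitz property. It is the reason why the shifts by letters are isometric
  and have mutually orthogonal ranges.\<close>

lemma kernel_Cons:
  "toeplitz_kernel \<rho> H T (i # \<alpha>) (j # \<beta>) h k = (if i = j then toeplitz_kernel \<rho> H T \<alpha> \<beta> h k else 0)"
  by (simp add: toeplitz_kernel_def)

lemma form_shift: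
  "toeplitz_form \<rho> H T (family_shift i f) (family_shift j g)
    = (if i = j then toeplitz_form \<rho> H T f g else 0)"
  unfolding toeplitz_form_def shift_support
  by (simp add: sum.reindex kernel_Cons) (simp add: family_shift_def)

lemma single_mem: "h \<in> hspace H \<Longrightarrow> single_family \<alpha> h \<in> word_families H"
  by (simp add: word_families_def single_family_def)

lemma form_single:
  assumes "h \<in> hspace H" "k \<in> hspace H"
  shows "toeplitz_form \<rho> H T (single_family \<alpha> h) (single_family \<beta> k) = toeplitz_kernel \<rho> H T \<alpha> \<beta> h k"
proof -
  have s: "{\<gamma>. single_family \<alpha> h \<gamma> \<noteq> 0} \<subseteq> {\<alpha>}" for \<alpha> :: "'n list" and h :: 'h
    by (auto simp: single_family_def split: if_splits)
  have "toeplitz_form \<rho> H T (single_family \<alpha> h) (single_family \<beta> k)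
      = (\<Sum>\<gamma>\<in>{\<alpha>}. \<Sum>\<delta>\<in>{\<beta>}.
          toeplitz_kernel \<rho> H T \<gamma> \<delta> (single_family \<alpha> h \<gamma>) (single_family \<beta> k \<delta>))"
    by (intro form_eq single_mem assms s) simp_all
  then show ?thesis by (simp add: single_family_def)
qed

text \<open>\<open>H\<close> is embedded as the families living on the empty word. The entry 1 at
  \<open>([], [])\<close> makes this isometric, and the entries at \<open>(\<alpha>, [])\<close>
  prescribe the compression of \<open>V_\<alpha>\<close>.\<close>

lemma class_C_of_positive_form:
  assumes \<rho>: "\<rho> > 0" and pos: "\<And>f. f \<in> word_families H \<Longrightarrow> 0 \<le> Re (toeplitz_form \<rho> H T f f)"
  shows "class_C \<rho> H T"
proof -
  interpret S: semi_inner_space "word_families H" "toeplitz_form \<rho> H T"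
    by (rule semi_inner_toeplitz[OF pos])
  interpret C: semi_inner_space S.cauchy_seqs S.lim_form by (rule S.semi_inner_cauchy)
  let ?G = "C.quotient_hilb"
  interpret G: hilbert_space ?G by (rule S.hilbert_space_completion)
  define V where "V i = S.completion_map (family_shift i)" for i
  have sh: "family_shift i (x + y) = family_shift i x + family_shift i y"
    "family_shift i (c *\<^sub>C x) = c *\<^sub>C family_shift i x" for i c and x y :: "'n list \<Rightarrow> 'h"
    by (auto simp: family_shift_def fun_eq_iff split: list.splits)
  have Viso: "isometric_op ?G ?G (V i)" for i
    unfolding V_def by (rule S.completion_map_isometric) (auto simp: shift_mem sh form_shift)
  have VF: "V i (C.functional u) = C.functional (\<lambda>n. family_shift i (u n))" if "u \<in> S.cauchy_seqs" for i u
    unfolding V_def by (rule S.completion_map_functional) (auto simp: shift_mem sh form_shift that)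
  have shC: "(\<lambda>n. family_shift i (u n)) \<in> S.cauchy_seqs" if "u \<in> S.cauchy_seqs" for i u
    by (rule S.pointwise_cauchy[where \<sigma> = "family_shift i"]) (auto simp: shift_mem sh form_shift that)
  have orth: "hinner ?G (V i x) (V j y) = 0" if ij: "i \<noteq> j" and xy: "x \<in> hspace ?G" "y \<in> hspace ?G" for i j x y
  proof -
    obtain u v where uv: "u \<in> S.cauchy_seqs" "x = C.functional u" "v \<in> S.cauchy_seqs" "y = C.functional v"
      using xy by (auto simp: C.hspace_quotient)
    have "S.lim_form (\<lambda>n. family_shift i (u n)) (\<lambda>n. family_shift j (v n)) = 0"
      by (rule S.lim_form_eqI) (simp add: form_shift ij)
    then show ?thesis using uv by (simp add: VF C.hinner_functional shC)
  qed
  define e where "e \<alpha> h = C.functional (\<lambda>n. single_family \<alpha> h)" for \<alpha> :: "'n list" and h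
  have eC: "(\<lambda>n. single_family \<alpha> h) \<in> S.cauchy_seqs" if "h \<in> hspace H" for \<alpha> :: "'n list" and h
    by (rule S.const_cauchy) (rule single_mem[OF that])
  have eG: "e \<alpha> h \<in> hspace ?G" if "h \<in> hspace H" for \<alpha> h
    unfolding e_def by (rule C.functional_mem[OF eC[OF that]])
  have ee: "hinner ?G (e \<alpha> h) (e \<beta> k) = toeplitz_kernel \<rho> H T \<alpha> \<beta> h k"
    if "h \<in> hspace H" "k \<in> hspace H" for \<alpha> \<beta> h k
    using that by (simp add: e_def C.hinner_functional eC S.lim_form_const form_single)
  have Ve: "word_op V \<alpha> (e [] h) = e \<alpha> h" if "h \<in> hspace H" for \<alpha> h
    by (induction \<alpha>) (simp_all add: e_def VF eC that family_shift_single)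
  define J where "J = e []"
  have Jadd: "J (x + y) = J x + J y" if "x \<in> hspace H" "y \<in> hspace H" for x y
  proof -
    have "(\<lambda>n::nat. single_family ([] :: 'n list) (x + y)) = (\<lambda>n. single_family [] x) + (\<lambda>n. single_family [] y)"
      by (auto simp: single_family_def fun_eq_iff)
    then show ?thesis
      unfolding J_def e_def using C.functional_add[OF eC[OF that(1)] eC[OF that(2)]] by (simp only:)
  qed
  have Jscale: "J (c *\<^sub>C x) = c *\<^sub>C J x" if "x \<in> hspace H" for c x
  proof -
    have "(\<lambda>n::nat. single_family ([] :: 'n list) (c *\<^sub>C x)) = c *\<^sub>C (\<lambda>n. single_family [] x)"
      by (auto simp: single_family_def fun_eq_iff)
    then show ?thesis
      unfolding J_def e_def using C.functional_scale[OF eC[OF that]] by (simp only:)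
  qed
  have Jinner: "hinner ?G (J x) (J y) = hinner H x y" if "x \<in> hspace H" "y \<in> hspace H" for x y
    using that by (simp add: J_def ee toeplitz_kernel_def)
  have J: "isometric_op H ?G J"
  proof (rule isometric_opI)
    show "J x \<in> hspace ?G" if "x \<in> hspace H" for x using that by (simp add: J_def eG)
  qed (simp_all add: Jadd Jscale Jinner hnorm_def)
  have dil: "J (word_op T \<alpha> h)
      = complex_of_real \<rho> *\<^sub>C orth_proj ?G (J ` hspace H) (word_op V \<alpha> (J h))"
    if \<alpha>: "\<alpha> \<noteq> []" and h: "h \<in> hspace H" for \<alpha> h
  proof -
    \<comment> \<open>The dilation identity solved for the projection; it remains to see that the
      difference to \<open>word_op V \<alpha> (J h)\<close> is orthogonal to the image of
      \<open>J\<close>.\<close>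
    define y where "y = complex_of_real (1 / \<rho>) *\<^sub>C J (word_op T \<alpha> h)"
    have y: "y = J (complex_of_real (1 / \<rho>) *\<^sub>C word_op T \<alpha> h)"
      unfolding y_def using h by (simp add: Jscale word_mem)
    have "orth_proj ?G (J ` hspace H) (word_op V \<alpha> (J h)) = y"
    proof (rule G.orth_proj_eqI)
      show "csubspace (J ` hspace H)" "J ` hspace H \<subseteq> hspace ?G"
        using range_isometry[OF hilbert_space_axioms G.hilbert_space_axioms J] by auto
      show "word_op V \<alpha> (J h) \<in> hspace ?G" using h by (simp add: J_def Ve eG)
      show "y \<in> J ` hspace H" unfolding y using h by (intro imageI) (simp add: word_mem)
      show "\<forall>z\<in>J ` hspace H. hinner ?G (word_op V \<alpha> (J h) - y) z = 0"
      proof clarify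
        fix k assume k: "k \<in> hspace H"
        have "hinner ?G (word_op V \<alpha> (J h)) (J k) = complex_of_real (1 / \<rho>) * hinner H (word_op T \<alpha> h) k"
          using h k \<alpha> by (simp add: J_def Ve ee toeplitz_kernel_def)
        moreover have "hinner ?G y (J k) = complex_of_real (1 / \<rho>) * hinner H (word_op T \<alpha> h) k"
          unfolding y using h k by (subst Jinner) (simp_all add: word_mem inner_scale)
        moreover have "word_op V \<alpha> (J h) \<in> hspace ?G" "y \<in> hspace ?G" "J k \<in> hspace ?G"
          using h k by (simp_all add: J_def Ve eG y word_mem)
        ultimately show "hinner ?G (word_op V \<alpha> (J h) - y) (J k) = 0" by (simp add: G.inner_diff)
      qed
    qed
    then show ?thesis using \<rho> by (simp add: y_def scaleC_scaleC scaleC_one flip: of_real_mult)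
  qed
  have "rho_dilation \<rho> H T ?G J V"
    unfolding rho_dilation_def using G.hilbert_space_axioms J Viso orth dil by blast
  \<comment> \<open>The completion consists of functionals on Cauchy sequences, not of the functions
    fixed in \<open>class_C\<close>; \<open>class_C_I\<close> transports the dilation.\<close>
  then show ?thesis by (rule class_C_I[OF hilbert_space_axioms])
qed

end

subsection \<open>Operator norms\<close>

lemma (in hilbert_space) bounded_opE:
  assumes "bounded_op H H A"
  obtains M where "0 \<le> M" "\<And>x. x \<in> hspace H \<Longrightarrow> hnorm H (A x) \<le> M * hnorm H x"
proof -
  obtain M where M: "\<forall>x\<in>hspace H. hnorm H (A x) \<le> M * hnorm H x"
    using assms unfolding bounded_op_def by blast
  have "hnorm H (A x) \<le> max M 0 * hnorm H x" if "x \<in> hspace H" for x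
    using bspec[OF M that] mult_right_mono[OF max.cobounded1 hnorm_nonneg[OF that], of M 0] by linarith
  then show ?thesis using that[of "max M 0"] by simp
qed

lemma bounded_opI:
  assumes "\<And>x. x \<in> hspace H \<Longrightarrow> A x \<in> hspace K"
    and "\<And>x y. x \<in> hspace H \<Longrightarrow> y \<in> hspace H \<Longrightarrow> A (x + y) = A x + A y"
    and "\<And>c x. x \<in> hspace H \<Longrightarrow> A (c *\<^sub>C x) = c *\<^sub>C A x"
    and "\<And>x. x \<in> hspace H \<Longrightarrow> hnorm K (A x) \<le> M * hnorm H x"
  shows "bounded_op H K A"
  using assms unfolding bounded_op_def by blast

lemma (in hilbert_space) hnorm_le_opnorm:
  assumes A: "bounded_op H H A" and x: "x \<in> hspace H" "hnorm H x \<le> 1"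
  shows "hnorm H (A x) \<le> opnorm H A"
  unfolding opnorm_def
proof (rule cSup_upper)
  obtain M where M: "0 \<le> M" "\<And>x. x \<in> hspace H \<Longrightarrow> hnorm H (A x) \<le> M * hnorm H x"
    using bounded_opE[OF A] by blast
  show "bdd_above {hnorm H (A x) | x. x \<in> hspace H \<and> hnorm H x \<le> 1}"
  proof (rule bdd_aboveI)
    fix y assume "y \<in> {hnorm H (A x) | x. x \<in> hspace H \<and> hnorm H x \<le> 1}"
    then obtain x where x: "x \<in> hspace H" "hnorm H x \<le> 1" "y = hnorm H (A x)" by blast
    then show "y \<le> M" using M(2)[OF x(1)] mult_left_mono[OF x(2) M(1)] by simp
  qed
qed (use x in blast)

lemma (in hilbert_space) opnorm_nonneg:
  assumes A: "bounded_op H H A"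
  shows "0 \<le> opnorm H A"
  using hnorm_le_opnorm[OF A zero_mem] hnorm_nonneg[OF bounded_opD(1)[OF A zero_mem]]
  by (simp add: hnorm_def[of _ 0])

lemma (in hilbert_space) le_opnorm:
  assumes A: "bounded_op H H A" and x: "x \<in> hspace H"
  shows "hnorm H (A x) \<le> opnorm H A * hnorm H x"
proof (cases "hnorm H x = 0")
  case True
  obtain M where "0 \<le> M" "\<And>x. x \<in> hspace H \<Longrightarrow> hnorm H (A x) \<le> M * hnorm H x"
    using bounded_opE[OF A] by blast
  then show ?thesis using True x by fastforce
next
  case False
  then have pos: "hnorm H x > 0" using hnorm_nonneg[OF x] by simp
  define y where "y = complex_of_real (1 / hnorm H x) *\<^sub>C x"
  have y: "y \<in> hspace H" "hnorm H y \<le> 1"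
    using x pos by (simp_all add: y_def hnorm_scale norm_divide)
  have "hnorm H (A y) \<le> opnorm H A" by (rule hnorm_le_opnorm[OF A y])
  moreover have "hnorm H (A y) = hnorm H (A x) / hnorm H x"
    using x pos bounded_opD[OF A] by (simp add: y_def hnorm_scale norm_divide)
  ultimately show ?thesis using pos by (simp add: field_simps)
qed

lemma (in hilbert_space) opnorm_leI:
  assumes "0 \<le> c" "\<And>x. x \<in> hspace H \<Longrightarrow> hnorm H (A x) \<le> c * hnorm H x"
  shows "opnorm H A \<le> c"
  unfolding opnorm_def
proof (rule cSup_least)
  have "hnorm H 0 \<le> 1" by (simp add: hnorm_def)
  then show "{hnorm H (A x) | x. x \<in> hspace H \<and> hnorm H x \<le> 1} \<noteq> {}" using zero_mem by blast
next
  fix y assume "y \<in> {hnorm H (A x) | x. x \<in> hspace H \<and> hnorm H x \<le> 1}"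
  then obtain x where x: "x \<in> hspace H" "hnorm H x \<le> 1" "y = hnorm H (A x)" by blast
  then show "y \<le> c" using assms(2)[OF x(1)] mult_left_mono[OF x(2) assms(1)] by simp
qed

text \<open>Returns from the additive to the multiplicative bound: inserting \<open>y = t z\<close>
  with \<open>t = 1 / c\<close> balances the two squares. For \<open>c = 0\<close> already
  \<open>t = 1\<close> forces \<open>z\<close> to have norm zero.\<close>

lemma (in hilbert_space) norm_le_of_form_le:
  assumes z: "z \<in> hspace H" and x: "x \<in> hspace H" and c: "0 \<le> c"
    and le: "\<And>y. y \<in> hspace H \<Longrightarrow> Re (hinner H z y) \<le> c / 2 * ((hnorm H x)\<^sup>2 + (hnorm H y)\<^sup>2)"
  shows "hnorm H z \<le> c * hnorm H x"
proof -
  define n where "n = (hnorm H z)\<^sup>2"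
  have t: "t * n \<le> c / 2 * ((hnorm H x)\<^sup>2 + t\<^sup>2 * n)" for t
    using le[of "complex_of_real t *\<^sub>C z"] z
    by (simp add: inner_scale_right inner_self hnorm_scale power_mult_distrib n_def
        del: of_real_power)
  have "n \<le> (c * hnorm H x)\<^sup>2"
  proof (cases "c = 0")
    case True
    then show ?thesis using t[of 1] by simp
  next
    case False
    then show ?thesis using t[of "1 / c"] c by (simp add: field_simps power2_eq_square)
  qed
  then show ?thesis
    unfolding n_def using c x by (meson hnorm_nonneg mult_nonneg_nonneg power2_le_imp_le)
qed

context hilbert_space
begin

lemma bounded_op_id: "bounded_op H H id"
  by (rule bounded_opI[where M = 1]) simp_all

lemma bounded_op_compose:
  assumes A: "bounded_op H H A" and B: "bounded_op H H B"
  shows "bounded_op H H (A \<circ> B)"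
proof -
  obtain M where M: "0 \<le> M" "\<And>x. x \<in> hspace H \<Longrightarrow> hnorm H (A x) \<le> M * hnorm H x"
    using bounded_opE[OF A] by blast
  obtain N where N: "0 \<le> N" "\<And>x. x \<in> hspace H \<Longrightarrow> hnorm H (B x) \<le> N * hnorm H x"
    using bounded_opE[OF B] by blast
  have "hnorm H ((A \<circ> B) x) \<le> M * N * hnorm H x" if "x \<in> hspace H" for x
    using M(2)[OF bounded_opD(1)[OF B that]] mult_left_mono[OF N(2)[OF that] M(1)]
    by (simp add: mult.assoc)
  then show ?thesis
    by (rule bounded_opI[rotated -1]) (simp_all add: bounded_opD[OF A] bounded_opD[OF B])
qed

lemma bounded_op_scale:
  assumes A: "bounded_op H H A"
  shows "bounded_op H H (c *\<^sub>C A)"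
proof -
  obtain M where M: "0 \<le> M" "\<And>x. x \<in> hspace H \<Longrightarrow> hnorm H (A x) \<le> M * hnorm H x"
    using bounded_opE[OF A] by blast
  have "hnorm H ((c *\<^sub>C A) x) \<le> cmod c * M * hnorm H x" if "x \<in> hspace H" for x
    using mult_left_mono[OF M(2)[OF that], of "cmod c"] bounded_opD(1)[OF A that]
    by (simp add: hnorm_scale mult.assoc)
  then show ?thesis
    by (rule bounded_opI[rotated -1])
      (simp_all add: bounded_opD[OF A] scaleC_add_right scaleC_scaleC mult.commute[of c])
qed

lemma bounded_op_zero: "bounded_op H H 0"
  by (rule bounded_opI[where M = 0]) (simp_all add: hnorm_def)

lemma bounded_op_plus:
  assumes A: "bounded_op H H A" and B: "bounded_op H H B"
  shows "bounded_op H H (A + B)"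
proof -
  obtain M where M: "0 \<le> M" "\<And>x. x \<in> hspace H \<Longrightarrow> hnorm H (A x) \<le> M * hnorm H x"
    using bounded_opE[OF A] by blast
  obtain N where N: "0 \<le> N" "\<And>x. x \<in> hspace H \<Longrightarrow> hnorm H (B x) \<le> N * hnorm H x"
    using bounded_opE[OF B] by blast
  have "hnorm H ((A + B) x) \<le> (M + N) * hnorm H x" if "x \<in> hspace H" for x
    using M(2)[OF that] N(2)[OF that] triangle[OF bounded_opD(1)[OF A that] bounded_opD(1)[OF B that]]
    by (simp add: distrib_right)
  then show ?thesis
    by (rule bounded_opI[rotated -1])
      (simp_all add: bounded_opD[OF A] bounded_opD[OF B] scaleC_add_right ac_simps)
qed

lemma bounded_op_nc_eval:
  assumes T: "\<And>i. bounded_op H H (T i)"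
  shows "bounded_op H H (nc_eval T q)"
proof -
  have w: "bounded_op H H (word_op T \<alpha>)" for \<alpha>
    by (induction \<alpha>) (simp_all only: word_op.simps bounded_op_id bounded_op_compose T)
  have "bounded_op H H (\<Sum>\<alpha>\<in>W. q \<alpha> *\<^sub>C word_op T \<alpha>)" for W
  proof (induction W rule: infinite_finite_induct)
    case (infinite W)
    then show ?case by (metis sum.infinite bounded_op_zero)
  next
    case empty
    show ?case unfolding sum.empty by (rule bounded_op_zero)
  next
    case (insert \<alpha> W)
    show ?case unfolding sum.insert[OF insert.hyps]
      by (intro bounded_op_plus bounded_op_scale w insert.IH)
  qed
  then show ?thesis by (simp add: nc_eval_def)
qed

text \<open>\<open>opnorm\<close> is a real supremum, so \<open>le_opnorm\<close> and
  \<open>opnorm_nonneg\<close> are available only after boundedness is known. Row sums of the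
  entrywise bounds are enough.\<close>

lemma bounded_op_mat_eval:
  assumes T: "\<And>i. bounded_op H H (T i)"
  shows "bounded_op (ampliation m H) (ampliation m H) (mat_eval m T q)"
proof -
  interpret A: hilbert_space "ampliation m H" by (rule hilbert_space_ampliation) (rule hilbert_space_axioms)
  note b = bounded_op_nc_eval[of T, OF T]
  have Tm: "T i x \<in> hspace H" if "x \<in> hspace H" for i x using bounded_opD(1)[OF T that] .
  have "\<forall>i j. \<exists>M. \<forall>x\<in>hspace H. hnorm H (nc_eval T (q i j) x) \<le> M * hnorm H x"
    using b by (auto simp: bounded_op_def)
  then obtain M where M: "\<And>i j x. x \<in> hspace H \<Longrightarrow> hnorm H (nc_eval T (q i j) x) \<le> M i j * hnorm H x"
    by metis
  define K where "K i = (\<Sum>j<m. \<bar>M i j\<bar>)" for i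
  have bound: "hnorm (ampliation m H) (mat_eval m T q x)
      \<le> sqrt (\<Sum>i<m. (K i)\<^sup>2) * hnorm (ampliation m H) x" if x: "x \<in> hspace (ampliation m H)" for x
  proof -
    define n where "n = hnorm (ampliation m H) x"
    have xm: "x j \<in> hspace H" if "j < m" for j using x that by (simp add: hspace_ampliation)
    have n0: "0 \<le> n" unfolding n_def by (rule A.hnorm_nonneg[OF x])
    have xn: "hnorm H (x j) \<le> n" if "j < m" for j
      unfolding n_def hnorm_ampliation[OF x]
      using that by (intro real_le_rsqrt) (auto intro!: member_le_sum[of j _ "\<lambda>j. (hnorm H (x j))\<^sup>2"])
    have sum_le: "hnorm H (\<Sum>j\<in>J. nc_eval T (q i j) (x j)) \<le> (\<Sum>j\<in>J. \<bar>M i j\<bar> * n)"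
      if "finite J" "J \<subseteq> {..<m}" for i J
      using that
    proof (induction J rule: finite_induct)
      case (insert j J)
      have j: "j < m" using insert.prems by simp
      have "hnorm H (nc_eval T (q i j) (x j)) \<le> \<bar>M i j\<bar> * n"
        using M[OF xm[OF j], of i j] mult_right_mono[of "M i j" "\<bar>M i j\<bar>" "hnorm H (x j)"]
          mult_left_mono[OF xn[OF j], of "\<bar>M i j\<bar>"] hnorm_nonneg[OF xm[OF j]] by linarith
      moreover have "hnorm H (nc_eval T (q i j) (x j) + (\<Sum>j\<in>J. nc_eval T (q i j) (x j)))
          \<le> hnorm H (nc_eval T (q i j) (x j)) + hnorm H (\<Sum>j\<in>J. nc_eval T (q i j) (x j))"
        using insert.prems by (intro triangle sum_mem nc_eval_mem Tm xm) auto
      ultimately show ?case using insert by simp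
    qed (simp add: hnorm_def)
    have "(\<Sum>i<m. (hnorm H (mat_eval m T q x i))\<^sup>2) \<le> (\<Sum>i<m. (K i * n)\<^sup>2)"
    proof (intro sum_mono power_mono)
      fix i assume i: "i \<in> {..<m}"
      then show "hnorm H (mat_eval m T q x i) \<le> K i * n"
        using sum_le[of "{..<m}" i] by (simp add: mat_eval_def K_def sum_distrib_right)
      show "0 \<le> hnorm H (mat_eval m T q x i)"
        using mat_eval_mem[of T, OF Tm x] i by (intro hnorm_nonneg) (simp add: hspace_ampliation)
    qed
    also have "\<dots> = (\<Sum>i<m. (K i)\<^sup>2) * n\<^sup>2" by (simp add: power_mult_distrib sum_distrib_right)
    finally have "sqrt (\<Sum>i<m. (hnorm H (mat_eval m T q x i))\<^sup>2) \<le> sqrt ((\<Sum>i<m. (K i)\<^sup>2) * n\<^sup>2)"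
      by simp
    then show ?thesis
      using n0 by (simp add: hnorm_ampliation[OF mat_eval_mem[of T, OF Tm x]] real_sqrt_mult flip: n_def)
  qed
  show ?thesis
    unfolding bounded_op_def
  proof (intro conjI ballI allI exI[of _ "sqrt (\<Sum>i<m. (K i)\<^sup>2)"])
    fix x assume x: "x \<in> hspace (ampliation m H)"
    show "mat_eval m T q x \<in> hspace (ampliation m H)" by (rule mat_eval_mem[of T, OF Tm x])
    show "hnorm (ampliation m H) (mat_eval m T q x)
        \<le> sqrt (\<Sum>i<m. (K i)\<^sup>2) * hnorm (ampliation m H) x" by (rule bound[OF x])
    show "mat_eval m T q (c *\<^sub>C x) = c *\<^sub>C mat_eval m T q x" for c
      using x bounded_opD(3)[OF b]
      by (auto simp: mat_eval_def fun_eq_iff hspace_ampliation complex_vector.scale_sum_right)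
    show "mat_eval m T q (x + y) = mat_eval m T q x + mat_eval m T q y"
      if "y \<in> hspace (ampliation m H)" for y
      using x that bounded_opD(2)[OF b]
      by (auto simp: mat_eval_def fun_eq_iff hspace_ampliation sum.distrib)
  qed
qed

end

subsection \<open>The map \<open>\<Psi>\<^sub>T\<close> on polynomials\<close>

text \<open>The coefficients of \<open>q / \<rho> + (1 - 1 / \<rho>) q(0)\<close>: the two
  contributions to the constant term add up to \<open>q []\<close>. So constants are fixed, and the
  parameter \<open>1 / \<rho>\<close> gives the inverse.\<close>

definition psi_poly :: "real \<Rightarrow> ('n list \<Rightarrow> complex) \<Rightarrow> 'n list \<Rightarrow> complex" where
  "psi_poly \<rho> q = (\<lambda>\<alpha>. if \<alpha> = [] then q [] else complex_of_real (1 / \<rho>) * q \<alpha>)"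

lemma psi_poly_one: "psi_poly 1 q = q"
  by (auto simp: psi_poly_def)

lemma psi_poly_inverse: "\<rho> > 0 \<Longrightarrow> psi_poly (1 / \<rho>) (psi_poly \<rho> q) = q"
  by (auto simp: psi_poly_def)

lemma psi_poly_mem: "q \<in> nc_polys \<Longrightarrow> psi_poly \<rho> q \<in> nc_polys"
  by (auto simp: nc_polys_def psi_poly_def elim!: finite_subset[rotated])

lemma nc_eval_affine:
  assumes q: "q \<in> nc_polys"
  shows "nc_eval T (\<lambda>\<alpha>. (if \<alpha> = [] then a else 0) + b * q \<alpha>) x = a *\<^sub>C x + b *\<^sub>C nc_eval T q x"
proof -
  \<comment> \<open>The empty word is added because \<open>a\<close> can create a constant term that
    \<open>q\<close> does not have.\<close>
  define W where "W = insert [] {\<alpha>. q \<alpha> \<noteq> 0}"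
  have W: "finite W" using q by (simp add: W_def nc_polys_def)
  have "nc_eval T (\<lambda>\<alpha>. (if \<alpha> = [] then a else 0) + b * q \<alpha>) x
      = (\<Sum>\<alpha>\<in>W. ((if \<alpha> = [] then a else 0) + b * q \<alpha>) *\<^sub>C word_op T \<alpha> x)"
    by (rule nc_eval_eq_sum[OF W]) (auto simp: W_def)
  also have "\<dots> = (\<Sum>\<alpha>\<in>W. (if \<alpha> = [] then a *\<^sub>C x else 0)) + (\<Sum>\<alpha>\<in>W. b *\<^sub>C q \<alpha> *\<^sub>C word_op T \<alpha> x)"
    unfolding sum.distrib[symmetric]
    by (intro sum.cong refl) (simp add: scaleC_add_left scaleC_scaleC)
  also have "(\<Sum>\<alpha>\<in>W. (if \<alpha> = [] then a *\<^sub>C x else 0)) = a *\<^sub>C x" using W by (simp add: W_def)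
  also have "(\<Sum>\<alpha>\<in>W. b *\<^sub>C q \<alpha> *\<^sub>C word_op T \<alpha> x) = b *\<^sub>C nc_eval T q x"
  proof -
    have "nc_eval T q x = (\<Sum>\<alpha>\<in>W. q \<alpha> *\<^sub>C word_op T \<alpha> x)"
      by (rule nc_eval_eq_sum[OF W]) (auto simp: W_def)
    then show ?thesis by (simp only: complex_vector.scale_sum_right)
  qed
  finally show ?thesis .
qed

lemma nc_eval_psi:
  assumes "q \<in> nc_polys"
  shows "nc_eval T (psi_poly \<rho> q)
    = complex_of_real (1 / \<rho>) *\<^sub>C nc_eval T q + (complex_of_real (1 - 1 / \<rho>) * q []) *\<^sub>C id"
proof
  fix x
  have e: "psi_poly \<rho> q = (\<lambda>\<alpha>. (if \<alpha> = [] then complex_of_real (1 - 1 / \<rho>) * q [] else 0)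
      + complex_of_real (1 / \<rho>) * q \<alpha>)"
    by (auto simp: psi_poly_def algebra_simps)
  show "nc_eval T (psi_poly \<rho> q) x
    = (complex_of_real (1 / \<rho>) *\<^sub>C nc_eval T q + (complex_of_real (1 - 1 / \<rho>) * q []) *\<^sub>C id) x"
    unfolding e nc_eval_affine[OF assms] by (simp add: add.commute)
qed

lemma mat_eval_cong:
  "(\<And>i j. \<lbrakk>i < m; j < m\<rbrakk> \<Longrightarrow> nc_eval T (p i j) = nc_eval T (q i j)) \<Longrightarrow> mat_eval m T p = mat_eval m T q"
  by (auto simp: mat_eval_def fun_eq_iff)

text \<open>The common form of (ii) and (iii), free of operator matrices and of matrix
  coefficients.\<close>

definition poly_contractive :: "real \<Rightarrow> 'h::complex_vector hilb \<Rightarrow> ('n \<Rightarrow> 'h \<Rightarrow> 'h) \<Rightarrow> bool" where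
  "poly_contractive \<rho> H T \<longleftrightarrow> (\<forall>m\<ge>1. \<forall>q. (\<forall>i<m. \<forall>j<m. q i j \<in> nc_polys) \<longrightarrow>
     opnorm (ampliation m H) (mat_eval m T (\<lambda>i j. psi_poly \<rho> (q i j)))
     \<le> opnorm (ampliation m fock) (mat_eval m creation q))"

lemma mat_op_eq_mat_eval:
  assumes "A \<in> carrier_mat m m" "\<And>i j. \<lbrakk>i < m; j < m\<rbrakk> \<Longrightarrow> A $$ (i, j) = nc_eval T (q i j)"
  shows "mat_op A = mat_eval m T q"
  using assms by (auto simp: mat_op_def mat_eval_def fun_eq_iff)

lemma completely_contractive_iff:
  fixes T :: "'n \<Rightarrow> 'h \<Rightarrow> 'h::complex_vector"
  shows "completely_contractive fock H creation_polys (Psi \<rho> T) \<longleftrightarrow> poly_contractive \<rho> H T"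
proof
  assume cc: "completely_contractive fock H creation_polys (Psi \<rho> T)"
  show "poly_contractive \<rho> H T"
    unfolding poly_contractive_def
  proof (intro allI impI)
    fix m :: nat and q :: "nat \<Rightarrow> nat \<Rightarrow> 'n list \<Rightarrow> complex"
    assume m: "1 \<le> m" and q: "\<forall>i<m. \<forall>j<m. q i j \<in> nc_polys"
    define A where "A = mat m m (\<lambda>(i, j). nc_eval creation (q i j))"
    have A: "A \<in> carrier_mat m m" by (simp add: A_def)
    have "\<forall>i<m. \<forall>j<m. A $$ (i, j) \<in> creation_polys" using q by (auto simp: A_def creation_polys_def)
    then have "opnorm (ampliation m H) (mat_op (map_mat (Psi \<rho> T) A)) \<le> opnorm (ampliation m fock) (mat_op A)"
      using cc m A unfolding completely_contractive_def by blast
    moreover have "mat_op A = mat_eval m creation q"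
      by (rule mat_op_eq_mat_eval[OF A]) (simp add: A_def)
    moreover have "mat_op (map_mat (Psi \<rho> T) A) = mat_eval m T (\<lambda>i j. psi_poly \<rho> (q i j))"
      using q by (intro mat_op_eq_mat_eval) (auto simp: A_def Psi_nc_eval nc_eval_psi)
    ultimately show "opnorm (ampliation m H) (mat_eval m T (\<lambda>i j. psi_poly \<rho> (q i j)))
        \<le> opnorm (ampliation m fock) (mat_eval m creation q)" by simp
  qed
next
  assume pc: "poly_contractive \<rho> H T"
  show "completely_contractive fock H creation_polys (Psi \<rho> T)"
    unfolding completely_contractive_def
  proof (intro allI ballI impI)
    fix m and A :: "(('n list \<Rightarrow> complex) \<Rightarrow> 'n list \<Rightarrow> complex) mat"
    assume m: "1 \<le> m" and A: "A \<in> carrier_mat m m" and e: "\<forall>i<m. \<forall>j<m. A $$ (i, j) \<in> creation_polys"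
    have "\<forall>i j. \<exists>q. i < m \<longrightarrow> j < m \<longrightarrow> q \<in> nc_polys \<and> A $$ (i, j) = nc_eval creation q"
      using e by (auto simp: creation_polys_def)
    then obtain q where q: "\<And>i j. \<lbrakk>i < m; j < m\<rbrakk> \<Longrightarrow> q i j \<in> nc_polys"
      and Aq: "\<And>i j. \<lbrakk>i < m; j < m\<rbrakk> \<Longrightarrow> A $$ (i, j) = nc_eval creation (q i j)" by metis
    have "mat_op A = mat_eval m creation q" by (rule mat_op_eq_mat_eval[OF A Aq])
    moreover have "mat_op (map_mat (Psi \<rho> T) A) = mat_eval m T (\<lambda>i j. psi_poly \<rho> (q i j))"
      using q A by (intro mat_op_eq_mat_eval) (auto simp: Aq Psi_nc_eval nc_eval_psi)
    ultimately show "opnorm (ampliation m H) (mat_op (map_mat (Psi \<rho> T) A)) \<le> opnorm (ampliation m fock) (mat_op A)"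
      using pc m q by (simp add: poly_contractive_def)
  qed
qed

lemma nc_meval_eq_mat_eval:
  assumes p: "p \<in> nc_mpolys m"
  shows "nc_meval m T p = mat_eval m T (\<lambda>i j \<alpha>. p \<alpha> $$ (i, j))"
proof (intro ext)
  fix x i
  define W where "W = {\<alpha>. p \<alpha> \<noteq> 0\<^sub>m m m}"
  have W: "finite W" and pc: "\<And>\<alpha>. p \<alpha> \<in> carrier_mat m m" using p by (auto simp: nc_mpolys_def W_def)
  have "nc_meval m T p x i = (\<Sum>\<alpha>\<in>W. op_tensor (word_op T \<alpha>) (p \<alpha>) x i)"
    by (simp add: nc_meval_def sum_fun_apply W_def)
  also have "\<dots> = (\<Sum>\<alpha>\<in>W. if i < m then \<Sum>j<m. p \<alpha> $$ (i, j) *\<^sub>C word_op T \<alpha> (x j) else 0)"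
    using carrier_matD[OF pc] by (intro sum.cong refl) (simp add: op_tensor_def mat_op_def)
  also have "\<dots> = mat_eval m T (\<lambda>i j \<alpha>. p \<alpha> $$ (i, j)) x i"
  proof (cases "i < m")
    case True
    then have "(\<Sum>\<alpha>\<in>W. p \<alpha> $$ (i, j) *\<^sub>C word_op T \<alpha> (x j)) = nc_eval T (\<lambda>\<alpha>. p \<alpha> $$ (i, j)) (x j)"
      if "j < m" for j
      using that W by (intro nc_eval_eq_sum[symmetric]) (auto simp: W_def)
    then show ?thesis using True by (simp add: mat_eval_def sum.swap[of _ "{..<m}" W])
  qed (simp add: mat_eval_def)
  finally show "nc_meval m T p x i = mat_eval m T (\<lambda>i j \<alpha>. p \<alpha> $$ (i, j)) x i" .
qed

lemma nc_mpolys_entry: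
  "\<lbrakk>p \<in> nc_mpolys m; i < m; j < m\<rbrakk> \<Longrightarrow> (\<lambda>\<alpha>. p \<alpha> $$ (i, j)) \<in> nc_polys"
  by (auto simp: nc_mpolys_def nc_polys_def elim!: finite_subset[rotated])

lemma nc_meval_affine:
  assumes p: "p \<in> nc_mpolys m"
  shows "complex_of_real \<rho> *\<^sub>C nc_meval m T p + complex_of_real (1 - \<rho>) *\<^sub>C nc_mconst p
    = mat_eval m T (\<lambda>i j. psi_poly (1 / \<rho>) (\<lambda>\<alpha>. p \<alpha> $$ (i, j)))"
proof (intro ext)
  fix x i
  have "p [] \<in> carrier_mat m m" using p by (simp add: nc_mpolys_def)
  then show "(complex_of_real \<rho> *\<^sub>C nc_meval m T p + complex_of_real (1 - \<rho>) *\<^sub>C nc_mconst p) x i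
    = mat_eval m T (\<lambda>i j. psi_poly (1 / \<rho>) (\<lambda>\<alpha>. p \<alpha> $$ (i, j))) x i"
    unfolding nc_meval_eq_mat_eval[OF p]
    by (auto simp: mat_eval_def nc_mconst_def op_tensor_def mat_op_def
        nc_eval_psi[OF nc_mpolys_entry[OF p]] complex_vector.scale_sum_right sum.distrib scaleC_scaleC)
qed

text \<open>Substitute \<open>psi_poly \<rho>\<close> of the entries of \<open>q\<close> for those
  of \<open>p\<close>: then \<open>\<rho> p(S) + (1 - \<rho>) p(0)\<close> is \<open>q(S)\<close>,
  because by \<open>nc_meval_affine\<close> this expression is \<open>psi_poly\<close> with the
  inverse parameter.\<close>

lemma von_neumann_iff:
  fixes T :: "'n \<Rightarrow> 'h \<Rightarrow> 'h::complex_vector"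
  assumes \<rho>: "\<rho> > 0"
  shows "(\<forall>m\<ge>1. \<forall>p\<in>nc_mpolys m.
              opnorm (ampliation m H) (nc_meval m T p)
              \<le> opnorm (ampliation m fock)
                   (complex_of_real \<rho> *\<^sub>C nc_meval m creation p
                    + complex_of_real (1 - \<rho>) *\<^sub>C nc_mconst p))
         \<longleftrightarrow> poly_contractive \<rho> H T"
proof
  assume vN: "\<forall>m\<ge>1. \<forall>p\<in>nc_mpolys m.
              opnorm (ampliation m H) (nc_meval m T p)
              \<le> opnorm (ampliation m fock)
                   (complex_of_real \<rho> *\<^sub>C nc_meval m creation p
                    + complex_of_real (1 - \<rho>) *\<^sub>C nc_mconst p)"
  show "poly_contractive \<rho> H T"
    unfolding poly_contractive_def
  proof (intro allI impI)
    fix m and q :: "nat \<Rightarrow> nat \<Rightarrow> 'n list \<Rightarrow> complex"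
    assume m: "1 \<le> m" and q: "\<forall>i<m. \<forall>j<m. q i j \<in> nc_polys"
    define p where "p \<alpha> = mat m m (\<lambda>(i, j). psi_poly \<rho> (q i j) \<alpha>)" for \<alpha>
    have "{\<alpha>. p \<alpha> \<noteq> 0\<^sub>m m m} \<subseteq> (\<Union>i<m. \<Union>j<m. {\<alpha>. psi_poly \<rho> (q i j) \<alpha> \<noteq> 0})"
      by (auto simp: p_def mat_eq_iff)
    moreover have "finite (\<Union>i<m. \<Union>j<m. {\<alpha>. psi_poly \<rho> (q i j) \<alpha> \<noteq> 0})"
      using q psi_poly_mem by (auto simp: nc_polys_def)
    ultimately have p: "p \<in> nc_mpolys m"
      by (auto simp: nc_mpolys_def p_def intro: finite_subset)
    have e: "(\<lambda>\<alpha>. p \<alpha> $$ (i, j)) = psi_poly \<rho> (q i j)" if "i < m" "j < m" for i j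
      using that by (simp add: p_def)
    have "nc_meval m T p = mat_eval m T (\<lambda>i j. psi_poly \<rho> (q i j))"
      unfolding nc_meval_eq_mat_eval[OF p] by (rule mat_eval_cong) (simp add: e)
    moreover have "complex_of_real \<rho> *\<^sub>C nc_meval m creation p + complex_of_real (1 - \<rho>) *\<^sub>C nc_mconst p
        = mat_eval m creation q"
      unfolding nc_meval_affine[OF p] by (rule mat_eval_cong) (simp add: e psi_poly_inverse[OF \<rho>])
    ultimately show "opnorm (ampliation m H) (mat_eval m T (\<lambda>i j. psi_poly \<rho> (q i j)))
        \<le> opnorm (ampliation m fock) (mat_eval m creation q)"
      using vN m p by metis
  qed
next
  assume pc: "poly_contractive \<rho> H T"
  show "\<forall>m\<ge>1. \<forall>p\<in>nc_mpolys m.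
              opnorm (ampliation m H) (nc_meval m T p)
              \<le> opnorm (ampliation m fock)
                   (complex_of_real \<rho> *\<^sub>C nc_meval m creation p
                    + complex_of_real (1 - \<rho>) *\<^sub>C nc_mconst p)"
  proof (intro allI impI ballI)
    fix m and p :: "'n list \<Rightarrow> complex mat"
    assume m: "1 \<le> m" and p: "p \<in> nc_mpolys m"
    have "psi_poly \<rho> (psi_poly (1 / \<rho>) r) = r" for r :: "'n list \<Rightarrow> complex"
      using psi_poly_inverse[of "1 / \<rho>" r] \<rho> by simp
    then show "opnorm (ampliation m H) (nc_meval m T p)
              \<le> opnorm (ampliation m fock)
                   (complex_of_real \<rho> *\<^sub>C nc_meval m creation p
                    + complex_of_real (1 - \<rho>) *\<^sub>C nc_mconst p)"
      using pc[unfolded poly_contractive_def, rule_format, OF m,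
          of "\<lambda>i j. psi_poly (1 / \<rho>) (\<lambda>\<alpha>. p \<alpha> $$ (i, j))"]
      unfolding nc_meval_affine[OF p] unfolding nc_meval_eq_mat_eval[OF p]
      by (simp add: psi_poly_mem nc_mpolys_entry[OF p])
  qed
qed

subsection \<open>Positivity of the Toeplitz kernel\<close>

lemma nc_eval_single: "nc_eval T (\<lambda>\<gamma>. if \<gamma> = \<delta> then c else 0) x = c *\<^sub>C word_op T \<delta> x"
proof -
  have "nc_eval T (\<lambda>\<gamma>. if \<gamma> = \<delta> then c else 0) x
      = (\<Sum>\<gamma>\<in>{\<delta>}. (if \<gamma> = \<delta> then c else 0) *\<^sub>C word_op T \<gamma> x)"
    by (rule nc_eval_eq_sum) auto
  then show ?thesis by simp
qed

text \<open>
  With \<open>q\<close> the entrywise image of this matrix under \<open>psi_poly\<close>, \<open>q(T) + q(T)\<^sup>*\<close> is the Toeplitz kernel matrix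
  of the words \<open>w 0, \<dots>, w (m - 1)\<close>.
\<close>

definition toeplitz_poly :: "(nat \<Rightarrow> 'n list) \<Rightarrow> nat \<Rightarrow> nat \<Rightarrow> 'n list \<Rightarrow> complex" where
  "toeplitz_poly w i j = (\<lambda>\<gamma>.
     if w j = w i @ \<gamma> then (if \<gamma> = [] then 1 / 2 else 1) else 0)"

lemma toeplitz_poly_prefix:
  assumes "prefix (w i) (w j)"
  shows "toeplitz_poly w i j = (\<lambda>\<gamma>. if \<gamma> = drop (length (w i)) (w j)
           then if w i = w j then 1 / 2 else 1 else 0)"
  using assms by (auto simp: toeplitz_poly_def prefix_def)

lemma toeplitz_poly_not_prefix: "\<not> prefix (w i) (w j) \<Longrightarrow> toeplitz_poly w i j = (\<lambda>\<gamma>. if \<gamma> = [] then 0 else 0)"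
  by (auto simp: toeplitz_poly_def prefix_def)

lemma toeplitz_poly_mem: "toeplitz_poly w i j \<in> nc_polys"
  by (cases "prefix (w i) (w j)") (simp_all add: nc_polys_def toeplitz_poly_prefix toeplitz_poly_not_prefix)

lemma nc_eval_toeplitz_poly:
  "nc_eval T (psi_poly \<rho> (toeplitz_poly w i j)) x =
     (if w i = w j then (1 / 2) *\<^sub>C x
      else if prefix (w i) (w j) then complex_of_real (1 / \<rho>) *\<^sub>C word_op T (drop (length (w i)) (w j)) x
      else 0)"
proof -
  have "psi_poly \<rho> (toeplitz_poly w i j) =
     (if w i = w j then (\<lambda>\<gamma>. if \<gamma> = [] then 1 / 2 else 0)
      else if prefix (w i) (w j)
        then (\<lambda>\<gamma>. if \<gamma> = drop (length (w i)) (w j) then complex_of_real (1 / \<rho>) else 0)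
      else (\<lambda>\<gamma>. if \<gamma> = [] then 0 else 0))"
    by (auto simp: psi_poly_def toeplitz_poly_def prefix_def fun_eq_iff)
  then show ?thesis by (simp only: nc_eval_single split: if_split) simp
qed

text \<open>On the diagonal two halves add up. Off the diagonal at most one summand is nonzero,
  since distinct words cannot be prefixes of each other.\<close>

lemma (in bounded_tuple) toeplitz_kernel_eq:
  fixes \<rho> :: real and w :: "nat \<Rightarrow> 'n list"
  defines "d i j x y \<equiv> hinner H (nc_eval T (psi_poly \<rho> (toeplitz_poly w i j)) x) y"
  assumes "x \<in> hspace H" "y \<in> hspace H"
  shows "toeplitz_kernel \<rho> H T (w j) (w i) x y = d i j x y + cnj (d j i y x)"
proof -
  have "\<not> (prefix (w i) (w j) \<and> prefix (w j) (w i))" if "w i \<noteq> w j"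
    using that by (auto dest: prefix_order.antisym)
  then show ?thesis
    using assms(2,3) inner_cnj[of x y] inner_cnj[of x "word_op T (drop (length (w j)) (w i)) y"]
    unfolding d_def nc_eval_toeplitz_poly
    by (auto simp: toeplitz_kernel_def word_mem inner_scale inner_scale_right)
qed

lemma (in bounded_tuple) toeplitz_kernel_sum:
  assumes x: "x \<in> hspace (ampliation m H)"
  shows "Re (\<Sum>i<m. \<Sum>j<m. toeplitz_kernel \<rho> H T (w j) (w i) (x j) (x i))
    = 2 * Re (hinner (ampliation m H) (mat_eval m T (\<lambda>i j. psi_poly \<rho> (toeplitz_poly w i j)) x) x)"
proof -
  define d where "d i j = hinner H (nc_eval T (psi_poly \<rho> (toeplitz_poly w i j)) (x j)) (x i)" for i j
  have xm: "x i \<in> hspace H" if "i < m" for i using x that by (simp add: hspace_ampliation)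
  have "(\<Sum>i<m. \<Sum>j<m. toeplitz_kernel \<rho> H T (w j) (w i) (x j) (x i))
      = (\<Sum>i<m. \<Sum>j<m. d i j + cnj (d j i))"
    by (intro sum.cong refl) (simp add: toeplitz_kernel_eq xm d_def)
  also have "\<dots> = (\<Sum>i<m. \<Sum>j<m. d i j) + cnj (\<Sum>j<m. \<Sum>i<m. d j i)"
    unfolding sum.distrib cnj_sum by (intro arg_cong2[where f = plus] refl sum.swap)
  finally have "Re (\<Sum>i<m. \<Sum>j<m. toeplitz_kernel \<rho> H T (w j) (w i) (x j) (x i))
      = 2 * Re (\<Sum>i<m. \<Sum>j<m. d i j)" by simp
  also have "(\<Sum>i<m. \<Sum>j<m. d i j)
      = hinner (ampliation m H) (mat_eval m T (\<lambda>i j. psi_poly \<rho> (toeplitz_poly w i j)) x) x"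
    unfolding hinner_ampliation
  proof (rule sum.cong[OF refl])
    fix i assume "i \<in> {..<m}"
    then show "(\<Sum>j<m. d i j)
        = hinner H (mat_eval m T (\<lambda>i j. psi_poly \<rho> (toeplitz_poly w i j)) x i) (x i)"
      by (subst mat_eval_def) (auto simp: d_def intro!: inner_sum[symmetric] nc_eval_mem T_mem xm)
  qed
  finally show ?thesis .
qed

text \<open>Equal first letters cancel and distinct ones give 0, which is the recursion
  \<open>kernel_Cons\<close>; when one word is exhausted, the other is the remaining power of
  \<open>V\<close>.\<close>

lemma (in row_isometry) hinner_word_word:
  assumes x: "x \<in> hspace G" and y: "y \<in> hspace G"
  shows "hinner G (word_op V \<alpha> x) (word_op V \<beta> y) = toeplitz_kernel 1 G V \<alpha> \<beta> x y"
proof (induction \<alpha> arbitrary: \<beta>)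
  case Nil
  then show ?case by (cases \<beta>) (simp_all add: toeplitz_kernel_def)
next
  case (Cons i \<alpha>)
  show ?case
  proof (cases \<beta>)
    case Nil
    then show ?thesis by (simp add: toeplitz_kernel_def)
  next
    case (Cons j \<beta>')
    then show ?thesis
      using Cons.IH[of \<beta>'] x y
      by (cases "i = j") (simp_all add: hinner_V orthogonal_ranges word_mem toeplitz_kernel_def)
  qed
qed

text \<open>Twice this real part is the squared norm of the sum of the vectors
  \<open>S_{w j} x_j\<close>. The kernel for the creation operators has parameter 1, where
  \<open>psi_poly\<close> is the identity.\<close>

lemma toeplitz_poly_creation_accretive:
  fixes w :: "nat \<Rightarrow> 'n list"
  assumes x: "x \<in> hspace (ampliation m fock)"
  shows "0 \<le> Re (hinner (ampliation m fock) (mat_eval m creation (toeplitz_poly w) x) x)"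
proof -
  interpret F: row_isometry fock "creation :: 'n \<Rightarrow> _" by (rule row_isometry_creation)
  interpret B: bounded_tuple fock "creation :: 'n \<Rightarrow> _"
    by unfold_locales (rule isometric_opD(1)[OF creation_isometric])
  have xm: "x i \<in> hspace fock" if "i < m" for i using x that by (simp add: hspace_ampliation)
  define s where "s = (\<Sum>j<m. word_op creation (w j) (x j))"
  have s: "s \<in> hspace fock" unfolding s_def by (intro F.sum_mem F.word_mem xm) simp
  have "hinner fock s s = (\<Sum>i<m. \<Sum>j<m. hinner fock (word_op creation (w j) (x j)) (word_op creation (w i) (x i)))"
  proof -
    have "hinner fock s s = (\<Sum>i<m. hinner fock s (word_op creation (w i) (x i)))"
      unfolding s_def[THEN arg_cong[where f = "hinner fock s"]]
      by (rule F.inner_sum_right) (auto intro: F.word_mem xm s)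
    also have "\<dots> = (\<Sum>i<m. \<Sum>j<m. hinner fock (word_op creation (w j) (x j)) (word_op creation (w i) (x i)))"
      unfolding s_def by (intro sum.cong refl F.inner_sum) (auto intro: F.word_mem xm)
    finally show ?thesis .
  qed
  also have "\<dots> = (\<Sum>i<m. \<Sum>j<m. toeplitz_kernel 1 fock creation (w j) (w i) (x j) (x i))"
    by (intro sum.cong refl) (simp add: F.hinner_word_word xm)
  finally have "Re (\<Sum>i<m. \<Sum>j<m. toeplitz_kernel 1 fock creation (w j) (w i) (x j) (x i)) \<ge> 0"
    using F.inner_self_nonneg[OF s] by simp
  then show ?thesis
    using B.toeplitz_kernel_sum[OF x, of 1 w] by (simp add: psi_poly_one del: Re_sum)
qed

text \<open>Realises \<open>1 + c A\<close> by a matrix of polynomials, to which contractivity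
  applies. \<open>x\<close> has to vanish from \<open>m\<close> on because values of
  \<open>mat_eval\<close> do.\<close>

lemma mat_eval_perturb:
  assumes q: "\<And>i j. \<lbrakk>i < m; j < m\<rbrakk> \<Longrightarrow> q i j \<in> nc_polys" and x: "\<And>i. i \<ge> m \<Longrightarrow> x i = 0"
  shows "mat_eval m T (\<lambda>i j \<alpha>. (if \<alpha> = [] then of_bool (i = j) else 0) + c * q i j \<alpha>) x
       = x + c *\<^sub>C mat_eval m T q x"
proof
  fix i
  show "mat_eval m T (\<lambda>i j \<alpha>. (if \<alpha> = [] then of_bool (i = j) else 0) + c * q i j \<alpha>) x i
       = (x + c *\<^sub>C mat_eval m T q x) i"
  proof (cases "i < m")
    case True
    have "(\<Sum>j<m. of_bool (i = j) *\<^sub>C x j) = (\<Sum>j<m. if j = i then x i else 0)"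
      by (intro sum.cong refl) (simp add: scaleC_one)
    then show ?thesis
      using True by (simp add: mat_eval_def nc_eval_affine[OF q] sum.distrib complex_vector.scale_sum_right)
  qed (simp add: mat_eval_def x)
qed

text \<open>
  An operator \<open>A\<close> has nonnegative real part iff \<open>\<parallel>1 - t A\<parallel>\<^sup>2 \<le> 1 + O(t\<^sup>2)\<close> as \<open>t \<rightarrow> 0\<close>, so a unital
  contraction preserves nonnegativity of the real part.
\<close>

lemma (in bounded_tuple) accretive_transfer:
  fixes q :: "nat \<Rightarrow> nat \<Rightarrow> 'n list \<Rightarrow> complex"
  assumes pc: "poly_contractive \<rho> H T" and m: "m \<ge> 1"
    and q: "\<And>i j. \<lbrakk>i < m; j < m\<rbrakk> \<Longrightarrow> q i j \<in> nc_polys"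
    and acc: "\<And>x. x \<in> hspace (ampliation m fock) \<Longrightarrow>
        0 \<le> Re (hinner (ampliation m fock) (mat_eval m creation q x) x)"
    and h: "h \<in> hspace (ampliation m H)"
  shows "0 \<le> Re (hinner (ampliation m H) (mat_eval m T (\<lambda>i j. psi_poly \<rho> (q i j)) h) h)"
proof -
  interpret F: hilbert_space "fock :: ('n list \<Rightarrow> complex) hilb" by (rule hilbert_space_fock)
  interpret FA: hilbert_space "ampliation m (fock :: ('n list \<Rightarrow> complex) hilb)"
    by (rule hilbert_space_ampliation) (rule hilbert_space_fock)
  interpret HA: hilbert_space "ampliation m H"
    by (rule hilbert_space_ampliation) (rule hilbert_space_axioms)
  let ?F = "ampliation m (fock :: ('n list \<Rightarrow> complex) hilb)" and ?H = "ampliation m H"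
  have cb: "bounded_op fock fock (creation i)" for i :: 'n
    by (rule isometric_opD(1)[OF creation_isometric])
  let ?A = "mat_eval m creation q" and ?B = "mat_eval m T (\<lambda>i j. psi_poly \<rho> (q i j))"
  have A: "bounded_op ?F ?F ?A" by (rule F.bounded_op_mat_eval[OF cb])
  have B: "bounded_op ?H ?H ?B" by (rule bounded_op_mat_eval[of T, OF bounded])
  obtain M where M: "0 \<le> M" "\<And>x. x \<in> hspace ?F \<Longrightarrow> hnorm ?F (?A x) \<le> M * hnorm ?F x"
    using FA.bounded_opE[OF A] by blast
  define b where "b = Re (hinner ?H (?B h) h)"
  \<comment> \<open>Comparing squared norms gives
    \<open>- 2 t b \<le> t\<^sup>2 M\<^sup>2 |h|\<^sup>2\<close>; dividing by \<open>2 t\<close>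
    leaves \<open>t * N\<close>.\<close>
  define N where "N = M\<^sup>2 * (hnorm ?H h)\<^sup>2 / 2"
  have key: "- (t * N) \<le> b" if t: "t > 0" for t
  proof -
    define p where "p = (\<lambda>i j \<alpha>. (if \<alpha> = [] then of_bool (i = j) else 0) + complex_of_real (- t) * q i j \<alpha>)"
    \<comment> \<open>In the square of the norm of \<open>x - t A x\<close> the cross term is
      nonpositive by \<open>acc\<close>, so only \<open>t\<^sup>2 M\<^sup>2\<close> is added to
      1.\<close>
    define K where "K = sqrt (1 + t\<^sup>2 * M\<^sup>2)"
    have p: "p i j \<in> nc_polys" if "i < m" "j < m" for i j
    proof -
      have "{\<alpha>. p i j \<alpha> \<noteq> 0} \<subseteq> insert [] {\<alpha>. q i j \<alpha> \<noteq> 0}" by (auto simp: p_def)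
      then show ?thesis using q[OF that] by (auto simp: nc_polys_def intro: finite_subset)
    qed
    have pF: "mat_eval m creation p x = x - complex_of_real t *\<^sub>C ?A x" if "x \<in> hspace ?F" for x
      using mat_eval_perturb[where m = m and q = q and x = x and c = "complex_of_real (- t)"] q that
      unfolding p_def by (simp add: hspace_ampliation)
    \<comment> \<open>Here unitality enters: \<open>psi_poly\<close> leaves constant terms alone, so
      the identity goes to the identity.\<close>
    have psi_p: "psi_poly \<rho> (p i j)
        = (\<lambda>\<alpha>. (if \<alpha> = [] then of_bool (i = j) else 0) + complex_of_real (- t) * psi_poly \<rho> (q i j) \<alpha>)" for i j
      by (auto simp: psi_poly_def p_def)
    have pH: "mat_eval m T (\<lambda>i j. psi_poly \<rho> (p i j)) h = h - complex_of_real t *\<^sub>C ?B h"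
      using mat_eval_perturb[where m = m and q = "\<lambda>i j. psi_poly \<rho> (q i j)" and x = h and T = T
          and c = "complex_of_real (- t)"] q h
      unfolding psi_p by (simp add: hspace_ampliation psi_poly_mem)
    have "opnorm ?F (mat_eval m creation p) \<le> K"
    proof (rule FA.opnorm_leI)
      show "0 \<le> K" by (simp add: K_def)
      fix x assume x: "x \<in> hspace ?F"
      have Ax: "?A x \<in> hspace ?F" by (rule bounded_opD(1)[OF A x])
      have "Re (hinner ?F x (?A x)) \<ge> 0" using acc[OF x] FA.inner_cnj[OF Ax x] by simp
      then have "0 \<le> t * Re (hinner ?F x (?A x))" using t by simp
      moreover have "(hnorm ?F (?A x))\<^sup>2 \<le> M\<^sup>2 * (hnorm ?F x)\<^sup>2"
        using power_mono[OF M(2)[OF x] FA.hnorm_nonneg[OF Ax], of 2] by (simp add: power_mult_distrib)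
      then have "t\<^sup>2 * (hnorm ?F (?A x))\<^sup>2 \<le> t\<^sup>2 * (M\<^sup>2 * (hnorm ?F x)\<^sup>2)" by (rule mult_left_mono) simp
      ultimately have "(hnorm ?F (mat_eval m creation p x))\<^sup>2 \<le> (1 + t\<^sup>2 * M\<^sup>2) * (hnorm ?F x)\<^sup>2"
        unfolding pF[OF x] using x Ax
        by (simp add: FA.hnorm_diff_sq FA.inner_scale_right FA.hnorm_scale power_mult_distrib distrib_right)
      also have "\<dots> = (K * hnorm ?F x)\<^sup>2" by (simp add: K_def power_mult_distrib)
      finally show "hnorm ?F (mat_eval m creation p x) \<le> K * hnorm ?F x"
        by (rule power2_le_imp_le) (simp add: K_def FA.hnorm_nonneg x)
    qed
    moreover have "opnorm ?H (mat_eval m T (\<lambda>i j. psi_poly \<rho> (p i j))) \<le> opnorm ?F (mat_eval m creation p)"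
      using pc m p by (simp add: poly_contractive_def)
    ultimately have K: "opnorm ?H (mat_eval m T (\<lambda>i j. psi_poly \<rho> (p i j))) \<le> K" by simp
    have Bh: "?B h \<in> hspace ?H" by (rule bounded_opD(1)[OF B h])
    have hn: "0 \<le> hnorm ?H (h - complex_of_real t *\<^sub>C ?B h)"
      using h Bh by (intro HA.hnorm_nonneg) simp
    have "hnorm ?H (h - complex_of_real t *\<^sub>C ?B h)
        \<le> opnorm ?H (mat_eval m T (\<lambda>i j. psi_poly \<rho> (p i j))) * hnorm ?H h"
      using HA.le_opnorm[OF bounded_op_mat_eval[of T m "\<lambda>i j. psi_poly \<rho> (p i j)", OF bounded] h] pH by simp
    also have "\<dots> \<le> K * hnorm ?H h" using K HA.hnorm_nonneg[OF h] by (rule mult_right_mono)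
    finally have "(hnorm ?H (h - complex_of_real t *\<^sub>C ?B h))\<^sup>2 \<le> (K * hnorm ?H h)\<^sup>2"
      using hn by (rule power_mono)
    moreover have "(K * hnorm ?H h)\<^sup>2 = (1 + t\<^sup>2 * M\<^sup>2) * (hnorm ?H h)\<^sup>2"
      by (simp add: K_def power_mult_distrib)
    moreover have "(hnorm ?H (h - complex_of_real t *\<^sub>C ?B h))\<^sup>2
        = (hnorm ?H h)\<^sup>2 - 2 * t * b + t\<^sup>2 * (hnorm ?H (?B h))\<^sup>2"
      using h Bh HA.inner_cnj[OF Bh h]
      by (simp add: HA.hnorm_diff_sq HA.inner_scale_right HA.hnorm_scale power_mult_distrib b_def)
    moreover have "0 \<le> t\<^sup>2 * (hnorm ?H (?B h))\<^sup>2" by simp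
    ultimately have "t * (- 2 * b) \<le> t * (t * M\<^sup>2 * (hnorm ?H h)\<^sup>2)"
      by (simp add: algebra_simps power2_eq_square)
    then have "- 2 * b \<le> t * M\<^sup>2 * (hnorm ?H h)\<^sup>2" using t by (simp only: mult_le_cancel_left_pos)
    then show ?thesis by (simp add: N_def)
  qed
  have "0 \<le> b"
  proof (rule tendsto_upperbound)
    show "((\<lambda>t. - (t * N)) \<longlongrightarrow> 0) (at_right 0)" by (auto intro!: tendsto_eq_intros)
    show "\<forall>\<^sub>F t in at_right 0. - (t * N) \<le> b"
      using eventually_at_right_less[of 0] by eventually_elim (rule key)
  qed simp
  then show ?thesis by (simp add: b_def)
qed

text \<open>Enumerating the support of \<open>f\<close> turns the form into twice the real part of
  one operator matrix, whose nonnegativity is inherited from the creation operators.\<close>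

lemma (in bounded_tuple) toeplitz_form_nonneg:
  assumes pc: "poly_contractive \<rho> H T" and f: "f \<in> word_families H"
  shows "0 \<le> Re (toeplitz_form \<rho> H T f f)"
proof -
  define W where "W = {\<alpha>. f \<alpha> \<noteq> 0}"
  have W: "finite W" and fm: "\<And>\<alpha>. f \<alpha> \<in> hspace H" using f by (auto simp: W_def word_families_def)
  define m where "m = card W"
  obtain w where w: "bij_betw w {..<m} W"
    using ex_bij_betw_nat_finite[OF W] by (auto simp: m_def atLeast0LessThan)
  define h where "h = (\<lambda>j. if j < m then f (w j) else 0)"
  have h: "h \<in> hspace (ampliation m H)" by (simp add: h_def hspace_ampliation fm)
  have "toeplitz_form \<rho> H T f f = (\<Sum>\<alpha>\<in>W. \<Sum>\<beta>\<in>W. toeplitz_kernel \<rho> H T \<alpha> \<beta> (f \<alpha>) (f \<beta>))"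
    by (simp add: toeplitz_form_def W_def)
  also have "\<dots> = (\<Sum>j<m. \<Sum>i<m. toeplitz_kernel \<rho> H T (w j) (w i) (f (w j)) (f (w i)))"
    by (simp add: sum.reindex_bij_betw[OF w, symmetric])
  also have "\<dots> = (\<Sum>i<m. \<Sum>j<m. toeplitz_kernel \<rho> H T (w j) (w i) (h j) (h i))"
    by (subst sum.swap) (simp add: h_def)
  finally have eq: "Re (toeplitz_form \<rho> H T f f)
      = 2 * Re (hinner (ampliation m H) (mat_eval m T (\<lambda>i j. psi_poly \<rho> (toeplitz_poly w i j)) h) h)"
    by (simp only: toeplitz_kernel_sum[OF h])
  show ?thesis
  \<comment> \<open>\<open>poly_contractive\<close> starts at \<open>m = 1\<close>; empty support,
    that is the zero family, is settled directly.\<close>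
  proof (cases "m = 0")
    case True
    then show ?thesis by (simp add: eq hinner_ampliation)
  next
    case False
    then have "0 \<le> Re (hinner (ampliation m H)
        (mat_eval m T (\<lambda>i j. psi_poly \<rho> (toeplitz_poly w i j)) h) h)"
      by (intro accretive_transfer pc h toeplitz_poly_mem toeplitz_poly_creation_accretive) simp_all
    then show ?thesis by (simp add: eq)
  qed
qed

subsection \<open>Dilations\<close>

text \<open>The operator in question is the compression of \<open>q(V)\<close> to the image of
  \<open>J\<close>, so \<open>von_neumann_form_bound\<close> for \<open>V\<close> bounds its form;
  \<open>norm_le_of_form_le\<close> turns this into the norm estimate.\<close>

lemma poly_contractive_of_class_C:
  fixes T :: "'n::finite \<Rightarrow> 'h \<Rightarrow> 'h::complex_vector"
  assumes H: "hilbert_space H" and \<rho>: "\<rho> > 0" and T: "\<And>i. bounded_op H H (T i)"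
    and C: "class_C \<rho> H T"
  shows "poly_contractive \<rho> H T"
  unfolding poly_contractive_def
proof (intro allI impI)
  fix m and q :: "nat \<Rightarrow> nat \<Rightarrow> 'n list \<Rightarrow> complex"
  assume m: "1 \<le> m" and q: "\<forall>i<m. \<forall>j<m. q i j \<in> nc_polys"
  obtain G :: "('n list \<times> 'h \<Rightarrow> complex) hilb" and J V where dil: "rho_dilation \<rho> H T G J V"
    using C unfolding class_C_def by blast
  have G: "hilbert_space G" and J: "isometric_op H G J" and V: "\<And>i. isometric_op G G (V i)"
    and orth: "\<And>i j x y. \<lbrakk>i \<noteq> j; x \<in> hspace G; y \<in> hspace G\<rbrakk> \<Longrightarrow> hinner G (V i x) (V j y) = 0"
    and dilT: "\<And>\<alpha> h. \<lbrakk>\<alpha> \<noteq> []; h \<in> hspace H\<rbrakk> \<Longrightarrow> J (word_op T \<alpha> h)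
          = complex_of_real \<rho> *\<^sub>C orth_proj G (J ` hspace H) (word_op V \<alpha> (J h))"
    using dil by (auto simp: rho_dilation_def)
  interpret B: bounded_tuple H T by (intro bounded_tuple.intro H bounded_tuple_axioms.intro T)
  interpret R: finite_row_isometry G V
    by (intro finite_row_isometry.intro row_isometry.intro row_isometry_axioms.intro G V orth)
  interpret F: hilbert_space "fock :: ('n list \<Rightarrow> complex) hilb" by (rule hilbert_space_fock)
  let ?F = "ampliation m (fock :: ('n list \<Rightarrow> complex) hilb)" and ?H = "ampliation m H"
  interpret FA: hilbert_space ?F by (rule hilbert_space_ampliation) (rule hilbert_space_fock)
  interpret HA: hilbert_space ?H by (rule hilbert_space_ampliation) (rule H)
  define c where "c = opnorm ?F (mat_eval m creation q)"
  have S: "bounded_op ?F ?F (mat_eval m creation q)"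
    by (rule F.bounded_op_mat_eval) (rule isometric_opD(1)[OF creation_isometric])
  have c0: "0 \<le> c" unfolding c_def by (rule FA.opnorm_nonneg[OF S])
  have fb: "fock_bounded_polynomial m q c"
    using q c0 FA.le_opnorm[OF S] by (intro fock_bounded_polynomial.intro) (auto simp: c_def)
  note Jm = bounded_opD(1)[OF isometric_opD(1)[OF J]]
  have word: "complex_of_real \<rho> * hinner G (word_op V \<alpha> (J h)) (J k) = hinner H (word_op T \<alpha> h) k"
    if \<alpha>: "\<alpha> \<noteq> []" and h: "h \<in> hspace H" and k: "k \<in> hspace H" for \<alpha> h k
  proof -
    define y where "y = orth_proj G (J ` hspace H) (word_op V \<alpha> (J h))"
    have v: "word_op V \<alpha> (J h) \<in> hspace G" by (rule R.word_mem[OF Jm[OF h]])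
    note P = orth_proj_range_isometry[OF H G J v]
    have yG: "y \<in> hspace G" using P(1) Jm by (auto simp: y_def)
    have "hinner G (word_op V \<alpha> (J h) - y) (J k) = 0" using P(2) k by (simp add: y_def)
    then have "hinner G (word_op V \<alpha> (J h)) (J k) = hinner G y (J k)"
      using v yG Jm[OF k] by (simp add: R.inner_diff)
    moreover have "hinner H (word_op T \<alpha> h) k = hinner G (J (word_op T \<alpha> h)) (J k)"
      using isometric_hinner[OF H G J B.word_mem[OF h] k] by simp
    ultimately show ?thesis
      using dilT[OF \<alpha> h] yG Jm[OF k] by (simp add: R.inner_scale flip: y_def)
  qed
  \<comment> \<open>For nonempty words the factor \<open>1 / \<rho>\<close> from
    \<open>psi_poly\<close> cancels the \<open>\<rho>\<close> of the dilation identity. The constant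
    term carries neither factor and is handled by \<open>J\<close> being isometric.\<close>
  have compress: "hinner H (nc_eval T (psi_poly \<rho> r) h) k = hinner G (nc_eval V r (J h)) (J k)"
    if r: "r \<in> nc_polys" and h: "h \<in> hspace H" and k: "k \<in> hspace H" for r h k
  proof -
    define W where "W = {\<alpha>. r \<alpha> \<noteq> 0}"
    have W: "finite W" using r by (simp add: W_def nc_polys_def)
    have "nc_eval T (psi_poly \<rho> r) h = (\<Sum>\<alpha>\<in>W. psi_poly \<rho> r \<alpha> *\<^sub>C word_op T \<alpha> h)"
      by (rule nc_eval_eq_sum[OF W]) (auto simp: W_def psi_poly_def)
    then have "hinner H (nc_eval T (psi_poly \<rho> r) h) k
        = (\<Sum>\<alpha>\<in>W. psi_poly \<rho> r \<alpha> * hinner H (word_op T \<alpha> h) k)"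
      using h k by (simp add: B.inner_sum B.inner_scale B.word_mem)
    also have "\<dots> = (\<Sum>\<alpha>\<in>W. r \<alpha> * hinner G (word_op V \<alpha> (J h)) (J k))"
    proof (rule sum.cong[OF refl])
      fix \<alpha>
      show "psi_poly \<rho> r \<alpha> * hinner H (word_op T \<alpha> h) k = r \<alpha> * hinner G (word_op V \<alpha> (J h)) (J k)"
        using \<rho> word[OF _ h k, of \<alpha>] isometric_hinner[OF H G J h k]
        by (cases "\<alpha> = []") (auto simp: psi_poly_def field_simps)
    qed
    also have "\<dots> = hinner G (\<Sum>\<alpha>\<in>W. r \<alpha> *\<^sub>C word_op V \<alpha> (J h)) (J k)"
      using Jm[OF h] Jm[OF k] by (simp add: R.inner_sum R.inner_scale R.word_mem)
    also have "(\<Sum>\<alpha>\<in>W. r \<alpha> *\<^sub>C word_op V \<alpha> (J h)) = nc_eval V r (J h)"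
      by (rule nc_eval_eq_sum[OF W, symmetric]) (simp add: W_def)
    finally show ?thesis .
  qed
  have norm_J: "(\<Sum>i<m. (hnorm G (J (x i)))\<^sup>2) = (hnorm ?H x)\<^sup>2" if "x \<in> hspace ?H" for x
    unfolding B.hnorm_ampliation[OF that]
    using that by (simp add: sum_nonneg hspace_ampliation isometric_opD(2)[OF J])
  have "opnorm ?H (mat_eval m T (\<lambda>i j. psi_poly \<rho> (q i j))) \<le> c"
  proof (rule HA.opnorm_leI[OF c0])
    fix x assume x: "x \<in> hspace ?H"
    show "hnorm ?H (mat_eval m T (\<lambda>i j. psi_poly \<rho> (q i j)) x) \<le> c * hnorm ?H x"
    proof (rule HA.norm_le_of_form_le[OF _ x c0])
      show "mat_eval m T (\<lambda>i j. psi_poly \<rho> (q i j)) x \<in> hspace ?H"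
        by (rule B.mat_eval_mem[of T, OF B.T_mem x])
      fix y assume y: "y \<in> hspace ?H"
      have xm: "x i \<in> hspace H" and ym: "y i \<in> hspace H" if "i < m" for i
        using x y that by (auto simp: hspace_ampliation)
      have "hinner ?H (mat_eval m T (\<lambda>i j. psi_poly \<rho> (q i j)) x) y
          = (\<Sum>i<m. \<Sum>j<m. hinner H (nc_eval T (psi_poly \<rho> (q i j)) (x j)) (y i))"
        unfolding hinner_ampliation
      proof (rule sum.cong[OF refl])
        fix i assume "i \<in> {..<m}"
        then show "hinner H (mat_eval m T (\<lambda>i j. psi_poly \<rho> (q i j)) x i) (y i)
            = (\<Sum>j<m. hinner H (nc_eval T (psi_poly \<rho> (q i j)) (x j)) (y i))"
          by (subst mat_eval_def) (auto intro!: B.inner_sum B.nc_eval_mem B.T_mem xm ym)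
      qed
      also have "\<dots> = (\<Sum>i<m. \<Sum>j<m. hinner G (nc_eval V (q i j) (J (x j))) (J (y i)))"
        using q by (intro sum.cong refl) (simp add: compress xm ym)
      finally show "Re (hinner ?H (mat_eval m T (\<lambda>i j. psi_poly \<rho> (q i j)) x) y)
          \<le> c / 2 * ((hnorm ?H x)\<^sup>2 + (hnorm ?H y)\<^sup>2)"
        using R.von_neumann_form_bound[OF fb, of "\<lambda>i. J (x i)" "\<lambda>i. J (y i)"] xm ym Jm
        by (simp add: norm_J[OF x] norm_J[OF y])
    qed
  qed
  then show "opnorm ?H (mat_eval m T (\<lambda>i j. psi_poly \<rho> (q i j))) \<le> opnorm ?F (mat_eval m creation q)"
    by (simp add: c_def)
qed

theorem theorem1p4:
  fixes H :: "'h::complex_vector hilb"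
    and T :: "'n::finite \<Rightarrow> 'h \<Rightarrow> 'h"
    and \<rho> :: real
  assumes "hilbert_space H"
    and "\<rho> > 0"
    and "\<And>i. bounded_op H H (T i)"
  shows "(class_C \<rho> H T \<longleftrightarrow>
           (\<forall>m\<ge>1. \<forall>p\<in>nc_mpolys m.
              opnorm (ampliation m H) (nc_meval m T p)
              \<le> opnorm (ampliation m fock)
                   (complex_of_real \<rho> *\<^sub>C nc_meval m creation p
                    + complex_of_real (1 - \<rho>) *\<^sub>C nc_mconst p)))
       \<and> (class_C \<rho> H T \<longleftrightarrow>
           completely_contractive fock H creation_polys (Psi \<rho> T))"
proof -
  interpret bounded_tuple H T by (intro bounded_tuple.intro bounded_tuple_axioms.intro assms)
  have "class_C \<rho> H T \<longleftrightarrow> poly_contractive \<rho> H T"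
    using poly_contractive_of_class_C[of H \<rho> T, OF assms] class_C_of_positive_form[OF assms(2)]
      toeplitz_form_nonneg by blast
  then show ?thesis by (simp only: von_neumann_iff[OF assms(2)] completely_contractive_iff)
qed

end
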